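(* Let $\mathcal G$ be an $S^*$-graph and $\mathrm{Obj}$ an object (of arbitrary degree). Set $\mathcal G_{\exp}=\mathrm{EXP}(\mathcal G)$. Then: (a) If $(w_1,s_1)$ and $(w_2,s_2)$ are configurations of $\mathcal G_{\exp}$ with $s_1,s_2\in S_{\mathcal G}$ and $(w_1,s_1,w_2,s_2)\in\mathrm{REACH}_{\mathcal G_{\exp}}$, then $w_1\in\mathrm{GL}_{\mathcal G}\times1^{\mathrm{inv}}_{\mathcal G}$ if and only if $w_2\in\mathrm{GL}_{\mathcal G}\times1^{\mathrm{inv}}_{\mathcal G}$. (b) For any computation $\delta=((w_0,s_0),e_1,(w_1,s_1),\dots,e_m,(w_m,s_m))$ of $\mathcal G_{\exp}$ with $(w_0,s_0),(w_m,s_m)\in(\mathrm{GL}_{\mathcal G}\times1^{\mathrm{inv}}_{\mathcal G})\times S_{\mathcal G}$, there exists a computation $\eta(\delta)=((w_0',s_0'),e_1',\dots,e_\ell',(w_\ell',s_\ell'))$ of $\mathcal G$ such that $w_0=w_0'\sqcup1^{\mathrm{inv}}_{\mathcal G}$, $w_m=w_\ell'\sqcup1^{\mathrm{inv}}_{\mathcal G}$, $s_0=s_0'$, $s_m=s_\ell'$, and $e_1',\dots,e_\ell'$ is a generic reduction of $e_1,\dots,e_m$. (c) Suppose $\delta=((w_0',s_0'),e_1',(w_1',s_1'))$ is a computation of $\mathcal G$ with $e_1'=(\mathrm{sf}_0,\mathrm{sf}_1,e)$, where $\mathrm{sf}_0,\mathrm{sf}_1\in\{\hat s,\hat f\}$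 and $e=(t_0,t_1,\mathrm{act}_e)\in E_{\mathcal G}-E^0_{\mathcal G}$, $\mathrm{act}_e=(\mathrm{inst}_e,\mathrm{op}_e,\mu^{\mathrm{ext}}_{\mathrm{act}_e})$. Write $\lambda_e=\lambda_{\mathrm{op}_e}$. Then $$\bigl(\mu_{\mathrm{act}_e}^{-1}(w_0'(\mathcal I_{\mathrm{act}_e})),\ \mu_{\mathrm{act}_e}^{-1}(w_1'(\mathcal I_{\mathrm{act}_e}))\bigr)\in\mathrm{IO}_{\mathrm{EXP}(\mathrm{op}_e)}^{\lambda_e(\mathrm{sf}_0),\lambda_e(\mathrm{sf}_1)} .$$ Moreover, for any input-output computation $\epsilon=((w_0'',s_0''),e_1'',\dots,e_m'',(w_m'',s_m''))$ of $\mathrm{EXP}(\mathrm{op}_e)$ with $(w_0'',s_0'')=(\mu_{\mathrm{act}_e}^{-1}(w_0'(\mathcal I_{\mathrm{act}_e}))\sqcup1^{\mathrm{int}}_{\mathrm{EXP}(\mathrm{op}_e)},\lambda_e(\mathrm{sf}_0))$ and $(w_m'',s_m'')=(\mu_{\mathrm{act}_e}^{-1}(w_1'(\mathcal I_{\mathrm{act}_e}))\sqcup1^{\mathrm{int}}_{\mathrm{EXP}(\mathrm{op}_e)},\lambda_e(\mathrm{sf}_1))$, there exists a computation $\kappa_\delta(\epsilon)=((w_0,s_0),e_1,\dots,e_m,(w_m,s_m))$ of $\mathcal G_{\exp}$ such that $(w_0,s_0)=(w_0'\sqcup1^{\mathrm{inv}}_{\mathcal G},s_0')$, $(w_m,s_m)=(w_1'\sqcup1^{\mathrm{inv}}_{\mathcal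 G},s_1')$, and $w_j=\mu_e(w_j'')\sqcup w_0'(\mathcal I_{\mathcal G}-\mathcal I_{\mathrm{act}_e})\sqcup(1)_{i\in\mathcal I^{\mathrm{inv}}_{\mathcal G}-\mathcal I_e^{\mathrm{int}}}$ for all $0\le j\le m$. (d) For any computation $\delta=((w_0',s_0'),e_1',\dots,e_\ell',(w_\ell',s_\ell'))$ of $\mathcal G$, there exists a computation $\nu(\delta)=((w_0,s_0),e_1,\dots,e_m,(w_m,s_m))$ of $\mathcal G_{\exp}$ with $(w_0,s_0),(w_m,s_m)\in(\mathrm{GL}_{\mathcal G}\times1^{\mathrm{inv}}_{\mathcal G})\times S_{\mathcal G}$, $w_0=w_0'\sqcup1^{\mathrm{inv}}_{\mathcal G}$, $w_m=w_\ell'\sqcup1^{\mathrm{inv}}_{\mathcal G}$, $s_0=s_0'$ and $s_m=s_\ell'$. (e) $\mathrm{VAL}_{\mathrm{EXP}(\mathrm{Obj})}=\mathrm{VAL}_{\mathrm{Obj}}$. (f) For any $\mathrm{op}\in\mathrm{Obj}$: if $(w_1,s_1,w_2,s_2)\in\mathrm{REACH}_{\mathrm{EXP}(\mathrm{op})}$ with $s_1,s_2\in\mathrm{SF}_{\mathrm{op}}$, then $w_1\in\mathrm{ND}^1_{\mathrm{op}}\times1^{\mathrm{inv}}_{\mathrm{op}}$ if and only if $w_2\in\mathrm{ND}^1_{\mathrm{op}}\times1^{\mathrm{inv}}_{\mathrm{op}}$. (g) For any $\mathrm{op}\in\mathrm{Obj}$, $\mathrm{IO}_{\mathrm{EXP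}(\mathrm{op})}=\mathrm{IO}_{\mathrm{op}}$.
   Context: **Conventions.** $F(X)$: freely reduced group words over $X\sqcup X^{-1}$. Fix countable sets $\mathcal I^*$ (indices, also called tapes) and $\mathcal A^*$ (letters). For an $\mathcal I$-tuple $w$ and $J\subseteq\mathcal I$, $w(J)$ is its restriction to $J$; $\sqcup$ of tuples with disjoint index sets is the combined tuple; $1$ denotes a tuple of trivial words. A hardware is $\mathcal H=(\mathcal I,\mathcal A)$ with $\mathcal I\subset\mathcal I^*$ finite and $\mathcal A(i)\subset\mathcal A^*$ finite for $i\in\mathcal I$; $L_{\mathcal H}=\prod_{i\in\mathcal I}F(\mathcal A(i))$. $\mathcal H_1\le\mathcal H_2$ means $\mathcal I_1\subseteq\mathcal I_2$ and $\mathcal A_1(i)\subseteq\mathcal A_2(i)$. **Degree 0.** An action of degree 0 over $\mathcal H$ is $(t,g)$: $t$ assigns $t_i^l,t_i^r\in F(\mathcal A(i))$ and acts by $t(w)=(t_i^lw_it_i^r)_i$; $g(i)\in F(\mathcal A(i))\cup\{\mathrm{NA}\}$, and $g$ accepts $w$ if for each $i$, $g(i)=\mathrm{NA}$ or $g(i)=w_i$. Its inverse is $(t',g')$ with inverted multipliers and $g'(i)=t_i^lg(i)t_i^r$ (or NA if $g(i)=\mathrm{NA}$). It mentions $i$ (as a variable) if $t_i^l\ne1$ or $t_i^r\ne1$ or $g(i)\ne\mathrm{NA}$; it mentions $i$ as an immutable variable if moreover $t_i^l=t_i^r=1$. $[i=1]$ denotes the guard $g(i)=1$. An $S$-graph of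 degree 0 over $\mathcal H$ is a finite directed graph (loops, multiple edges allowed) with edges labelled by degree-0 actions over $\mathcal H$, such that each edge $e=(s_1,s_2,\mathrm{act})$ has an inverse edge $e^{-1}=(s_2,s_1,\mathrm{act}^{-1})$; it has instance set $\mathrm{INST}=\emptyset$. A computation in degree 0 is a sequence $((w_0,s_0),e_1,\dots,e_m,(w_m,s_m))$ with each $e_i$ an edge from $s_{i-1}$ to $s_i$ whose guard accepts $w_{i-1}$ and $w_i=t_{e_i}(w_{i-1})$; each such edge step is identified with the generic edge $(\hat s,\hat f,e_i)$ below. **Higher degree (simultaneous recursion).** Assume everything below is defined for degrees $\le n$. *Instances.* An instance of degree $m\le n$ is $\mathrm{inst}=(\mathrm{Obj},\mu^{\mathrm{val}}_{\mathrm{inst}})$, with $\mathrm{Obj}$ an object of degree $m$ and $\mu^{\mathrm{val}}_{\mathrm{inst}}:\mathcal I^{\mathrm{val}}_{\mathrm{Obj}}\to\mathcal I^*$ injective with image $\mathcal I^{\mathrm{val}}_{\mathrm{inst}}$; $\mathrm{VAL}_{\mathrm{inst}}=\mu^{\mathrm{val}}_{\mathrm{inst}}(\mathrm{VAL}_{\mathrm{Obj}})$ (reindexing). *Positive actions.* $\mathrm{act}=(\mathrm{inst},\mathrm{op},\mu^{\mathrm{ext}}_{\mathrm{act}})$ with $\mathrm{op}\in\mathrm{Obj}$ and $\mu^{\mathrm{ext}}_{\mathrm{act}}:\mathcal I^{\mathrm{ext}}_{\mathrm{op}}\to\mathcal I^*$ injective with image $\mathcal I^{\mathrm{ext}}_{\mathrm{act}}$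 disjoint from $\mathcal I^{\mathrm{val}}_{\mathrm{inst}}$; its degree is $m+1$ if $\mathrm{inst}$ has degree $m$. Put $\mathcal I_{\mathrm{act}}=\mathcal I^{\mathrm{ext}}_{\mathrm{act}}\sqcup\mathcal I^{\mathrm{val}}_{\mathrm{inst}}$, $\mu_{\mathrm{act}}=\mu^{\mathrm{ext}}_{\mathrm{act}}\sqcup\mu^{\mathrm{val}}_{\mathrm{inst}}$ (also as a map of tuples by reindexing). It mentions the indices of $\mathcal I_{\mathrm{act}}$, those in $\mathcal I_{\mathrm{act}}^{\mathrm{ext}}$ as variables, and $i\in\mathcal I^{\mathrm{ext}}_{\mathrm{act}}$ as an immutable variable if $(\mu^{\mathrm{ext}}_{\mathrm{act}})^{-1}(i)$ is immutable in $\mathrm{op}$. *$S$-graphs of degree $n+1$* over $(\mathcal H,\mathrm{INST}_{\mathcal G})$, $\mathcal H=(\mathcal I_{\mathcal G},\mathcal A_{\mathcal G})$: finite directed graphs $\mathcal G=(S_{\mathcal G},E_{\mathcal G})$ with a finite set $\mathrm{INST}_{\mathcal G}$ of instances of degree $\le n$, at least one of degree $n$, edges labelled by actions of degree $\le n+1$; $E^0_{\mathcal G}$ is the set of edges with degree-0 label, and it is required that: the instance of each positive label is in $\mathrm{INST}_{\mathcal G}$; $\mathcal I^{\mathrm{val}}_{\mathrm{inst}}\subseteq\mathcal I_{\mathcal G}$ for $\mathrm{inst}\in\mathrm{INST}_{\mathcal G}$; degree-0 labels are actions over $\mathcal H$; for positive labels $\mathcal I_{\mathrm{act}}\subseteq\mathcal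 I_{\mathcal G}$ and the alphabet of each renamed tape agrees with that of the original, so that $\mu_{\mathrm{act}}$ is a bijection $L^{\mathrm{ext}}_{\mathrm{op}}\times L^{\mathrm{val}}_{\mathrm{Obj}}\to L_{\mathcal H}(\mathcal I_{\mathrm{act}})$; edges of $E^0_{\mathcal G}$ have inverse edges; the sets $\mathcal I^{\mathrm{val}}_{\mathrm{inst}}$ for distinct instances are disjoint; if a label mentions as a variable some $i\in\mathcal I^{\mathrm{val}}_{\mathrm{inst}}$ with $\mathrm{inst}\in\mathrm{INST}_{\mathcal G}$, it mentions it as an immutable variable. An $S^*$-graph is an $S$-graph of some degree. *Operations.* $\mathrm{op}=(\mathcal G_{\mathrm{op}},\mathcal I^{\mathrm{ext}}_{\mathrm{op}},\mathcal I^{\mathrm{val}}_{\mathrm{op}},\mathcal I^{\mathrm{int}}_{\mathrm{op}},\mathrm{op}_s,\mathrm{op}_f)$ with $\mathcal G_{\mathrm{op}}$ an $S$-graph with connected underlying graph over $(\mathcal H_{\mathrm{op}},\mathrm{INST}_{\mathrm{op}})$, the three sets partitioning $\mathcal I_{\mathrm{op}}$ (external, value, internal tapes), $\mathcal I_{\mathrm{inst}}^{\mathrm{val}}\subseteq\mathcal I^{\mathrm{val}}_{\mathrm{op}}\sqcup\mathcal I^{\mathrm{int}}_{\mathrm{op}}$ for $\mathrm{inst}\in\mathrm{INST}_{\mathrm{op}}$, and states $\mathrm{op}_s,\mathrm{op}_f$; $\mathrm{SF}_{\mathrm{op}}=\{\mathrm{op}_s,\mathrm{op}_f\}$. Condition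 (O): for each sequence $e_1,\dots,e_N$ forming a path between states of $\mathrm{SF}_{\mathrm{op}}$ in which positive edges may also be traversed backwards (formal inverses, with the same label), and each $i\in\mathcal I^{\mathrm{int}}_{\mathrm{op}}$ mentioned by some $e_j$, there are $l_1\le l_2$ such that $e_{l_1},e_{l_2}$ have degree-0 labels, $e_{l_1}$ and $e_{l_2}^{-1}$ contain $[i=1]$, and no $e_m$ with $m\notin[l_1,l_2]$ mentions $i$. The degree of $\mathrm{op}$ is that of $\mathcal G_{\mathrm{op}}$. $L^{\mathrm{ext}}_{\mathrm{op}},L^{\mathrm{val}}_{\mathrm{op}},L^{\mathrm{int}}_{\mathrm{op}}$ are the sets of tuples of reduced words on the corresponding tapes. A subscript $\mathrm{op}$ refers to $\mathcal G_{\mathrm{op}}$. *Objects.* $\mathrm{Obj}=(\mathcal I^{\mathrm{val}},\mathrm{INST},\mathrm{op}_1,\dots,\mathrm{op}_k)$, where all $\mathrm{op}_j$ have the same value tapes $\mathcal I^{\mathrm{val}}=\mathcal I^{\mathrm{val}}_{\mathrm{Obj}}$ with the same alphabets and the same instance set $\mathrm{INST}$; its degree is the maximal degree of its operations; each operation belongs to a unique object. $L^{\mathrm{val}}_{\mathrm{Obj}}$ is the common value language. *Graph language.* $\mathrm{GL}_{\mathcal G}=\{w\in L_{\mathcal H}\mid w(\mathcal I^{\mathrm{val}}_{\mathrm{inst}})\in\mathrm{VAL}_{\mathrm{inst}}\ \forall\,\mathrm{inst}\in\mathrm{INST}_{\mathcal G}\}$ (in degree 0, $\mathrm{GL}_{\mathcal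 G}=L_{\mathcal H}$). Configurations: $\mathrm{GL}_{\mathcal G}\times S_{\mathcal G}$. *Computations.* Let $\hat s,\hat f$ be symbols and $\lambda_{\mathrm{op}}(\hat s)=\mathrm{op}_s$, $\lambda_{\mathrm{op}}(\hat f)=\mathrm{op}_f$. For a degree-0 action $(t,g)$ with inverse $(t',g')$: $\mathrm{IO}^{\hat s,\hat s}=\mathrm{IO}^{\hat f,\hat f}$ is the identity, $\mathrm{IO}^{\hat s,\hat f}=\{(w,t(w))\mid g\text{ accepts }w\}$, $\mathrm{IO}^{\hat f,\hat s}=\{(w,t'(w))\mid g'\text{ accepts }w\}$. For a positive action, $(w_1,w_2)\in\mathrm{IO}_{\mathrm{act}}^{p,q}$ iff $w_1,w_2$ agree on $\mathcal I_{\mathcal G}-\mathcal I_{\mathrm{act}}$ and $(\mu_{\mathrm{act}}^{-1}(w_1(\mathcal I_{\mathrm{act}})),\mu_{\mathrm{act}}^{-1}(w_2(\mathcal I_{\mathrm{act}})))\in\mathrm{IO}_{\mathrm{op}}^{\lambda_{\mathrm{op}}(p),\lambda_{\mathrm{op}}(q)}$. (All restricted to $w_1,w_2\in\mathrm{GL}_{\mathcal G}$.) A generic edge is $e'=(p,q,e)$ with $p,q\in\{\hat s,\hat f\}$, $e=(s_1,s_2,\mathrm{act})\in E_{\mathcal G}$; its tail is $s_1$ if $p=\hat s$, $s_2$ if $p=\hat f$; its head is $s_1$ if $q=\hat s$, $s_2$ if $q=\hat f$. A generic path is a sequence of generic edges in which each head equals the next tail. A computation of $\mathcal G$ is a sequence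 $((w_0,s_0),e_1',\dots,e_m',(w_m,s_m))$, $m\ge0$, of configurations and generic edges, $e_i'=(p_i,q_i,e_i)$ having tail $s_{i-1}$ and head $s_i$, with $(w_{i-1},w_i)\in\mathrm{IO}_{\mathrm{lab}(e_i)}^{p_i,q_i}$. $\mathrm{REACH}_{\mathcal G}$ is the set of $(w_1,s_1,w_2,s_2)$ for which there is a computation from $(w_1,s_1)$ to $(w_2,s_2)$. An input-output computation of $\mathrm{op}$ is a computation of $\mathcal G_{\mathrm{op}}$ whose first and last states are in $\mathrm{SF}_{\mathrm{op}}$ and whose first and last words are trivial on all internal tapes. *Values, natural domain, IO, immutability.* $\mathrm{VAL}_{\mathrm{Obj}}$ is the connected component of the trivial tuple in the graph on $L^{\mathrm{val}}_{\mathrm{Obj}}$ in which $v_1,v_2$ are adjacent iff some $\mathrm{op}\in\mathrm{Obj}$ has an input-output computation whose first and last words restrict to $v_1,v_2$ on $\mathcal I^{\mathrm{val}}_{\mathrm{Obj}}$. $\mathrm{ND}_{\mathrm{op}}=L^{\mathrm{ext}}_{\mathrm{op}}\times\mathrm{VAL}_{\mathrm{Obj}}$; $1^{\mathrm{int}}_{\mathrm{op}}$ is the trivial tuple on internal tapes; $\mathrm{ND}^1_{\mathrm{op}}=\mathrm{ND}_{\mathrm{op}}\times1^{\mathrm{int}}_{\mathrm{op}}$. For $s_1,s_2\in\mathrm{SF}_{\mathrm{op}}$, $\mathrm{IO}_{\mathrm{op}}^{s_1,s_2}=\{(w_1,w_2)\in\mathrm{ND}_{\mathrm{op}}^2\mid(w_1\sqcup1^{\mathrm{int}}_{\mathrm{op}},s_1,w_2\sqcup1^{\mathrm{int}}_{\mathrm{op}},s_2)\in\mathrm{REACH}_{\mathrm{op}}\}$,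 and $\mathrm{IO}_{\mathrm{op}}$ is the corresponding relation on $\mathrm{ND}_{\mathrm{op}}\times\mathrm{SF}_{\mathrm{op}}$. An external tape $a$ is immutable in $\mathrm{op}$ if $w_1(a)=w_2(a)$ whenever $(w_1,s_1,w_2,s_2)\in\mathrm{IO}_{\mathrm{op}}$. These definitions apply verbatim in degree 0. **Expansion.** In degree 0, $\mathrm{EXP}$ is the identity and $\mathcal I^{\mathrm{inv}}=\emptyset$. For $\mathcal G$ of degree $n+1$ and $e=(s_1,s_2,\mathrm{act}_e)\in E_{\mathcal G}-E^0_{\mathcal G}$, $\mathrm{act}_e=(\mathrm{inst}_e,\mathrm{op}_e,\mu^{\mathrm{ext}}_{\mathrm{act}_e})$, fix an injection $\mu_e^{\mathrm{int}}$ of the internal tapes of $\mathrm{EXP}(\mathrm{op}_e)$ into $\mathcal I^*$ with image $\mathcal I_e^{\mathrm{int}}$, these images being disjoint from $\mathcal I_{\mathcal G}$ and from each other for distinct $e$. Put $\mathcal I^{\mathrm{inv}}_{\mathcal G}=\bigsqcup_e\mathcal I_e^{\mathrm{int}}$ (invisible tapes), $\mathcal I^{\exp}_{\mathcal G}=\mathcal I_{\mathcal G}\sqcup\mathcal I^{\mathrm{inv}}_{\mathcal G}$ (alphabets inherited), $\mu_e=\mu^{\mathrm{ext}}_{\mathrm{act}_e}\sqcup\mu^{\mathrm{val}}_{\mathrm{inst}_e}\sqcup\mu_e^{\mathrm{int}}$. $\mathrm{EXP}(\mathcal G)$ is the degree-0 $S$-graph over this hardware obtained from $\mathcal G$ by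 keeping the states and the edges of $E^0_{\mathcal G}$ (giving proper edges; the states of $\mathcal G$ are called proper) and replacing each $e\in E_{\mathcal G}-E^0_{\mathcal G}$ by a copy of the graph of $\mathrm{EXP}(\mathrm{op}_e)$ with tapes renamed by $\mu_e$ and with its start and finish states identified with $s_1$ and $s_2$ respectively (its edges and new states are the expanded edges and states of $e$). For an operation, $\mathrm{EXP}(\mathrm{op})$ has graph $\mathrm{EXP}(\mathcal G_{\mathrm{op}})$, the same external and value tapes, internal tapes $\mathcal I^{\mathrm{int}}_{\mathrm{op}}\sqcup\mathcal I^{\mathrm{inv}}_{\mathrm{op}}$, the same start and finish states; $\mathrm{EXP}(\mathrm{Obj})=(\mathcal I^{\mathrm{val}}_{\mathrm{Obj}},\mathrm{EXP}(\mathrm{op}_1),\dots,\mathrm{EXP}(\mathrm{op}_k))$. $1^{\mathrm{inv}}_{\mathcal G}$, $1^{\mathrm{inv}}_{\mathrm{op}}$ are the trivial tuples on invisible tapes. **Generic reduction.** Let $\rho=e_1,\dots,e_N$ be a path in $\mathrm{EXP}(\mathcal G)$ with proper endpoints. Cut it at every visit to a proper state. A piece is either one proper edge coming from $e\in E^0_{\mathcal G}$, replaced by the generic edge $(\hat s,\hat f,e)$, or a path of expanded edges of a single $e=(s_1',s_2',\mathrm{act}_e)$ between states of $\{s_1',s_2'\}$, replaced by $(p,q,e)$, where, if $s_1'\ne s_2'$, $p=\hat s$ iff the piece starts at $s_1'$ and $q=\hat s$ iff it ends at $s_1'$, while if $s_1'=s_2'$ then $p,q\in\{\hat s,\hat f\}$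 are arbitrary. Any resulting generic path in $\mathcal G$ is a generic reduction of $\rho$.
   Formalization: It is assumed that, in G, Obj and all operations nested in them, a positive edge whose operation has equal start and finish states is a loop; otherwise EXP would have to identify two distinct states that it must keep, and is undefined. *)

theory Defs
  imports "HOL-Library.FSet" "HOL-Library.Countable"
begin

section \<open>Group words and tuples\<close>

text \<open>The letter \<open>(a, True)\<close> is \<open>a\<close>, the letter \<open>(a, False)\<close> is its formal inverse.
  Elements of the free group are represented by freely reduced words.\<close>

type_synonym 'a word = "('a \<times> bool) list"

definition free_words :: "'a set \<Rightarrow> 'a word set" where
  "free_words X = {w. successively (\<lambda>x y. y \<noteq> (fst x, \<not> snd x)) w \<and> fst ` set w \<subseteq> X}"

fun red_cons :: "'a \<times> bool \<Rightarrow> 'a word \<Rightarrow> 'a word" where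
  "red_cons x [] = [x]"
| "red_cons x (y # w) = (if y = (fst x, \<not> snd x) then w else x # y # w)"

definition word_mult :: "'a word \<Rightarrow> 'a word \<Rightarrow> 'a word" (infixl "\<cdot>" 70) where
  "u \<cdot> v = foldr red_cons u v"

definition word_inv :: "'a word \<Rightarrow> 'a word" where
  "word_inv w = rev (map (\<lambda>x. (fst x, \<not> snd x)) w)"

text \<open>A \<open>J\<close>-tuple is a partial map with domain \<open>J\<close>, so that restriction is \<open>|`\<close> and the
  combination of tuples with disjoint index sets is \<open>++\<close>. Likewise a hardware is the
  partial map \<open>i \<mapsto> \<A>(i)\<close>, whose domain is its index set.\<close>

type_synonym ('i, 'a) tuple = "'i \<rightharpoonup> 'a word"
type_synonym ('i, 'a) hardware = "'i \<rightharpoonup> 'a set"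

definition finite_hardware :: "('i, 'a) hardware \<Rightarrow> bool" where
  "finite_hardware H \<longleftrightarrow> finite (dom H) \<and> (\<forall>A\<in>ran H. finite A)"

definition lang :: "('i, 'a) hardware \<Rightarrow> ('i, 'a) tuple set" where
  "lang H = {w. dom w = dom H \<and> (\<forall>i u A. w i = Some u \<and> H i = Some A \<longrightarrow> u \<in> free_words A)}"

definition trivial :: "'i set \<Rightarrow> ('i, 'a) tuple" where
  "trivial J = (\<lambda>i. if i \<in> J then Some [] else None)"

text \<open>Injections between index sets are partial maps \<open>\<mu>\<close> as well; their domain and image
  are \<open>dom \<mu>\<close> and \<open>ran \<mu>\<close>. Reindexing by \<open>\<mu>\<close> turns a tuple on \<open>dom \<mu>\<close> into one on
  \<open>ran \<mu>\<close>. In the other direction, \<open>w \<circ>\<^sub>m \<mu>\<close> is \<open>\<mu>\<inverse>(w(ran \<mu>))\<close>, a tuple on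
  \<open>dom \<mu>\<close>.\<close>

definition map_injective :: "('i \<rightharpoonup> 'j) \<Rightarrow> bool" where
  "map_injective \<mu> \<longleftrightarrow> inj_on \<mu> (dom \<mu>)"

definition map_inv :: "('i \<rightharpoonup> 'j) \<Rightarrow> ('j \<rightharpoonup> 'i)" where
  "map_inv \<mu> = (\<lambda>j. if j \<in> ran \<mu> then Some (SOME i. \<mu> i = Some j) else None)"

definition reindex :: "('i \<rightharpoonup> 'i) \<Rightarrow> ('i \<rightharpoonup> 'b) \<Rightarrow> ('i \<rightharpoonup> 'b)" where
  "reindex \<mu> w = w \<circ>\<^sub>m map_inv \<mu>"


section \<open>Actions, graphs, instances, objects, operations\<close>

text \<open>The multipliers of a degree-0 action are total functions which are trivial outside the
  hardware (see \<open>act0_over\<close>); thus an action over a hardware is also an action over every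
  larger hardware. \<open>guard a i = None\<close> stands for \<open>g(i) = NA\<close>.\<close>

datatype ('i, 'a) act0 =
  Act0 (lmul: "'i \<Rightarrow> 'a word") (rmul: "'i \<Rightarrow> 'a word") (guard: "'i \<rightharpoonup> 'a word")

text \<open>The name of an edge only serves to distinguish parallel edges carrying the same label.\<close>

datatype ('n, 's, 'l) edge = Edge (ename: 'n) (esrc: 's) (etgt: 's) (elab: 'l)

text \<open>These are the raw data; the conditions imposed on them are collected in
  \<open>is_sgraph\<close>, \<open>is_act\<close>, \<open>is_inst\<close>, \<open>is_obj\<close>, \<open>is_oper\<close> below.
  \<open>Pos\<close> builds the actions of positive degree. An object stores its value tapes together
  with their alphabets.\<close>

datatype ('i, 'a, 's, 'n) sgraph =
    SGraph (hw: "('i, 'a) hardware") (states: "'s fset")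
      (edges: "('n, 's, ('i, 'a, 's, 'n) action) edge fset")
      (insts: "('i, 'a, 's, 'n) inst fset")
and ('i, 'a, 's, 'n) action =
    Deg0 "('i, 'a) act0"
  | Pos "('i, 'a, 's, 'n) inst" (act_op: "('i, 'a, 's, 'n) oper") "'i \<rightharpoonup> 'i"
and ('i, 'a, 's, 'n) inst =
    Inst (inst_obj: "('i, 'a, 's, 'n) obj") (inst_map: "'i \<rightharpoonup> 'i")
and ('i, 'a, 's, 'n) obj =
    Obj (val_hw: "('i, 'a) hardware") (obj_insts: "('i, 'a, 's, 'n) inst fset")
      (obj_ops: "('i, 'a, 's, 'n) oper list")
and ('i, 'a, 's, 'n) oper =
    Oper (op_graph: "('i, 'a, 's, 'n) sgraph")
      (ext_tapes: "'i set") (val_tapes: "'i set") (int_tapes: "'i set")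
      (op_start: 's) (op_finish: 's)

type_synonym ('i, 'a, 's, 'n) sedge = "('n, 's, ('i, 'a, 's, 'n) action) edge"

definition SF :: "('i, 'a, 's, 'n) oper \<Rightarrow> 's set" where
  "SF op = {op_start op, op_finish op}"

abbreviation inst_tapes :: "('i, 'a, 's, 'n) inst \<Rightarrow> 'i set" where
  "inst_tapes inst \<equiv> ran (inst_map inst)"

text \<open>The map \<open>\<mu>\<^sub>a\<^sub>c\<^sub>t\<close> of a positive action; its image is \<open>\<I>\<^sub>a\<^sub>c\<^sub>t\<close>.\<close>

fun mu_act :: "('i, 'a, 's, 'n) action \<Rightarrow> ('i \<rightharpoonup> 'i)" where
  "mu_act (Pos inst op \<mu>) = \<mu> ++ inst_map inst"
| "mu_act (Deg0 a) = Map.empty"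

fun positive :: "('i, 'a, 's, 'n) action \<Rightarrow> bool" where
  "positive (Pos inst op \<mu>) = True"
| "positive (Deg0 a) = False"

definition act0_over :: "('i, 'a) hardware \<Rightarrow> ('i, 'a) act0 \<Rightarrow> bool" where
  "act0_over H a \<longleftrightarrow>
     (\<forall>i A. H i = Some A \<longrightarrow>
        lmul a i \<in> free_words A \<and> rmul a i \<in> free_words A \<and>
        (\<forall>u. guard a i = Some u \<longrightarrow> u \<in> free_words A)) \<and>
     (\<forall>i. i \<notin> dom H \<longrightarrow> lmul a i = [] \<and> rmul a i = [] \<and> guard a i = None)"

definition act0_apply :: "('i, 'a) act0 \<Rightarrow> ('i, 'a) tuple \<Rightarrow> ('i, 'a) tuple" where
  "act0_apply a w = (\<lambda>i. map_option (\<lambda>u. lmul a i \<cdot> u \<cdot> rmul a i) (w i))"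

definition accepts :: "('i, 'a) act0 \<Rightarrow> ('i, 'a) tuple \<Rightarrow> bool" where
  "accepts a w \<longleftrightarrow> guard a \<subseteq>\<^sub>m w"

definition act0_inv :: "('i, 'a) act0 \<Rightarrow> ('i, 'a) act0" where
  "act0_inv a = Act0 (\<lambda>i. word_inv (lmul a i)) (\<lambda>i. word_inv (rmul a i))
     (\<lambda>i. map_option (\<lambda>u. lmul a i \<cdot> u \<cdot> rmul a i) (guard a i))"


section \<open>Generic edges and computations\<close>

datatype sf = S_hat | F_hat

type_synonym ('i, 'a, 's, 'n) gedge = "sf \<times> sf \<times> ('i, 'a, 's, 'n) sedge"

fun edge_end :: "('i, 'a, 's, 'n) sedge \<Rightarrow> sf \<Rightarrow> 's" where
  "edge_end e S_hat = esrc e"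
| "edge_end e F_hat = etgt e"

definition gtail :: "('i, 'a, 's, 'n) gedge \<Rightarrow> 's" where
  "gtail g = (case g of (p, q, e) \<Rightarrow> edge_end e p)"

definition ghead :: "('i, 'a, 's, 'n) gedge \<Rightarrow> 's" where
  "ghead g = (case g of (p, q, e) \<Rightarrow> edge_end e q)"

definition under :: "('i, 'a, 's, 'n) gedge \<Rightarrow> ('i, 'a, 's, 'n) sedge" where
  "under g = snd (snd g)"

definition generic_path :: "('i, 'a, 's, 'n) sgraph \<Rightarrow> ('i, 'a, 's, 'n) gedge list \<Rightarrow> bool" where
  "generic_path G gs \<longleftrightarrow>
     (\<forall>g\<in>set gs. under g |\<in>| edges G) \<and> successively (\<lambda>g h. ghead g = gtail h) gs"

fun lam :: "('i, 'a, 's, 'n) oper \<Rightarrow> sf \<Rightarrow> 's" where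
  "lam op S_hat = op_start op"
| "lam op F_hat = op_finish op"

text \<open>The simultaneous recursion is organised as follows. The notions below take as
  parameters candidates \<open>V\<close> and \<open>R\<close> for the predicates defining the values of objects and
  the relations \<open>IO\<close> of operations. They are monotone in \<open>V\<close> and \<open>R\<close> and only consult them
  on objects and operations nested inside the given graph; hence the mutually inductive
  definition that follows has a unique solution, which is the one given by recursion on the
  degree.\<close>

type_synonym ('i, 'a, 's, 'n) val_pred = "('i, 'a, 's, 'n) obj \<Rightarrow> ('i, 'a) tuple \<Rightarrow> bool"
type_synonym ('i, 'a, 's, 'n) io_pred =
  "('i, 'a, 's, 'n) obj \<Rightarrow> ('i, 'a, 's, 'n) oper \<Rightarrow>
   ('i, 'a) tuple \<Rightarrow> 's \<Rightarrow> ('i, 'a) tuple \<Rightarrow> 's \<Rightarrow> bool"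
type_synonym ('i, 'a, 's) conf = "('i, 'a) tuple \<times> 's"

definition GL_param ::
    "('i, 'a, 's, 'n) val_pred \<Rightarrow> ('i, 'a, 's, 'n) sgraph \<Rightarrow> ('i, 'a) tuple set" where
  "GL_param V G = {w \<in> lang (hw G). \<forall>inst. inst |\<in>| insts G \<longrightarrow>
     w |` inst_tapes inst \<in> reindex (inst_map inst) ` {v. V (inst_obj inst) v}}"

fun IO_act_param ::
    "('i, 'a, 's, 'n) io_pred \<Rightarrow> ('i, 'a, 's, 'n) sgraph \<Rightarrow> ('i, 'a, 's, 'n) action \<Rightarrow>
     sf \<Rightarrow> sf \<Rightarrow> ('i, 'a) tuple \<Rightarrow> ('i, 'a) tuple \<Rightarrow> bool" where
  "IO_act_param R G (Deg0 a) S_hat S_hat w1 w2 = (w1 = w2)"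
| "IO_act_param R G (Deg0 a) F_hat F_hat w1 w2 = (w1 = w2)"
| "IO_act_param R G (Deg0 a) S_hat F_hat w1 w2 = (accepts a w1 \<and> w2 = act0_apply a w1)"
| "IO_act_param R G (Deg0 a) F_hat S_hat w1 w2 =
     (accepts (act0_inv a) w1 \<and> w2 = act0_apply (act0_inv a) w1)"
| "IO_act_param R G (Pos inst op \<mu>) p q w1 w2 =
     (let \<mu>a = mu_act (Pos inst op \<mu>) in
      (\<forall>i \<in> dom (hw G) - ran \<mu>a. w1 i = w2 i) \<and>
      R (inst_obj inst) op (w1 \<circ>\<^sub>m \<mu>a) (lam op p) (w2 \<circ>\<^sub>m \<mu>a) (lam op q))"

text \<open>A computation \<open>(w\<^sub>0, s\<^sub>0), e\<^sub>1', \<dots>, e\<^sub>m', (w\<^sub>m, s\<^sub>m)\<close> is given by the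
  list \<open>cs\<close> of its \<open>m + 1\<close> configurations and the list \<open>gs\<close> of its \<open>m\<close> generic edges. In
  degree 0, i.e. when there are no instances, only edges traversed from \<open>S_hat\<close> to \<open>F_hat\<close>
  are allowed.\<close>

definition computation_param ::
    "('i, 'a, 's, 'n) val_pred \<Rightarrow> ('i, 'a, 's, 'n) io_pred \<Rightarrow> ('i, 'a, 's, 'n) sgraph \<Rightarrow>
     ('i, 'a, 's) conf list \<Rightarrow> ('i, 'a, 's, 'n) gedge list \<Rightarrow> bool" where
  "computation_param V R G cs gs \<longleftrightarrow>
     length cs = Suc (length gs) \<and>
     (\<forall>c\<in>set cs. fst c \<in> GL_param V G \<and> snd c |\<in>| states G) \<and>
     (\<forall>j<length gs. \<exists>p q e. gs ! j = (p, q, e) \<and> e |\<in>| edges G \<and>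
        (insts G = {||} \<longrightarrow> p = S_hat \<and> q = F_hat) \<and>
        gtail (gs ! j) = snd (cs ! j) \<and> ghead (gs ! j) = snd (cs ! Suc j) \<and>
        IO_act_param R G (elab e) p q (fst (cs ! j)) (fst (cs ! Suc j)))"

definition REACH_param ::
    "('i, 'a, 's, 'n) val_pred \<Rightarrow> ('i, 'a, 's, 'n) io_pred \<Rightarrow> ('i, 'a, 's, 'n) sgraph \<Rightarrow>
     (('i, 'a) tuple \<times> 's \<times> ('i, 'a) tuple \<times> 's) set" where
  "REACH_param V R G = {(w1, s1, w2, s2).
     \<exists>cs gs. computation_param V R G cs gs \<and> hd cs = (w1, s1) \<and> last cs = (w2, s2)}"

definition io_computation_param ::
    "('i, 'a, 's, 'n) val_pred \<Rightarrow> ('i, 'a, 's, 'n) io_pred \<Rightarrow> ('i, 'a, 's, 'n) oper \<Rightarrow>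
     ('i, 'a, 's) conf list \<Rightarrow> ('i, 'a, 's, 'n) gedge list \<Rightarrow> bool" where
  "io_computation_param V R op cs gs \<longleftrightarrow>
     computation_param V R (op_graph op) cs gs \<and>
     snd (hd cs) \<in> SF op \<and> snd (last cs) \<in> SF op \<and>
     fst (hd cs) |` int_tapes op = trivial (int_tapes op) \<and>
     fst (last cs) |` int_tapes op = trivial (int_tapes op)"

definition val_adj_param ::
    "('i, 'a, 's, 'n) val_pred \<Rightarrow> ('i, 'a, 's, 'n) io_pred \<Rightarrow> ('i, 'a, 's, 'n) obj \<Rightarrow>
     ('i, 'a) tuple \<Rightarrow> ('i, 'a) tuple \<Rightarrow> bool" where
  "val_adj_param V R ob v1 v2 \<longleftrightarrow> v1 \<in> lang (val_hw ob) \<and> v2 \<in> lang (val_hw ob) \<and>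
     (\<exists>op\<in>set (obj_ops ob). \<exists>cs gs. io_computation_param V R op cs gs \<and>
        fst (hd cs) |` dom (val_hw ob) = v1 \<and> fst (last cs) |` dom (val_hw ob) = v2)"

definition ND_param ::
    "('i, 'a, 's, 'n) val_pred \<Rightarrow> ('i, 'a, 's, 'n) obj \<Rightarrow> ('i, 'a, 's, 'n) oper \<Rightarrow>
     ('i, 'a) tuple set" where
  "ND_param V ob op = {x ++ v | x v. x \<in> lang (hw (op_graph op) |` ext_tapes op) \<and> V ob v}"

lemma GL_param_mono:
  assumes "\<And>ob v. V ob v \<longrightarrow> V' ob v"
  shows "w \<in> GL_param V G \<longrightarrow> w \<in> GL_param V' G"
  using assms unfolding GL_param_def by blast

lemma IO_act_param_mono:
  assumes "\<And>ob op w1 s1 w2 s2. R ob op w1 s1 w2 s2 \<longrightarrow> R' ob op w1 s1 w2 s2"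
  shows "IO_act_param R G act p q w1 w2 \<longrightarrow> IO_act_param R' G act p q w1 w2"
  using assms by (cases act; cases p; cases q) (auto simp: Let_def)

lemma computation_param_mono:
  assumes "\<And>ob v. V ob v \<longrightarrow> V' ob v"
    and "\<And>ob op w1 s1 w2 s2. R ob op w1 s1 w2 s2 \<longrightarrow> R' ob op w1 s1 w2 s2"
  shows "computation_param V R G cs gs \<longrightarrow> computation_param V' R' G cs gs"
  using GL_param_mono[of V V', OF assms(1)] IO_act_param_mono[of R R', OF assms(2)]
  unfolding computation_param_def by meson

lemma REACH_param_mono [mono]:
  assumes "\<And>ob v. V ob v \<longrightarrow> V' ob v"
    and "\<And>ob op w1 s1 w2 s2. R ob op w1 s1 w2 s2 \<longrightarrow> R' ob op w1 s1 w2 s2"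
  shows "c \<in> REACH_param V R G \<longrightarrow> c \<in> REACH_param V' R' G"
  using computation_param_mono[of V V' R R', OF assms] unfolding REACH_param_def by blast

lemma val_adj_param_mono:
  assumes "\<And>ob v. V ob v \<longrightarrow> V' ob v"
    and "\<And>ob op w1 s1 w2 s2. R ob op w1 s1 w2 s2 \<longrightarrow> R' ob op w1 s1 w2 s2"
  shows "val_adj_param V R ob v1 v2 \<longrightarrow> val_adj_param V' R' ob v1 v2"
  using computation_param_mono[of V V' R R', OF assms]
  unfolding val_adj_param_def io_computation_param_def by meson

lemma equivclp_val_adj_param_mono [mono]:
  assumes "\<And>ob v. V ob v \<longrightarrow> V' ob v"
    and "\<And>ob op w1 s1 w2 s2. R ob op w1 s1 w2 s2 \<longrightarrow> R' ob op w1 s1 w2 s2"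
  shows "equivclp (val_adj_param V R ob) v1 v2 \<longrightarrow> equivclp (val_adj_param V' R' ob) v1 v2"
proof
  assume "equivclp (val_adj_param V R ob) v1 v2"
  then show "equivclp (val_adj_param V' R' ob) v1 v2"
  proof (induction rule: equivclp_induct)
    case base
    show ?case by simp
  next
    case (step y z)
    have "val_adj_param V' R' ob y z \<or> val_adj_param V' R' ob z y"
      using step.hyps(2) val_adj_param_mono[of V V' R R', OF assms] by blast
    with step.IH show ?case by (metis equivclp_into_equivclp)
  qed
qed

lemma ND_param_mono [mono]:
  assumes "\<And>ob v. V ob v \<longrightarrow> V' ob v"
  shows "w \<in> ND_param V ob op \<longrightarrow> w \<in> ND_param V' ob op"
  using assms unfolding ND_param_def by blast

inductive in_VAL :: "('i, 'a, 's, 'n) obj \<Rightarrow> ('i, 'a) tuple \<Rightarrow> bool"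
  and in_IO :: "('i, 'a, 's, 'n) obj \<Rightarrow> ('i, 'a, 's, 'n) oper \<Rightarrow>
    ('i, 'a) tuple \<Rightarrow> 's \<Rightarrow> ('i, 'a) tuple \<Rightarrow> 's \<Rightarrow> bool" where
  in_VAL: "equivclp (val_adj_param in_VAL in_IO ob) (trivial (dom (val_hw ob))) v \<Longrightarrow> in_VAL ob v"
| in_IO: "\<lbrakk> w1 \<in> ND_param in_VAL ob op; w2 \<in> ND_param in_VAL ob op; s1 \<in> SF op; s2 \<in> SF op;
    (w1 ++ trivial (int_tapes op), s1, w2 ++ trivial (int_tapes op), s2)
      \<in> REACH_param in_VAL in_IO (op_graph op) \<rbrakk> \<Longrightarrow> in_IO ob op w1 s1 w2 s2"

text \<open>An operation is not tied to the object it belongs to, so the notions for operations that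
  depend on the values of that object get it as an argument.\<close>

definition VAL :: "('i, 'a, 's, 'n) obj \<Rightarrow> ('i, 'a) tuple set" where
  "VAL ob = {v. in_VAL ob v}"

definition IO :: "('i, 'a, 's, 'n) obj \<Rightarrow> ('i, 'a, 's, 'n) oper \<Rightarrow>
    (('i, 'a) tuple \<times> 's \<times> ('i, 'a) tuple \<times> 's) set" where
  "IO ob op = {(w1, s1, w2, s2). in_IO ob op w1 s1 w2 s2}"

definition GL :: "('i, 'a, 's, 'n) sgraph \<Rightarrow> ('i, 'a) tuple set" where
  "GL = GL_param in_VAL"

definition configs :: "('i, 'a, 's, 'n) sgraph \<Rightarrow> ('i, 'a, 's) conf set" where
  "configs G = GL G \<times> fset (states G)"

definition computation :: "('i, 'a, 's, 'n) sgraph \<Rightarrow>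
    ('i, 'a, 's) conf list \<Rightarrow> ('i, 'a, 's, 'n) gedge list \<Rightarrow> bool" where
  "computation = computation_param in_VAL in_IO"

definition REACH :: "('i, 'a, 's, 'n) sgraph \<Rightarrow>
    (('i, 'a) tuple \<times> 's \<times> ('i, 'a) tuple \<times> 's) set" where
  "REACH = REACH_param in_VAL in_IO"

definition io_computation :: "('i, 'a, 's, 'n) oper \<Rightarrow>
    ('i, 'a, 's) conf list \<Rightarrow> ('i, 'a, 's, 'n) gedge list \<Rightarrow> bool" where
  "io_computation = io_computation_param in_VAL in_IO"

definition ND :: "('i, 'a, 's, 'n) obj \<Rightarrow> ('i, 'a, 's, 'n) oper \<Rightarrow> ('i, 'a) tuple set" where
  "ND = ND_param in_VAL"

definition ND1 :: "('i, 'a, 's, 'n) obj \<Rightarrow> ('i, 'a, 's, 'n) oper \<Rightarrow> ('i, 'a) tuple set" where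
  "ND1 ob op = (\<lambda>w. w ++ trivial (int_tapes op)) ` ND ob op"

definition immutable :: "('i, 'a, 's, 'n) obj \<Rightarrow> ('i, 'a, 's, 'n) oper \<Rightarrow> 'i \<Rightarrow> bool" where
  "immutable ob op a \<longleftrightarrow> a \<in> ext_tapes op \<and>
     (\<forall>(w1, s1, w2, s2) \<in> IO ob op. w1 a = w2 a)"


section \<open>S-graphs, operations and objects\<close>

definition mentions0 :: "('i, 'a) act0 \<Rightarrow> 'i \<Rightarrow> bool" where
  "mentions0 a i \<longleftrightarrow> lmul a i \<noteq> [] \<or> rmul a i \<noteq> [] \<or> guard a i \<noteq> None"

fun mentions :: "('i, 'a, 's, 'n) action \<Rightarrow> 'i \<Rightarrow> bool" where
  "mentions (Deg0 a) i = mentions0 a i"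
| "mentions (Pos inst op \<mu>) i = (i \<in> ran (mu_act (Pos inst op \<mu>)))"

fun mentions_var :: "('i, 'a, 's, 'n) action \<Rightarrow> 'i \<Rightarrow> bool" where
  "mentions_var (Deg0 a) i = mentions0 a i"
| "mentions_var (Pos inst op \<mu>) i = (i \<in> ran \<mu>)"

fun mentions_immutable :: "('i, 'a, 's, 'n) action \<Rightarrow> 'i \<Rightarrow> bool" where
  "mentions_immutable (Deg0 a) i = (mentions0 a i \<and> lmul a i = [] \<and> rmul a i = [])"
| "mentions_immutable (Pos inst op \<mu>) i =
     (\<exists>a. \<mu> a = Some i \<and> immutable (inst_obj inst) op a)"

fun label_ok :: "('i, 'a, 's, 'n) sgraph \<Rightarrow> ('i, 'a, 's, 'n) action \<Rightarrow> bool" where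
  "label_ok G (Deg0 a) = act0_over (hw G) a"
| "label_ok G (Pos inst op \<mu>) =
     (inst |\<in>| insts G \<and>
      (\<forall>j i. mu_act (Pos inst op \<mu>) j = Some i \<longrightarrow>
         i \<in> dom (hw G) \<and> hw G i = hw (op_graph op) j))"

definition graph_ok :: "('i, 'a, 's, 'n) sgraph \<Rightarrow> bool" where
  "graph_ok G \<longleftrightarrow>
     finite_hardware (hw G) \<and>
     (\<forall>e. e |\<in>| edges G \<longrightarrow>
        esrc e |\<in>| states G \<and> etgt e |\<in>| states G \<and> label_ok G (elab e)) \<and>
     (\<forall>e a. e |\<in>| edges G \<and> elab e = Deg0 a \<longrightarrow>
        (\<exists>e'. e' |\<in>| edges G \<and> esrc e' = etgt e \<and> etgt e' = esrc e \<and>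
           elab e' = Deg0 (act0_inv a))) \<and>
     (\<forall>inst. inst |\<in>| insts G \<longrightarrow> inst_tapes inst \<subseteq> dom (hw G)) \<and>
     (\<forall>inst inst'. inst |\<in>| insts G \<and> inst' |\<in>| insts G \<and> inst \<noteq> inst' \<longrightarrow>
        inst_tapes inst \<inter> inst_tapes inst' = {}) \<and>
     (\<forall>e inst i. e |\<in>| edges G \<and> inst |\<in>| insts G \<and> i \<in> inst_tapes inst \<and>
        mentions_var (elab e) i \<longrightarrow> mentions_immutable (elab e) i)"

text \<open>In condition (O), \<open>(True, e)\<close> traverses \<open>e\<close> forwards and \<open>(False, e)\<close> backwards.\<close>

definition dir_tail :: "bool \<times> ('i, 'a, 's, 'n) sedge \<Rightarrow> 's" where
  "dir_tail x = (if fst x then esrc (snd x) else etgt (snd x))"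

definition dir_head :: "bool \<times> ('i, 'a, 's, 'n) sedge \<Rightarrow> 's" where
  "dir_head x = (if fst x then etgt (snd x) else esrc (snd x))"

definition condition_O :: "('i, 'a, 's, 'n) oper \<Rightarrow> bool" where
  "condition_O op \<longleftrightarrow>
     (\<forall>\<rho> i. \<rho> \<noteq> [] \<and>
        (\<forall>x\<in>set \<rho>. snd x |\<in>| edges (op_graph op) \<and> (\<not> fst x \<longrightarrow> positive (elab (snd x)))) \<and>
        successively (\<lambda>x y. dir_head x = dir_tail y) \<rho> \<and>
        dir_tail (hd \<rho>) \<in> SF op \<and> dir_head (last \<rho>) \<in> SF op \<and>
        i \<in> int_tapes op \<and> (\<exists>x\<in>set \<rho>. mentions (elab (snd x)) i)
      \<longrightarrow> (\<exists>l1 l2. l1 \<le> l2 \<and> l2 < length \<rho> \<and>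
            (\<exists>a. elab (snd (\<rho> ! l1)) = Deg0 a \<and> guard a i = Some []) \<and>
            (\<exists>a. elab (snd (\<rho> ! l2)) = Deg0 a \<and> guard (act0_inv a) i = Some []) \<and>
            (\<forall>m<length \<rho>. m \<notin> {l1..l2} \<longrightarrow> \<not> mentions (elab (snd (\<rho> ! m))) i)))"

definition graph_connected :: "('i, 'a, 's, 'n) sgraph \<Rightarrow> bool" where
  "graph_connected G \<longleftrightarrow> (\<forall>s t. s |\<in>| states G \<and> t |\<in>| states G \<longrightarrow>
     equivclp (\<lambda>s t. \<exists>e. e |\<in>| edges G \<and> esrc e = s \<and> etgt e = t) s t)"

definition oper_ok :: "('i, 'a, 's, 'n) oper \<Rightarrow> bool" where
  "oper_ok op \<longleftrightarrow>
     graph_connected (op_graph op) \<and>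
     dom (hw (op_graph op)) = ext_tapes op \<union> val_tapes op \<union> int_tapes op \<and>
     ext_tapes op \<inter> val_tapes op = {} \<and> ext_tapes op \<inter> int_tapes op = {} \<and>
     val_tapes op \<inter> int_tapes op = {} \<and>
     (\<forall>inst. inst |\<in>| insts (op_graph op) \<longrightarrow> inst_tapes inst \<subseteq> val_tapes op \<union> int_tapes op) \<and>
     op_start op |\<in>| states (op_graph op) \<and> op_finish op |\<in>| states (op_graph op) \<and>
     condition_O op"

definition obj_ok :: "('i, 'a, 's, 'n) obj \<Rightarrow> bool" where
  "obj_ok ob \<longleftrightarrow> obj_ops ob \<noteq> [] \<and>
     (\<forall>op\<in>set (obj_ops ob).
        val_tapes op = dom (val_hw ob) \<and> hw (op_graph op) |` val_tapes op = val_hw ob \<and>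
        insts (op_graph op) = obj_insts ob)"

inductive is_sgraph :: "nat \<Rightarrow> ('i, 'a, 's, 'n) sgraph \<Rightarrow> bool"
  and is_act :: "nat \<Rightarrow> ('i, 'a, 's, 'n) action \<Rightarrow> bool"
  and is_inst :: "nat \<Rightarrow> ('i, 'a, 's, 'n) inst \<Rightarrow> bool"
  and is_obj :: "nat \<Rightarrow> ('i, 'a, 's, 'n) obj \<Rightarrow> bool"
  and is_oper :: "nat \<Rightarrow> ('i, 'a, 's, 'n) oper \<Rightarrow> bool" where
  sgraph_0: "\<lbrakk> graph_ok G; insts G = {||}; \<forall>e. e |\<in>| edges G \<longrightarrow> is_act 0 (elab e) \<rbrakk>
    \<Longrightarrow> is_sgraph 0 G"
| sgraph_Suc: "\<lbrakk> graph_ok G;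
     \<forall>inst. inst |\<in>| insts G \<longrightarrow> (\<exists>m\<le>n. is_inst m inst);
     \<exists>inst. inst |\<in>| insts G \<and> is_inst n inst;
     \<forall>e. e |\<in>| edges G \<longrightarrow> (\<exists>m\<le>Suc n. is_act m (elab e)) \<rbrakk>
    \<Longrightarrow> is_sgraph (Suc n) G"
| act_0: "is_act 0 (Deg0 a)"
| act_Suc: "\<lbrakk> is_inst m inst; op \<in> set (obj_ops (inst_obj inst));
     dom \<mu> = ext_tapes op; map_injective \<mu>; ran \<mu> \<inter> inst_tapes inst = {} \<rbrakk>
    \<Longrightarrow> is_act (Suc m) (Pos inst op \<mu>)"
| inst: "\<lbrakk> is_obj m (inst_obj inst); dom (inst_map inst) = dom (val_hw (inst_obj inst));
     map_injective (inst_map inst) \<rbrakk>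
    \<Longrightarrow> is_inst m inst"
| obj: "\<lbrakk> obj_ok ob; \<forall>op\<in>set (obj_ops ob). \<exists>m\<le>n. is_oper m op; \<exists>op\<in>set (obj_ops ob). is_oper n op \<rbrakk>
    \<Longrightarrow> is_obj n ob"
| oper: "\<lbrakk> is_sgraph n (op_graph op); oper_ok op \<rbrakk> \<Longrightarrow> is_oper n op"

definition S_star_graph :: "('i, 'a, 's, 'n) sgraph \<Rightarrow> bool" where
  "S_star_graph G \<longleftrightarrow> (\<exists>n. is_sgraph n G)"

definition S_star_object :: "('i, 'a, 's, 'n) obj \<Rightarrow> bool" where
  "S_star_object ob \<longleftrightarrow> (\<exists>n. is_obj n ob)"


section \<open>Expansion\<close>

text \<open>The expansion involves choices: for each positive edge \<open>e\<close> of a graph, the injection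
  \<open>\<mu>\<^sub>e\<^sup>i\<^sup>n\<^sup>t\<close> and the copy of the graph of the expanded operation, i.e. the states of the
  copy and the names of its edges. A function \<open>\<chi>\<close> assigning these data to all
  graphs and edges is fixed; \<open>expansion_choice\<close> below states which \<open>\<chi>\<close> are admissible.\<close>

datatype ('i, 'a, 's, 'n) copy_data =
  Copy (copy_tape: "'i \<rightharpoonup> 'i") (copy_state: "'s \<Rightarrow> 's") (copy_name: "('i, 'a, 's, 'n) sedge \<Rightarrow> 'n")

type_synonym ('i, 'a, 's, 'n) choice =
  "('i, 'a, 's, 'n) sgraph \<Rightarrow> ('i, 'a, 's, 'n) sedge \<Rightarrow> ('i, 'a, 's, 'n) copy_data"

definition pos_edges :: "('i, 'a, 's, 'n) sgraph \<Rightarrow> ('i, 'a, 's, 'n) sedge fset" where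
  "pos_edges G = ffilter (\<lambda>e. positive (elab e)) (edges G)"

fun rename_label :: "('i \<rightharpoonup> 'i) \<Rightarrow> ('i, 'a, 's, 'n) action \<Rightarrow> ('i, 'a, 's, 'n) action" where
  "rename_label \<mu> (Deg0 a) = Deg0 (Act0
     (\<lambda>i. case map_inv \<mu> i of None \<Rightarrow> [] | Some j \<Rightarrow> lmul a j)
     (\<lambda>i. case map_inv \<mu> i of None \<Rightarrow> [] | Some j \<Rightarrow> rmul a j)
     (reindex \<mu> (guard a)))"
| "rename_label \<mu> (Pos inst op \<mu>') = Pos inst op \<mu>'"

text \<open>The map \<open>\<mu>\<^sub>e\<close> for a positive edge \<open>e\<close> with copying data \<open>c\<close>.\<close>

definition mu_edge ::
    "('i, 'a, 's, 'n) copy_data \<Rightarrow> ('i, 'a, 's, 'n) sedge \<Rightarrow> ('i \<rightharpoonup> 'i)" where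
  "mu_edge c e = mu_act (elab e) ++ copy_tape c"

definition copy_edge :: "('i, 'a, 's, 'n) copy_data \<Rightarrow> ('i, 'a, 's, 'n) sedge \<Rightarrow>
    ('i, 'a, 's, 'n) sedge \<Rightarrow> ('i, 'a, 's, 'n) sedge" where
  "copy_edge c e f = Edge (copy_name c f) (copy_state c (esrc f)) (copy_state c (etgt f))
     (rename_label (mu_edge c e) (elab f))"

text \<open>The union of a family of partial maps with disjoint domains.\<close>

definition join_maps :: "('i \<rightharpoonup> 'b) set \<Rightarrow> ('i \<rightharpoonup> 'b)" where
  "join_maps M = (\<lambda>i. if \<exists>f\<in>M. i \<in> dom f then (SOME f. f \<in> M \<and> i \<in> dom f) i else None)"

text \<open>\<open>substitute G c X\<close> replaces every positive edge \<open>e\<close> of \<open>G\<close> by the copy, given by \<open>c e\<close>,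
  of the degree-0 graph \<open>X e\<close>.\<close>

definition substitute :: "('i, 'a, 's, 'n) sgraph \<Rightarrow>
    (('i, 'a, 's, 'n) sedge \<Rightarrow> ('i, 'a, 's, 'n) copy_data) \<Rightarrow>
    (('i, 'a, 's, 'n) sedge \<Rightarrow> ('i, 'a, 's, 'n) sgraph) \<Rightarrow> ('i, 'a, 's, 'n) sgraph" where
  "substitute G c X = SGraph
     (join_maps (insert (hw G) ((\<lambda>e. reindex (copy_tape (c e)) (hw (X e))) ` fset (pos_edges G))))
     (states G |\<union>| ffUnion ((\<lambda>e. copy_state (c e) |`| states (X e)) |`| pos_edges G))
     (ffilter (\<lambda>e. \<not> positive (elab e)) (edges G) |\<union>|
        ffUnion ((\<lambda>e. copy_edge (c e) e |`| edges (X e)) |`| pos_edges G))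
     {||}"

lemma substitute_cong [fundef_cong]:
  assumes "G = G'" "c = c'" "\<And>e. e |\<in>| pos_edges G' \<Longrightarrow> X e = X' e"
  shows "substitute G c X = substitute G' c' X'"
proof -
  have "(\<lambda>e. reindex (copy_tape (c e)) (hw (X e))) ` fset (pos_edges G') =
        (\<lambda>e. reindex (copy_tape (c e)) (hw (X' e))) ` fset (pos_edges G')"
    using assms(3) by (auto intro!: image_cong)
  moreover have "(\<lambda>e. copy_state (c e) |`| states (X e)) |`| pos_edges G' =
        (\<lambda>e. copy_state (c e) |`| states (X' e)) |`| pos_edges G'"
    using assms(3) by (intro fset.map_cong) auto
  moreover have "(\<lambda>e. copy_edge (c e) e |`| edges (X e)) |`| pos_edges G' =
        (\<lambda>e. copy_edge (c e) e |`| edges (X' e)) |`| pos_edges G'"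
    using assms(3) by (intro fset.map_cong) auto
  ultimately show ?thesis using assms(1,2) unfolding substitute_def by simp
qed

lemma size_edge_graph:
  assumes "e |\<in>| pos_edges G"
  shows "size (op_graph (act_op (elab e))) < size G"
proof (cases G)
  case (SGraph H S E I)
  then obtain inst op \<mu> where e: "e |\<in>| E" "elab e = Pos inst op \<mu>"
    using assms by (cases "elab e") (auto simp: pos_edges_def)
  show ?thesis 
  proof -
    let ?f = "map_edge (\<lambda>x. x) (\<lambda>x. x) (\<lambda>act. (act, size act))"
    have "Suc (size_edge (\<lambda>_. 0) (\<lambda>_. 0) snd (?f e)) \<le>
        (\<Sum>x\<in>?f ` fset E. Suc (size_edge (\<lambda>_. 0) (\<lambda>_. 0) snd x))"
      using e(1) by (intro member_le_sum) auto
    moreover have "size (op_graph op) < size_edge (\<lambda>_. 0) (\<lambda>_. 0) snd (?f e)"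
      using e(2) by (cases op; cases e) simp
    ultimately show ?thesis
      using e(2) SGraph by simp
  qed
qed

function exp_graph :: "('i, 'a, 's, 'n) choice \<Rightarrow> ('i, 'a, 's, 'n) sgraph \<Rightarrow>
    ('i, 'a, 's, 'n) sgraph" where
  "exp_graph \<chi> G = substitute G (\<chi> G) (\<lambda>e. exp_graph \<chi> (op_graph (act_op (elab e))))"
  by pat_completeness auto
termination
  by (relation "measure (\<lambda>(\<chi>, G). size G)") (auto intro: size_edge_graph)

declare exp_graph.simps [simp del]

lemma exp_graph_degree_0:
  fixes G :: "('i, 'a, 's, 'n) sgraph"
  assumes "is_sgraph 0 G"
  shows "exp_graph \<chi> G = G"
proof -
  have deg0: "\<not> positive act" if "is_act 0 act" for act :: "('i, 'a, 's, 'n) action"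
    using that by cases auto
  have "\<not> positive (elab e)" if "e |\<in>| edges G" for e
    using assms that deg0 by (auto elim: is_sgraph.cases)
  then have "pos_edges G = {||}" "ffilter (\<lambda>e. \<not> positive (elab e)) (edges G) = edges G"
    by (auto simp: pos_edges_def)
  moreover have "join_maps {hw G} = hw G"
  proof
    fix i
    show "join_maps {hw G} i = hw G i"
    proof (cases "i \<in> dom (hw G)")
      case True
      then have "(SOME f. f \<in> {hw G} \<and> i \<in> dom f) = hw G"
        by (intro some_equality) auto
      with True show ?thesis by (simp add: join_maps_def)
    next
      case False
      then show ?thesis by (simp add: join_maps_def domIff)
    qed
  qed
  moreover have "insts G = {||}"
    using assms by (auto elim: is_sgraph.cases)
  ultimately show ?thesis
    by (subst exp_graph.simps) (cases G; simp add: substitute_def)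
qed

definition inv_tapes :: "('i, 'a, 's, 'n) choice \<Rightarrow> ('i, 'a, 's, 'n) sgraph \<Rightarrow> 'i set" where
  "inv_tapes \<chi> G = (\<Union>e\<in>fset (pos_edges G). ran (copy_tape (\<chi> G e)))"

definition exp_op :: "('i, 'a, 's, 'n) choice \<Rightarrow> ('i, 'a, 's, 'n) oper \<Rightarrow>
    ('i, 'a, 's, 'n) oper" where
  "exp_op \<chi> op = Oper (exp_graph \<chi> (op_graph op)) (ext_tapes op) (val_tapes op)
     (int_tapes op \<union> inv_tapes \<chi> (op_graph op)) (op_start op) (op_finish op)"

definition exp_obj :: "('i, 'a, 's, 'n) choice \<Rightarrow> ('i, 'a, 's, 'n) obj \<Rightarrow>
    ('i, 'a, 's, 'n) obj" where
  "exp_obj \<chi> ob = Obj (val_hw ob) {||} (map (exp_op \<chi>) (obj_ops ob))"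

definition new_states :: "('i, 'a, 's, 'n) oper \<Rightarrow> 's set" where
  "new_states op = fset (states (op_graph op)) - SF op"

text \<open>For each positive edge \<open>e\<close>, the internal tapes of the expanded operation are renamed
  injectively to fresh tapes, its start and finish states become the source and the target of
  \<open>e\<close>, its other states and its edges are copied injectively and freshly, and all this is done
  disjointly for distinct edges. Since the states of \<open>G\<close> are kept, this is only possible if
  \<open>e\<close> is a loop whenever its operation has equal start and finish states.\<close>

definition choice_ok :: "('i, 'a, 's, 'n) choice \<Rightarrow> ('i, 'a, 's, 'n) sgraph \<Rightarrow> bool" where
  "choice_ok \<chi> G \<longleftrightarrow>
     (\<forall>e. e |\<in>| pos_edges G \<longrightarrow>
        (let c = \<chi> G e; op = exp_op \<chi> (act_op (elab e)) in
           dom (copy_tape c) = int_tapes op \<and> map_injective (copy_tape c) \<and>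
           ran (copy_tape c) \<inter> dom (hw G) = {} \<and>
           copy_state c (op_start op) = esrc e \<and> copy_state c (op_finish op) = etgt e \<and>
           inj_on (copy_state c) (new_states op) \<and>
           copy_state c ` new_states op \<inter> fset (states G) = {} \<and>
           inj_on (copy_name c) (fset (edges (op_graph op))) \<and>
           copy_name c ` fset (edges (op_graph op)) \<inter> ename ` fset (edges G) = {})) \<and>
     (\<forall>e e'. e |\<in>| pos_edges G \<and> e' |\<in>| pos_edges G \<and> e \<noteq> e' \<longrightarrow>
        (let c = \<chi> G e; op = exp_op \<chi> (act_op (elab e));
             c' = \<chi> G e'; op' = exp_op \<chi> (act_op (elab e')) in
           ran (copy_tape c) \<inter> ran (copy_tape c') = {} \<and>
           copy_state c ` new_states op \<inter> copy_state c' ` new_states op' = {} \<and>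
           copy_name c ` fset (edges (op_graph op)) \<inter>
             copy_name c' ` fset (edges (op_graph op')) = {}))"

text \<open>Admissibility is required for \<open>G\<close> and, hereditarily, for the operations of the objects
  occurring in \<open>G\<close>.\<close>

inductive expansion_choice :: "('i, 'a, 's, 'n) choice \<Rightarrow> ('i, 'a, 's, 'n) sgraph \<Rightarrow> bool"
  for \<chi> where
  "\<lbrakk> choice_ok \<chi> G;
     \<forall>inst. inst |\<in>| insts G \<longrightarrow>
       (\<forall>op\<in>set (obj_ops (inst_obj inst)). expansion_choice \<chi> (op_graph op)) \<rbrakk>
   \<Longrightarrow> expansion_choice \<chi> G"

definition expansion_choice_obj :: "('i, 'a, 's, 'n) choice \<Rightarrow> ('i, 'a, 's, 'n) obj \<Rightarrow> bool" where
  "expansion_choice_obj \<chi> ob \<longleftrightarrow> (\<forall>op\<in>set (obj_ops ob). expansion_choice \<chi> (op_graph op))"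

definition expanded_edges :: "('i, 'a, 's, 'n) choice \<Rightarrow> ('i, 'a, 's, 'n) sgraph \<Rightarrow>
    ('i, 'a, 's, 'n) sedge \<Rightarrow> ('i, 'a, 's, 'n) sedge set" where
  "expanded_edges \<chi> G e =
     copy_edge (\<chi> G e) e ` fset (edges (exp_graph \<chi> (op_graph (act_op (elab e)))))"

text \<open>The tuples in \<open>GL \<times> 1\<^sup>i\<^sup>n\<^sup>v\<close> and in \<open>ND\<^sup>1 \<times> 1\<^sup>i\<^sup>n\<^sup>v\<close>.\<close>

definition GL1 :: "('i, 'a, 's, 'n) choice \<Rightarrow> ('i, 'a, 's, 'n) sgraph \<Rightarrow> ('i, 'a) tuple set" where
  "GL1 \<chi> G = (\<lambda>w. w ++ trivial (inv_tapes \<chi> G)) ` GL G"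

definition ND1_inv :: "('i, 'a, 's, 'n) choice \<Rightarrow> ('i, 'a, 's, 'n) obj \<Rightarrow>
    ('i, 'a, 's, 'n) oper \<Rightarrow> ('i, 'a) tuple set" where
  "ND1_inv \<chi> ob op = (\<lambda>w. w ++ trivial (inv_tapes \<chi> (op_graph op))) ` ND1 ob op"


section \<open>Generic reduction\<close>

definition edge_path :: "('i, 'a, 's, 'n) sgraph \<Rightarrow> ('i, 'a, 's, 'n) sedge list \<Rightarrow> bool" where
  "edge_path G \<rho> \<longleftrightarrow> set \<rho> \<subseteq> fset (edges G) \<and> successively (\<lambda>e f. etgt e = esrc f) \<rho>"

text \<open>A piece of a path between two consecutive visits to proper states, and the generic edges
  it may be replaced by.\<close>

definition piece :: "('i, 'a, 's, 'n) sgraph \<Rightarrow> ('i, 'a, 's, 'n) sedge list \<Rightarrow> bool" where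
  "piece G \<pi> \<longleftrightarrow> \<pi> \<noteq> [] \<and> esrc (hd \<pi>) |\<in>| states G \<and> etgt (last \<pi>) |\<in>| states G \<and>
     (\<forall>f\<in>set (butlast \<pi>). etgt f |\<notin>| states G)"

definition replaces :: "('i, 'a, 's, 'n) choice \<Rightarrow> ('i, 'a, 's, 'n) sgraph \<Rightarrow>
    ('i, 'a, 's, 'n) sedge list \<Rightarrow> ('i, 'a, 's, 'n) gedge \<Rightarrow> bool" where
  "replaces \<chi> G \<pi> g \<longleftrightarrow>
     (\<exists>e. e |\<in>| edges G \<and> \<not> positive (elab e) \<and> \<pi> = [e] \<and> g = (S_hat, F_hat, e)) \<or>
     (\<exists>p q e. e |\<in>| pos_edges G \<and> set \<pi> \<subseteq> expanded_edges \<chi> G e \<and>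
        esrc (hd \<pi>) \<in> {esrc e, etgt e} \<and> etgt (last \<pi>) \<in> {esrc e, etgt e} \<and> g = (p, q, e) \<and>
        (esrc e \<noteq> etgt e \<longrightarrow>
           (p = S_hat \<longleftrightarrow> esrc (hd \<pi>) = esrc e) \<and> (q = S_hat \<longleftrightarrow> etgt (last \<pi>) = esrc e)))"

definition generic_reduction :: "('i, 'a, 's, 'n) choice \<Rightarrow> ('i, 'a, 's, 'n) sgraph \<Rightarrow>
    ('i, 'a, 's, 'n) sedge list \<Rightarrow> ('i, 'a, 's, 'n) gedge list \<Rightarrow> bool" where
  "generic_reduction \<chi> G \<rho> gs \<longleftrightarrow>
     edge_path (exp_graph \<chi> G) \<rho> \<and> generic_path G gs \<and>
     (\<exists>\<pi>s. \<rho> = concat \<pi>s \<and> (\<forall>\<pi>\<in>set \<pi>s. piece G \<pi>) \<and> list_all2 (replaces \<chi> G) \<pi>s gs)"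

end

theory Submission
  imports Defs
begin

text \<open>
  A path of the expansion between proper states falls into pieces between consecutive visits to
  proper states. The new states of the copies are fresh and disjoint, so a piece is either
  a single proper edge or a path in the copy for one edge \<open>e\<close> of positive degree. Seen
  through the renaming \<open>\<mu>\<^sub>e\<close>, the latter is a path of the expanded operation \<open>op\<^sub>e\<close> between
  its start and finish states, and the tapes outside the image of \<open>\<mu>\<^sub>e\<close> do not change
  (\<open>copy_step_iff\<close>, \<open>copy_run\<close>).

  The theorem follows by induction on the degree. Suppose that for the objects of the
  instances of \<open>G\<close> the expansion preserves the values, the set of admissible tuples of each
  operation, and the input-output relations (\<open>expands_correctly\<close>). Then a piece in
  a copy does what the generic edge over \<open>e\<close> does: it keeps the values of its own instance
  admissible and its internal tapes trivial at the ends, and it cannot change the values of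
  other instances, because it sees them only as immutable tapes (\<open>copy_piece\<close>). Putting the
  pieces together gives the reduction of computations of the expansion (\<open>run_reduction\<close>).
  Conversely, a generic edge over \<open>e\<close> is carried out in the copy, since the expanded operation
  has the same input-output relation (\<open>generic_edge_computation\<close>, \<open>run_lift\<close>).

  For an object whose operations have such graphs, two more facts are needed. First, a tuple with
  values of the object and trivial internal words lies in the graph language although value
  tapes of instances may be among the value tapes of the object: a nontrivial value occurs at an
  end of a computation of some operation, and all operations of the object share their
  instances (\<open>VAL_instances\<close>). Second, a computation between start and finish states
  of the operation has trivial internal tapes at one end if and only if it has them at the other;
  this is condition (O), applied to the generic reduction with each generic loop unfolded
  (\<open>internal_tape_trivial\<close>). With them, reduction and lifting identify values,
  admissible tuples and input-output relations of the object and its expansion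
  (\<open>correct_object.expands_correctly\<close>).
\<close>


section \<open>Tuples of words\<close>

lemma lang_iff:
  "w \<in> lang H \<longleftrightarrow> (\<forall>i. rel_option (\<lambda>u A. u \<in> free_words A) (w i) (H i))"
proof
  assume w: "w \<in> lang H"
  show "\<forall>i. rel_option (\<lambda>u A. u \<in> free_words A) (w i) (H i)"
  proof
    fix i
    from w have "dom w = dom H" by (simp add: lang_def)
    then have "w i = None \<longleftrightarrow> H i = None" by blast
    with w show "rel_option (\<lambda>u A. u \<in> free_words A) (w i) (H i)"
      by (cases "w i"; cases "H i") (auto simp: lang_def)
  qed
next
  assume r: "\<forall>i. rel_option (\<lambda>u A. u \<in> free_words A) (w i) (H i)"
  have "w i = None \<longleftrightarrow> H i = None" for i
    using r by (metis option.rel_distinct(1,2) option.exhaust)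
  then have "dom w = dom H" by (auto simp: dom_def)
  moreover have "u \<in> free_words A" if "w i = Some u" "H i = Some A" for i u A
    using r that by (metis option.rel_inject(2))
  ultimately show "w \<in> lang H" unfolding lang_def by blast
qed

lemma lang_dom: "w \<in> lang H \<Longrightarrow> dom w = dom H"
  by (simp add: lang_def)

lemma lang_map_comp: "w \<in> lang H \<Longrightarrow> w \<circ>\<^sub>m \<mu> \<in> lang (H \<circ>\<^sub>m \<mu>)"
  by (auto simp: lang_iff map_comp_def split: option.splits)

lemma lang_restrict: "w \<in> lang H \<Longrightarrow> w |` J \<in> lang (H |` J)"
  by (auto simp: lang_iff restrict_map_def)

lemma Nil_free_words [simp]: "[] \<in> free_words A"
  by (simp add: free_words_def)

lemma trivial_apply [simp]: "trivial J i = (if i \<in> J then Some [] else None)"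
  by (simp add: trivial_def)

lemma dom_trivial [simp]: "dom (trivial J) = J"
  by (auto simp: trivial_def dom_def)

lemma trivial_Un: "trivial (J \<union> K) = trivial J ++ trivial K"
  by (auto simp: map_add_def)

lemma trivial_lang: "trivial (dom H) \<in> lang H"
  by (auto simp: lang_def)

lemma Nil_mult [simp]: "[] \<cdot> u = u"
  by (simp add: word_mult_def)

text \<open>Multiplication by the trivial word on the right has to be applied to a reduced word to
  leave it unchanged.\<close>

lemma mult_Nil: "u \<in> free_words A \<Longrightarrow> u \<cdot> [] = u"
proof (induction u)
  case (Cons x u)
  then have "u \<in> free_words A" by (auto simp: free_words_def successively_Cons)
  with Cons have "foldr red_cons u [] = u" by (simp add: word_mult_def)
  moreover have "red_cons x u = x # u"
    using Cons.prems by (cases u) (auto simp: free_words_def)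
  ultimately show ?case by (simp add: word_mult_def)
qed (simp add: word_mult_def)

lemma act0_apply_other:
  assumes "w \<in> lang H" "lmul a i = []" "rmul a i = []"
  shows "act0_apply a w i = w i"
proof (cases "w i")
  case (Some u)
  with assms(1) obtain A where "u \<in> free_words A"
    by (metis lang_iff option_rel_Some1)
  with Some assms show ?thesis by (simp add: act0_apply_def mult_Nil)
qed (simp add: act0_apply_def)

lemma map_inv_eq_Some_iff:
  assumes "map_injective \<mu>"
  shows "map_inv \<mu> i = Some j \<longleftrightarrow> \<mu> j = Some i"
proof -
  have uniq: "j = k" if "\<mu> j = Some i" "\<mu> k = Some i" for j k
    using assms that unfolding map_injective_def by (metis domI inj_onD)
  show ?thesis
  proof
    assume "map_inv \<mu> i = Some j"
    then have "i \<in> ran \<mu>" "j = (SOME j. \<mu> j = Some i)"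
      by (auto simp: map_inv_def split: if_splits)
    then show "\<mu> j = Some i" by (auto simp: ran_def intro: someI)
  next
    assume j: "\<mu> j = Some i"
    then have "(SOME j. \<mu> j = Some i) = j" using uniq by (intro some_equality)
    with j show "map_inv \<mu> i = Some j" by (auto simp: map_inv_def ran_def)
  qed
qed

lemma map_inv_eq_None_iff: "map_inv \<mu> i = None \<longleftrightarrow> i \<notin> ran \<mu>"
  by (simp add: map_inv_def)

lemma reindex_image:
  "map_injective \<mu> \<Longrightarrow> \<mu> j = Some i \<Longrightarrow> reindex \<mu> w i = w j"
  by (simp add: reindex_def map_comp_def map_inv_eq_Some_iff[THEN iffD2])

lemma reindex_outside: "i \<notin> ran \<mu> \<Longrightarrow> reindex \<mu> w i = None"
  by (simp add: reindex_def map_comp_def map_inv_eq_None_iff[THEN iffD2])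

lemma dom_reindex:
  assumes "map_injective \<mu>" "dom \<mu> \<subseteq> dom w"
  shows "dom (reindex \<mu> w) = ran \<mu>"
proof -
  have "i \<in> ran \<mu> \<Longrightarrow> reindex \<mu> w i \<noteq> None" for i
    using assms by (auto simp: ran_def reindex_image)
  then show ?thesis using reindex_outside by (metis (no_types, opaque_lifting) domIff subset_antisym subsetI)
qed

lemma restrict_ran_eq_reindex:
  assumes "map_injective \<mu>" "dom v = dom \<mu>"
  shows "w |` ran \<mu> = reindex \<mu> v \<longleftrightarrow> w \<circ>\<^sub>m \<mu> = v"
proof
  assume *: "w |` ran \<mu> = reindex \<mu> v"
  have "(w \<circ>\<^sub>m \<mu>) j = v j" for j
  proof (cases "\<mu> j")
    case None
    with assms have "v j = None" by (metis domIff)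
    with None show ?thesis by simp
  next
    case (Some i)
    then have "(w |` ran \<mu>) i = w i" by (auto simp: ran_def restrict_map_def)
    with * Some assms(1) show ?thesis by (simp add: map_comp_def reindex_image)
  qed
  then show "w \<circ>\<^sub>m \<mu> = v" by (rule ext)
next
  assume *: "w \<circ>\<^sub>m \<mu> = v"
  have "(w |` ran \<mu>) i = reindex \<mu> v i" for i
  proof (cases "i \<in> ran \<mu>")
    case True
    then obtain j where "\<mu> j = Some i" by (auto simp: ran_def)
    with True * assms(1) show ?thesis by (auto simp: map_comp_def reindex_image)
  qed (simp add: reindex_outside)
  then show "w |` ran \<mu> = reindex \<mu> v" by (rule ext)
qed


section \<open>Computations as runs\<close>

text \<open>Computations are taken apart and put together step by step; for this, an inductive
  relation between the first and the last configuration is handier than a list of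
  configurations.\<close>

definition step :: "('i, 'a, 's, 'n) sgraph \<Rightarrow> ('i, 'a, 's) conf \<Rightarrow> ('i, 'a, 's, 'n) gedge \<Rightarrow>
    ('i, 'a, 's) conf \<Rightarrow> bool" where
  "step G c g c' \<longleftrightarrow> c \<in> configs G \<and> c' \<in> configs G \<and>
     (\<exists>p q e. g = (p, q, e) \<and> e |\<in>| edges G \<and> (insts G = {||} \<longrightarrow> p = S_hat \<and> q = F_hat) \<and>
        edge_end e p = snd c \<and> edge_end e q = snd c' \<and>
        IO_act_param in_IO G (elab e) p q (fst c) (fst c'))"

inductive run :: "('i, 'a, 's, 'n) sgraph \<Rightarrow> ('i, 'a, 's) conf \<Rightarrow> ('i, 'a, 's, 'n) gedge list \<Rightarrow>
    ('i, 'a, 's) conf \<Rightarrow> bool" for G where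
  run_Nil: "c \<in> configs G \<Longrightarrow> run G c [] c"
| run_Cons: "step G c g c1 \<Longrightarrow> run G c1 gs c2 \<Longrightarrow> run G c (g # gs) c2"

inductive_cases run_NilE: "run G c [] c'"
inductive_cases run_ConsE: "run G c (g # gs) c'"

lemma run_configs: "run G c gs c' \<Longrightarrow> c \<in> configs G \<and> c' \<in> configs G"
  by (induction rule: run.induct) (auto simp: step_def)

lemma run_append: "run G c gs c1 \<Longrightarrow> run G c1 hs c2 \<Longrightarrow> run G c (gs @ hs) c2"
  by (induction rule: run.induct) (auto intro: run_Cons)

lemma run_appendE:
  assumes "run G c (gs @ hs) c2"
  obtains c1 where "run G c gs c1" "run G c1 hs c2"
proof -
  have "\<exists>c1. run G c gs c1 \<and> run G c1 hs c2"
    using assms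
  proof (induction gs arbitrary: c)
    case Nil
    then have hs: "run G c hs c2" by simp
    then have "c \<in> configs G" using run_configs by blast
    with hs show ?case using run_Nil by blast
  next
    case (Cons g gs)
    from Cons.prems obtain c' where "step G c g c'" "run G c' (gs @ hs) c2"
      by (auto elim: run_ConsE)
    with Cons.IH obtain c1 where "run G c' gs c1" "run G c1 hs c2" by blast
    with \<open>step G c g c'\<close> show ?case using run_Cons by blast
  qed
  with that show thesis by blast
qed

lemma computation_iff:
  "computation G cs gs \<longleftrightarrow> length cs = Suc (length gs) \<and> set cs \<subseteq> configs G \<and>
     (\<forall>j<length gs. step G (cs ! j) (gs ! j) (cs ! Suc j))"
proof -
  have c: "(\<forall>c\<in>set cs. fst c \<in> GL_param in_VAL G \<and> snd c |\<in>| states G) \<longleftrightarrow> set cs \<subseteq> configs G"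
    by (auto simp: configs_def GL_def)
  have "step G (cs ! j) (gs ! j) (cs ! Suc j) \<longleftrightarrow> (\<exists>p q e. gs ! j = (p, q, e) \<and> e |\<in>| edges G \<and>
        (insts G = {||} \<longrightarrow> p = S_hat \<and> q = F_hat) \<and>
        gtail (gs ! j) = snd (cs ! j) \<and> ghead (gs ! j) = snd (cs ! Suc j) \<and>
        IO_act_param in_IO G (elab e) p q (fst (cs ! j)) (fst (cs ! Suc j)))"
    if "length cs = Suc (length gs)" "set cs \<subseteq> configs G" "j < length gs" for j
  proof -
    have "cs ! j \<in> configs G" "cs ! Suc j \<in> configs G" using that by auto
    then show ?thesis by (auto simp: step_def gtail_def ghead_def)
  qed
  then show ?thesis unfolding computation_def computation_param_def c by blast
qed

lemma computation_Nil: "computation G cs [] \<longleftrightarrow> (\<exists>c\<in>configs G. cs = [c])"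
  by (cases cs) (auto simp: computation_iff)

lemma computation_Cons:
  "computation G (c # cs) (g # gs) \<longleftrightarrow> cs \<noteq> [] \<and> step G c g (hd cs) \<and> computation G cs gs"
proof (cases cs)
  case Nil
  then show ?thesis by (simp add: computation_iff)
next
  case (Cons c1 cs')
  have "c \<in> configs G" if "step G c g c1" using that by (simp add: step_def)
  with Cons show ?thesis by (auto simp: computation_iff All_less_Suc2)
qed

lemma computation_run:
  "computation G cs gs \<Longrightarrow> run G (hd cs) gs (last cs)"
proof (induction gs arbitrary: cs)
  case (Cons g gs)
  then obtain c cs' where "cs = c # cs'" by (cases cs) (auto simp: computation_iff)
  with Cons show ?case by (auto simp: computation_Cons intro: run_Cons)
qed (auto simp: computation_Nil intro: run_Nil)

lemma run_computation:
  assumes "run G c gs c'"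
  obtains cs where "computation G cs gs" "hd cs = c" "last cs = c'"
proof -
  have "\<exists>cs. computation G cs gs \<and> hd cs = c \<and> last cs = c'"
    using assms
  proof (induction rule: run.induct)
    case (run_Nil c)
    then show ?case by (auto simp: computation_Nil)
  next
    case (run_Cons c g c1 gs c2)
    then obtain cs where cs: "computation G cs gs" "hd cs = c1" "last cs = c2" by blast
    then have "cs \<noteq> []" by (auto simp: computation_iff)
    with cs run_Cons.hyps(1) show ?case
      by (intro exI[of _ "c # cs"]) (simp add: computation_Cons)
  qed
  with that show thesis by blast
qed

lemma REACH_iff: "(w1, s1, w2, s2) \<in> REACH G \<longleftrightarrow> (\<exists>gs. run G (w1, s1) gs (w2, s2))"
proof
  assume "(w1, s1, w2, s2) \<in> REACH G"
  then obtain cs gs where "computation G cs gs" "hd cs = (w1, s1)" "last cs = (w2, s2)"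
    unfolding REACH_def REACH_param_def computation_def by blast
  then show "\<exists>gs. run G (w1, s1) gs (w2, s2)" using computation_run by metis
next
  assume "\<exists>gs. run G (w1, s1) gs (w2, s2)"
  then show "(w1, s1, w2, s2) \<in> REACH G"
    unfolding REACH_def REACH_param_def computation_def[symmetric] using run_computation by blast
qed

lemma GL_degree_0: "insts X = {||} \<Longrightarrow> GL X = lang (hw X)"
  by (simp add: GL_def GL_param_def)

lemma step_degree_0:
  assumes "insts X = {||}" "elab f = Deg0 a"
  shows "step X (w, s) (p, q, f) (w', s') \<longleftrightarrow> p = S_hat \<and> q = F_hat \<and> f |\<in>| edges X \<and>
     s = esrc f \<and> s' = etgt f \<and> s |\<in>| states X \<and> s' |\<in>| states X \<and>
     w \<in> lang (hw X) \<and> w' \<in> lang (hw X) \<and> accepts a w \<and> w' = act0_apply a w"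
  using assms by (auto simp: step_def configs_def GL_degree_0)

lemma run_path: "run G (w, s) gs (w', s') \<Longrightarrow>
    generic_path G gs \<and> (gs \<noteq> [] \<longrightarrow> gtail (hd gs) = s \<and> ghead (last gs) = s') \<and> (gs = [] \<longrightarrow> s' = s)"
proof (induction gs arbitrary: w s)
  case (Cons g gs)
  then obtain w1 s1 where 1: "step G (w, s) g (w1, s1)" "run G (w1, s1) gs (w', s')"
    by (auto elim!: run_ConsE)
  from 1(1) have "under g |\<in>| edges G" "gtail g = s" "ghead g = s1"
    by (auto simp: step_def under_def gtail_def ghead_def)
  with Cons.IH[OF 1(2)] show ?case
    by (cases gs) (auto simp: generic_path_def)
qed (auto simp: generic_path_def elim: run_NilE)


section \<open>The structure of the expansion\<close>

lemma join_maps_eq: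
  assumes "f \<in> M" "i \<in> dom f" "\<And>g. g \<in> M \<Longrightarrow> i \<in> dom g \<Longrightarrow> g i = f i"
  shows "join_maps M i = f i"
proof -
  define h where "h = (SOME f. f \<in> M \<and> i \<in> dom f)"
  have "h \<in> M \<and> i \<in> dom h"
    unfolding h_def by (rule someI[of "\<lambda>f. f \<in> M \<and> i \<in> dom f" f]) (simp add: assms(1,2))
  then have "h i = f i" using assms(3) by blast
  moreover have "join_maps M i = h i"
    unfolding join_maps_def h_def using assms(1,2) by (intro if_P) blast
  ultimately show ?thesis by simp
qed

lemma dom_join_maps: "dom (join_maps M) = (\<Union>f\<in>M. dom f)"
proof (intro subset_antisym subsetI)
  fix i assume "i \<in> dom (join_maps M)"
  then show "i \<in> (\<Union>f\<in>M. dom f)" by (auto simp: join_maps_def split: if_splits)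
next
  fix i assume "i \<in> (\<Union>f\<in>M. dom f)"
  then have ex: "\<exists>f. f \<in> M \<and> i \<in> dom f" by blast
  define h where "h = (SOME f. f \<in> M \<and> i \<in> dom f)"
  from someI_ex[OF ex] have "i \<in> dom h" by (simp add: h_def)
  moreover have "join_maps M i = h i"
    unfolding join_maps_def h_def using ex by (intro if_P) blast
  ultimately show "i \<in> dom (join_maps M)" by (simp add: domIff)
qed

text \<open>The properties of an expansion that are needed when a copy of it is substituted for an
  edge of a larger graph.\<close>

definition wf_expansion :: "('i, 'a, 's, 'n) choice \<Rightarrow> ('i, 'a, 's, 'n) sgraph \<Rightarrow> bool" where
  "wf_expansion \<chi> G \<longleftrightarrow>
     dom (hw (exp_graph \<chi> G)) = dom (hw G) \<union> inv_tapes \<chi> G \<and>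
     dom (hw G) \<inter> inv_tapes \<chi> G = {} \<and>
     (\<forall>i\<in>dom (hw G). hw (exp_graph \<chi> G) i = hw G i) \<and>
     (\<forall>f. f |\<in>| edges (exp_graph \<chi> G) \<longrightarrow>
        esrc f |\<in>| states (exp_graph \<chi> G) \<and> etgt f |\<in>| states (exp_graph \<chi> G) \<and>
        (\<exists>a. elab f = Deg0 a \<and> (\<forall>i. mentions0 a i \<longrightarrow> i \<in> dom (hw (exp_graph \<chi> G)))))"

definition inst_ok :: "('i, 'a, 's, 'n) inst \<Rightarrow> bool" where
  "inst_ok inst \<longleftrightarrow> obj_ok (inst_obj inst) \<and> map_injective (inst_map inst) \<and>
     dom (inst_map inst) = dom (val_hw (inst_obj inst))"

lemma exp_op_simps [simp]:
  "op_graph (exp_op \<chi> op) = exp_graph \<chi> (op_graph op)"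
  "op_start (exp_op \<chi> op) = op_start op" "op_finish (exp_op \<chi> op) = op_finish op"
  "SF (exp_op \<chi> op) = SF op"
  "int_tapes (exp_op \<chi> op) = int_tapes op \<union> inv_tapes \<chi> (op_graph op)"
  "ext_tapes (exp_op \<chi> op) = ext_tapes op" "val_tapes (exp_op \<chi> op) = val_tapes op"
  by (simp_all add: exp_op_def SF_def)

lemma insts_exp_graph [simp]: "insts (exp_graph \<chi> G) = {||}"
  by (subst exp_graph.simps) (simp add: substitute_def)

locale object_op =
  fixes \<chi> :: "('i, 'a, 's, 'n) choice" and ob :: "('i, 'a, 's, 'n) obj" and op :: "('i, 'a, 's, 'n) oper"
  assumes obj_ok: "obj_ok ob" and op: "op \<in> set (obj_ops ob)" and oper_ok: "oper_ok op"
    and wf_Y: "wf_expansion \<chi> (op_graph op)"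
begin

abbreviation "opx \<equiv> exp_op \<chi> op"
abbreviation "Y \<equiv> exp_graph \<chi> (op_graph op)"

lemma op_tapes: "dom (hw (op_graph op)) = ext_tapes op \<union> val_tapes op \<union> int_tapes op"
    "ext_tapes op \<inter> val_tapes op = {}" "ext_tapes op \<inter> int_tapes op = {}"
    "val_tapes op \<inter> int_tapes op = {}"
  using oper_ok by (auto simp: oper_ok_def)

lemma val_hw: "dom (val_hw ob) = val_tapes op" "hw (op_graph op) |` val_tapes op = val_hw ob"
  using obj_ok op by (auto simp: obj_ok_def)

lemma hw_Y: "dom (hw Y) = ext_tapes op \<union> val_tapes op \<union> int_tapes opx"
    "i \<in> dom (hw (op_graph op)) \<Longrightarrow> hw Y i = hw (op_graph op) i"
  using wf_Y op_tapes by (auto simp: wf_expansion_def)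

lemma int_opx_disjoint: "int_tapes opx \<inter> (ext_tapes op \<union> val_tapes op) = {}"
  using wf_Y op_tapes by (auto simp: wf_expansion_def)

lemma SF_lam: "s \<in> SF op \<Longrightarrow> \<exists>p. s = lam op p"
  unfolding SF_def by (metis insertE lam.simps singletonD)

end

text \<open>All that the expansion of \<open>G\<close> needs to know about the degree recursion: the instances and
  the labels of \<open>G\<close> are well formed, and the operations in its labels have already been
  expanded properly.\<close>

locale expansion =
  fixes \<chi> :: "('i, 'a, 's, 'n) choice" and G :: "('i, 'a, 's, 'n) sgraph"
  assumes graph_ok: "graph_ok G"
    and choice_ok: "choice_ok \<chi> G"
    and inst_ok: "inst |\<in>| insts G \<Longrightarrow> inst_ok inst"
    and label_wf: "e |\<in>| edges G \<Longrightarrow> elab e = Pos inst op \<mu> \<Longrightarrow>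
      op \<in> set (obj_ops (inst_obj inst)) \<and> dom \<mu> = ext_tapes op \<and> map_injective \<mu> \<and>
      ran \<mu> \<inter> inst_tapes inst = {} \<and> oper_ok op \<and> wf_expansion \<chi> (op_graph op)"
begin

abbreviation "Gexp \<equiv> exp_graph \<chi> G"

lemma edge_ok: "e |\<in>| edges G \<Longrightarrow> esrc e |\<in>| states G \<and> etgt e |\<in>| states G \<and> label_ok G (elab e)"
  using graph_ok by (simp add: graph_ok_def)

lemma states_Gexp: "s |\<in>| states Gexp \<longleftrightarrow> s |\<in>| states G \<or> (\<exists>e. e |\<in>| pos_edges G \<and>
    (\<exists>t. t |\<in>| states (exp_graph \<chi> (op_graph (act_op (elab e)))) \<and> s = copy_state (\<chi> G e) t))"
  by (subst exp_graph.simps) (auto simp: substitute_def ffUnion.rep_eq)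

lemma edges_Gexp: "f |\<in>| edges Gexp \<longleftrightarrow> f |\<in>| edges G \<and> \<not> positive (elab f) \<or>
    (\<exists>e. e |\<in>| pos_edges G \<and> (\<exists>f'. f' |\<in>| edges (exp_graph \<chi> (op_graph (act_op (elab e)))) \<and>
       f = copy_edge (\<chi> G e) e f'))"
  by (subst exp_graph.simps) (auto simp: substitute_def ffUnion.rep_eq)

lemma hw_Gexp: "hw Gexp = join_maps (insert (hw G) ((\<lambda>e. reindex (copy_tape (\<chi> G e))
    (hw (exp_graph \<chi> (op_graph (act_op (elab e)))))) ` fset (pos_edges G)))"
  by (subst exp_graph.simps) (simp add: substitute_def)

end

locale positive_edge = expansion +
  fixes e inst op \<mu>
  assumes edge: "e |\<in>| edges G" and label: "elab e = Pos inst op \<mu>"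
begin

abbreviation "c \<equiv> \<chi> G e"
abbreviation "m \<equiv> mu_edge (\<chi> G e) e"
lemma pos: "e |\<in>| pos_edges G"
  using edge label by (simp add: pos_edges_def)

lemma \<mu>: "dom \<mu> = ext_tapes op" "map_injective \<mu>" "ran \<mu> \<inter> inst_tapes inst = {}"
  using label_wf[OF edge label] by auto

lemma inst: "inst |\<in>| insts G"
  using edge_ok[OF edge] label by simp

sublocale object_op \<chi> "inst_obj inst" op
  using label_wf[OF edge label] inst_ok[OF inst] by unfold_locales (simp_all add: inst_ok_def)

lemma inst_map: "map_injective (inst_map inst)"
  and dom_inst_map: "dom (inst_map inst) = val_tapes op"
  using inst_ok[OF inst] val_hw(1) by (simp_all add: inst_ok_def)

lemma copy: "dom (copy_tape c) = int_tapes opx" "map_injective (copy_tape c)"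
    "ran (copy_tape c) \<inter> dom (hw G) = {}"
    "copy_state c (op_start op) = esrc e" "copy_state c (op_finish op) = etgt e"
    "inj_on (copy_state c) (new_states opx)"
    "copy_state c ` new_states opx \<inter> fset (states G) = {}"
proof -
  have op: "act_op (elab e) = op" by (simp add: label)
  note * = choice_ok[unfolded choice_ok_def Let_def, THEN conjunct1, rule_format, OF pos, unfolded op]
  from * show "dom (copy_tape c) = int_tapes opx" "map_injective (copy_tape c)"
    "ran (copy_tape c) \<inter> dom (hw G) = {}"
    "copy_state c (op_start op) = esrc e" "copy_state c (op_finish op) = etgt e"
    "inj_on (copy_state c) (new_states opx)"
    "copy_state c ` new_states opx \<inter> fset (states G) = {}"
    by simp_all
qed

lemma copy_lam: "copy_state c (lam op p) = edge_end e p"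
  using copy(4,5) by (cases p) auto

lemma mu_act: "mu_act (elab e) = \<mu> ++ inst_map inst"
  by (simp add: label)

lemma dom_mu_act: "dom (mu_act (elab e)) = ext_tapes op \<union> val_tapes op"
  using \<mu>(1) dom_inst_map by (auto simp: mu_act)

lemma m_ext: "j \<in> ext_tapes op \<Longrightarrow> m j = \<mu> j"
  and m_val: "j \<in> val_tapes op \<Longrightarrow> m j = inst_map inst j"
  and m_int: "j \<in> int_tapes opx \<Longrightarrow> m j = copy_tape c j"
  and m_act: "j \<in> dom (mu_act (elab e)) \<Longrightarrow> m j = mu_act (elab e) j"
proof -
  have *: "int_tapes opx \<inter> ext_tapes op = {}" "int_tapes opx \<inter> val_tapes op = {}"
    using int_opx_disjoint by auto
  have "(\<mu> ++ inst_map inst ++ copy_tape c) j = \<mu> j" if "j \<in> ext_tapes op"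
  proof -
    have "j \<notin> dom (copy_tape c)" "j \<notin> dom (inst_map inst)"
      unfolding copy(1) dom_inst_map using that *(1) op_tapes(2) by blast+
    then show ?thesis by (simp add: map_add_dom_app_simps)
  qed
  then show "j \<in> ext_tapes op \<Longrightarrow> m j = \<mu> j" by (simp add: mu_edge_def mu_act)
  have m_act: "m j = mu_act (elab e) j" if "j \<in> ext_tapes op \<union> val_tapes op"
  proof -
    have "j \<notin> dom (copy_tape c)" unfolding copy(1) using that * by blast
    then show ?thesis unfolding mu_edge_def by (rule map_add_dom_app_simps(3))
  qed
  then show "j \<in> dom (mu_act (elab e)) \<Longrightarrow> m j = mu_act (elab e) j" by (simp only: dom_mu_act)
  have "mu_act (elab e) j = inst_map inst j" if "j \<in> val_tapes op"
  proof -
    have "j \<in> dom (inst_map inst)" unfolding dom_inst_map by (rule that)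
    then show ?thesis unfolding mu_act by (rule map_add_dom_app_simps(1))
  qed
  with m_act show "j \<in> val_tapes op \<Longrightarrow> m j = inst_map inst j" by simp
  have "m j = copy_tape c j" if "j \<in> int_tapes opx"
  proof -
    have "j \<in> dom (copy_tape c)" unfolding copy(1) by (rule that)
    then show ?thesis unfolding mu_edge_def by (rule map_add_dom_app_simps(1))
  qed
  then show "j \<in> int_tapes opx \<Longrightarrow> m j = copy_tape c j" .
qed

lemma dom_m: "dom m = dom (hw Y)"
  unfolding mu_edge_def using dom_mu_act copy(1) hw_Y(1) by auto

lemma ran_mu_act: "ran (mu_act (elab e)) = ran \<mu> \<union> inst_tapes inst"
  unfolding mu_act by (rule ran_map_add) (use \<mu>(1) dom_inst_map op_tapes(2) in auto)

lemma ran_m: "ran m = ran (mu_act (elab e)) \<union> ran (copy_tape c)"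
  unfolding mu_edge_def
  by (rule ran_map_add) (use dom_mu_act copy(1) int_opx_disjoint in auto)

lemma act_tape: "mu_act (elab e) j = Some i \<Longrightarrow> i \<in> dom (hw G) \<and> hw G i = hw (op_graph op) j"
  using edge_ok[OF edge] label by simp

lemma ran_mu_act_hw: "ran (mu_act (elab e)) \<subseteq> dom (hw G)"
  using act_tape unfolding ran_def by blast

lemma m_injective: "map_injective m"
proof -
  have image: "f ` dom f = Some ` ran f" for f :: "'i \<rightharpoonup> 'i"
    by (force simp: ran_def)
  have ext: "m ` ext_tapes op = Some ` ran \<mu>"
    unfolding image[symmetric] \<mu>(1) by (rule image_cong[OF refl m_ext])
  have val: "m ` val_tapes op = Some ` inst_tapes inst"
    unfolding image[symmetric] dom_inst_map by (rule image_cong[OF refl m_val])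
  have int: "m ` int_tapes opx = Some ` ran (copy_tape c)"
    unfolding image[symmetric] copy(1) by (rule image_cong[OF refl m_int])
  have "inj_on m (ext_tapes op)"
    using \<mu>(2) unfolding map_injective_def \<mu>(1) by (simp add: m_ext cong: inj_on_cong)
  moreover have "inj_on m (val_tapes op)"
    using inst_map unfolding map_injective_def dom_inst_map by (simp add: m_val cong: inj_on_cong)
  moreover have "inj_on m (int_tapes opx)"
    using copy(2) unfolding map_injective_def copy(1)
    by (simp add: m_int del: exp_op_simps cong: inj_on_cong)
  moreover have union: "inj_on m (A \<union> B)"
    if "inj_on m A" "inj_on m B" "m ` A \<inter> m ` B = {}" for A B
    using that unfolding inj_on_Un by blast
  moreover have "m ` ext_tapes op \<inter> m ` val_tapes op = {}"
    unfolding ext val using \<mu>(3) by blast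
  moreover have "m ` (ext_tapes op \<union> val_tapes op) \<inter> m ` int_tapes opx = {}"
    unfolding image_Un ext val int using copy(3) ran_mu_act_hw ran_mu_act by blast
  ultimately have "inj_on m (ext_tapes op \<union> val_tapes op \<union> int_tapes opx)"
    by (intro union)
  then show ?thesis unfolding map_injective_def dom_m hw_Y(1) .
qed

end

context expansion
begin

lemma positive_edge: "e |\<in>| pos_edges G \<Longrightarrow> \<exists>inst op \<mu>. positive_edge \<chi> G e inst op \<mu>"
  using expansion_axioms
  by (cases "elab e") (auto simp: pos_edges_def positive_edge_def positive_edge_axioms_def)

lemma inv_tapes_hw: "dom (hw G) \<inter> inv_tapes \<chi> G = {}"
proof -
  have "ran (copy_tape (\<chi> G e)) \<inter> dom (hw G) = {}" if "e |\<in>| pos_edges G" for e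
    using positive_edge[OF that] positive_edge.copy(3) by blast
  then show ?thesis by (auto simp: inv_tapes_def)
qed

lemma copies_disjoint:
  assumes "e |\<in>| pos_edges G" "e' |\<in>| pos_edges G" "e \<noteq> e'"
  shows "ran (copy_tape (\<chi> G e)) \<inter> ran (copy_tape (\<chi> G e')) = {}"
    and "copy_state (\<chi> G e) ` new_states (exp_op \<chi> (act_op (elab e))) \<inter>
      copy_state (\<chi> G e') ` new_states (exp_op \<chi> (act_op (elab e'))) = {}"
proof -
  note * = choice_ok[unfolded choice_ok_def Let_def, THEN conjunct2, rule_format,
      OF conjI[OF assms(1) conjI[OF assms(2,3)]]]
  show "ran (copy_tape (\<chi> G e)) \<inter> ran (copy_tape (\<chi> G e')) = {}"
    by (rule *[THEN conjunct1])
  show "copy_state (\<chi> G e) ` new_states (exp_op \<chi> (act_op (elab e))) \<inter>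
      copy_state (\<chi> G e') ` new_states (exp_op \<chi> (act_op (elab e'))) = {}"
    by (rule *[THEN conjunct2, THEN conjunct1])
qed

lemma dom_copy_hw:
  assumes "e |\<in>| pos_edges G"
  shows "dom (reindex (copy_tape (\<chi> G e)) (hw (exp_graph \<chi> (op_graph (act_op (elab e)))))) =
    ran (copy_tape (\<chi> G e))"
proof -
  obtain inst op \<mu> where "positive_edge \<chi> G e inst op \<mu>" using positive_edge[OF assms] by blast
  then interpret positive_edge \<chi> G e inst op \<mu> .
  show ?thesis using copy(1,2) hw_Y(1) label by (intro dom_reindex) auto
qed

lemma dom_hw_Gexp: "dom (hw Gexp) = dom (hw G) \<union> inv_tapes \<chi> G"
  unfolding hw_Gexp dom_join_maps inv_tapes_def using dom_copy_hw by auto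

lemma hw_Gexp_proper:
  assumes "i \<in> dom (hw G)"
  shows "hw Gexp i = hw G i"
  unfolding hw_Gexp
proof (rule join_maps_eq)
  fix g
  assume g: "g \<in> insert (hw G) ((\<lambda>e. reindex (copy_tape (\<chi> G e))
    (hw (exp_graph \<chi> (op_graph (act_op (elab e)))))) ` fset (pos_edges G))" "i \<in> dom g"
  have "i \<notin> ran (copy_tape (\<chi> G e))" if "e |\<in>| pos_edges G" for e
    using inv_tapes_hw assms that by (auto simp: inv_tapes_def)
  with g dom_copy_hw show "g i = hw G i" by auto
qed (use assms in auto)

end

context positive_edge
begin

lemma hw_Gexp_copy:
  assumes "copy_tape c j = Some i"
  shows "hw Gexp i = hw Y j"
proof -
  have i: "i \<in> ran (copy_tape c)" using assms by (auto simp: ran_def)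
  have "hw Gexp i = reindex (copy_tape c) (hw (exp_graph \<chi> (op_graph (act_op (elab e))))) i"
    unfolding hw_Gexp
  proof (rule join_maps_eq)
    fix g
    assume g: "g \<in> insert (hw G) ((\<lambda>e. reindex (copy_tape (\<chi> G e))
      (hw (exp_graph \<chi> (op_graph (act_op (elab e)))))) ` fset (pos_edges G))" "i \<in> dom g"
    have "i \<notin> dom (hw G)" using i copy(3) by auto
    moreover have "i \<notin> ran (copy_tape (\<chi> G e'))" if "e' |\<in>| pos_edges G" "e' \<noteq> e" for e'
      using copies_disjoint(1)[OF pos that(1)] that(2) i by blast
    ultimately show "g i = reindex (copy_tape c) (hw (exp_graph \<chi> (op_graph (act_op (elab e))))) i"
      using g dom_copy_hw by blast
  qed (use pos dom_copy_hw[OF pos] i in auto)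
  then show ?thesis using assms copy(2) label by (simp add: reindex_image)
qed

lemma hw_Gexp_m: "m j = Some i \<Longrightarrow> hw Gexp i = hw Y j"
proof -
  assume ji: "m j = Some i"
  then have "j \<in> dom (mu_act (elab e)) \<or> j \<in> int_tapes opx"
    using dom_m hw_Y(1) dom_mu_act by auto
  then show ?thesis
  proof
    assume j: "j \<in> dom (mu_act (elab e))"
    with ji have "mu_act (elab e) j = Some i" by (simp add: m_act)
    from act_tape[OF this] have i: "i \<in> dom (hw G)" "hw G i = hw (op_graph op) j" by auto
    have "j \<in> dom (hw (op_graph op))" using j dom_mu_act op_tapes(1) by auto
    with i show ?thesis by (simp add: hw_Gexp_proper hw_Y(2))
  next
    assume "j \<in> int_tapes opx"
    with ji show ?thesis by (simp add: m_int hw_Gexp_copy)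
  qed
qed

lemma hw_Gexp_comp: "hw Gexp \<circ>\<^sub>m m = hw Y"
proof
  fix j show "(hw Gexp \<circ>\<^sub>m m) j = hw Y j"
  proof (cases "m j")
    case None
    then have "hw Y j = None" using dom_m by blast
    with None show ?thesis by simp
  qed (simp add: hw_Gexp_m)
qed

lemma ran_m_hw: "ran m \<subseteq> dom (hw Gexp)"
  using ran_mu_act_hw ran_m dom_hw_Gexp pos by (auto simp: inv_tapes_def)

lemma Y_edge:
  assumes "f |\<in>| edges Y"
  obtains a where "elab f = Deg0 a" "\<And>i. mentions0 a i \<Longrightarrow> i \<in> dom m"
    "esrc f |\<in>| states Y" "etgt f |\<in>| states Y"
  using wf_Y assms dom_m unfolding wf_expansion_def by metis

lemma copy_state_Y: "s |\<in>| states Y \<Longrightarrow> copy_state c s |\<in>| states Gexp"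
  unfolding states_Gexp using pos label by (intro disjI2 exI[of _ e]) auto

lemma copy_edge_Y: "f |\<in>| edges Y \<Longrightarrow> copy_edge c e f |\<in>| edges Gexp"
  unfolding edges_Gexp using pos label by (intro disjI2 exI[of _ e]) auto

lemma copy_state_proper:
  assumes "s |\<in>| states Y"
  shows "copy_state c s |\<in>| states G \<longleftrightarrow> s \<in> SF op"
proof
  assume "s \<in> SF op"
  then show "copy_state c s |\<in>| states G" using copy(4,5) edge_ok[OF edge] by (auto simp: SF_def)
next
  assume "copy_state c s |\<in>| states G"
  with copy(7) have "s \<notin> new_states opx" by auto
  with assms show "s \<in> SF op" by (simp add: new_states_def exp_op_def SF_def)
qed

end

lemma (in expansion) wf_expansion: "wf_expansion \<chi> G"
proof -
  have "esrc f |\<in>| states Gexp \<and> etgt f |\<in>| states Gexp \<and>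
      (\<exists>a. elab f = Deg0 a \<and> (\<forall>i. mentions0 a i \<longrightarrow> i \<in> dom (hw Gexp)))"
    if f: "f |\<in>| edges Gexp" for f
    using f[unfolded edges_Gexp]
  proof (elim disjE exE conjE)
    assume f: "f |\<in>| edges G" "\<not> positive (elab f)"
    then obtain a where a: "elab f = Deg0 a" by (cases "elab f") auto
    with edge_ok[OF f(1)] have a_over: "act0_over (hw G) a" by simp
    have "i \<in> dom (hw Gexp)" if "mentions0 a i" for i
    proof (rule ccontr)
      assume "i \<notin> dom (hw Gexp)"
      then have "i \<notin> dom (hw G)" using dom_hw_Gexp by blast
      with a_over that show False by (simp add: act0_over_def mentions0_def)
    qed
    with a edge_ok[OF f(1)] show ?thesis by (simp add: states_Gexp)
  next
    fix e f' assume e: "e |\<in>| pos_edges G"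
      and f': "f' |\<in>| edges (exp_graph \<chi> (op_graph (act_op (elab e))))"
      and f: "f = copy_edge (\<chi> G e) e f'"
    obtain inst op \<mu> where "positive_edge \<chi> G e inst op \<mu>" using positive_edge[OF e] by blast
    then interpret positive_edge \<chi> G e inst op \<mu> .
    from f' label have "f' |\<in>| edges Y" by simp
    then obtain a where a: "elab f' = Deg0 a" "esrc f' |\<in>| states Y" "etgt f' |\<in>| states Y"
      by (rule Y_edge)
    have "i \<in> ran m" if "map_inv m i \<noteq> None" for i
      using that by (auto simp: map_inv_eq_None_iff)
    then have "\<forall>i. mentions0 (case rename_label m (elab f') of Deg0 b \<Rightarrow> b) i \<longrightarrow> i \<in> dom (hw Gexp)"
      using ran_m_hw by (auto simp: a(1) mentions0_def reindex_def map_comp_def split: option.splits)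
    then show ?thesis using a copy_state_Y by (auto simp: f copy_edge_def)
  qed
  then show ?thesis
    unfolding wf_expansion_def using dom_hw_Gexp inv_tapes_hw hw_Gexp_proper by auto
qed


section \<open>Values and graph languages\<close>

lemma VAL_lang:
  assumes "v \<in> VAL ob"
  shows "v \<in> lang (val_hw ob)"
proof -
  have "equivclp (val_adj_param in_VAL in_IO ob) (trivial (dom (val_hw ob))) v"
    using assms by (auto simp: VAL_def elim: in_VAL.cases)
  then show ?thesis
  proof (induction rule: equivclp_induct)
    case base
    show ?case by (rule trivial_lang)
  qed (auto simp: val_adj_param_def)
qed

lemma map_comp_cong:
  assumes "\<And>i. i \<in> ran \<mu> \<Longrightarrow> w i = w' i"
  shows "w \<circ>\<^sub>m \<mu> = w' \<circ>\<^sub>m \<mu>"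
  using assms by (auto simp: map_comp_def ran_def fun_eq_iff split: option.splits)

lemma (in object_op) ND_iff:
  "w \<in> ND ob op \<longleftrightarrow>
     w \<in> lang (hw (op_graph op) |` (ext_tapes op \<union> val_tapes op)) \<and> w |` val_tapes op \<in> VAL ob"
proof
  assume "w \<in> ND ob op"
  then obtain x v where w: "w = x ++ v" and x: "x \<in> lang (hw (op_graph op) |` ext_tapes op)"
    and v: "v \<in> VAL ob"
    by (auto simp: ND_def ND_param_def VAL_def)
  have v': "v \<in> lang (hw (op_graph op) |` val_tapes op)" using VAL_lang[OF v] val_hw(2) by simp
  have dom: "dom x = ext_tapes op" "dom v = val_tapes op"
    using lang_dom[OF x] lang_dom[OF v'] op_tapes(1) by auto
  have xi: "x i = None" if "i \<notin> ext_tapes op" for i using that dom(1) by blast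
  have vi: "v i = None" if "i \<notin> val_tapes op" for i using that dom(2) by blast
  have "rel_option (\<lambda>u A. u \<in> free_words A) (w i)
      ((hw (op_graph op) |` (ext_tapes op \<union> val_tapes op)) i)" for i
    using x[unfolded lang_iff, rule_format, of i] v'[unfolded lang_iff, rule_format, of i] xi[of i] vi[of i]
      op_tapes(2)
    by (cases "i \<in> val_tapes op"; cases "i \<in> ext_tapes op")
      (auto simp: w map_add_def restrict_map_def split: option.splits)
  moreover have "w |` val_tapes op = v"
  proof
    fix i
    show "(w |` val_tapes op) i = v i"
    proof (cases "i \<in> val_tapes op")
      case True
      then have "x i = None" using xi op_tapes(2) by blast
      with True show ?thesis by (simp add: w map_add_def split: option.splits)
    qed (simp add: vi)
  qed
  ultimately show "w \<in> lang (hw (op_graph op) |` (ext_tapes op \<union> val_tapes op)) \<and> w |` val_tapes op \<in> VAL ob"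
    using v by (auto simp: lang_iff)
next
  assume *: "w \<in> lang (hw (op_graph op) |` (ext_tapes op \<union> val_tapes op)) \<and> w |` val_tapes op \<in> VAL ob"
  have "w |` ext_tapes op \<in> lang (hw (op_graph op) |` (ext_tapes op \<union> val_tapes op) |` ext_tapes op)"
    using * lang_restrict by blast
  then have "w |` ext_tapes op \<in> lang (hw (op_graph op) |` ext_tapes op)"
    by (simp add: Int_absorb1)
  moreover have "w = (w |` ext_tapes op) ++ (w |` val_tapes op)"
  proof
    fix i
    have "w i = None" if "i \<notin> ext_tapes op" "i \<notin> val_tapes op"
    proof -
      have "i \<notin> dom (hw (op_graph op) |` (ext_tapes op \<union> val_tapes op))" using that by simp
      then show ?thesis using * lang_dom by blast
    qed
    then show "w i = ((w |` ext_tapes op) ++ (w |` val_tapes op)) i"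
      by (cases "w i") (auto simp: map_add_def restrict_map_def)
  qed
  ultimately show "w \<in> ND ob op" using * unfolding ND_def ND_param_def VAL_def by blast
qed

lemma (in object_op) ND1_inv_iff:
  "w \<in> ND1_inv \<chi> ob op \<longleftrightarrow>
     w \<in> lang (hw Y) \<and> (\<forall>i\<in>int_tapes opx. w i = Some []) \<and> w |` val_tapes op \<in> VAL ob"
proof -
  let ?J = "ext_tapes op \<union> val_tapes op"
  have ND1: "w \<in> ND1_inv \<chi> ob op \<longleftrightarrow> (\<exists>v\<in>ND ob op. w = v ++ trivial (int_tapes opx))"
    by (simp add: ND1_inv_def ND1_def image_image trivial_Un image_iff)
  have hw_eq: "hw Y i = (hw (op_graph op) |` ?J) i" if "i \<notin> int_tapes opx" for i
  proof (cases "i \<in> ?J")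
    case True
    then show ?thesis using op_tapes(1) hw_Y(2)[of i] by simp
  next
    case False
    then have "i \<notin> dom (hw Y)" using that hw_Y(1) by blast
    with False show ?thesis by (simp add: domIff)
  qed
  show ?thesis
  proof
    assume "w \<in> ND1_inv \<chi> ob op"
    then obtain v where v: "v \<in> ND ob op" and w: "w = v ++ trivial (int_tapes opx)"
      unfolding ND1 by blast
    from v have v': "v \<in> lang (hw (op_graph op) |` ?J)" "v |` val_tapes op \<in> VAL ob"
      unfolding ND_iff by auto
    have wi: "w i = Some []" if "i \<in> int_tapes opx" for i
      using that unfolding w map_add_def trivial_apply by simp
    have wv: "w i = v i" if "i \<notin> int_tapes opx" for i
      using that unfolding w map_add_def trivial_apply by simp
    have "rel_option (\<lambda>u A. u \<in> free_words A) (w i) (hw Y i)" for i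
    proof (cases "i \<in> int_tapes opx")
      case True
      then obtain A where "hw Y i = Some A" using hw_Y(1) by blast
      then show ?thesis using wi[OF True] by simp
    next
      case False
      then show ?thesis
        unfolding wv[OF False] hw_eq[OF False] using v'(1) unfolding lang_iff by blast
    qed
    moreover have "w |` val_tapes op = v |` val_tapes op"
    proof
      fix i
      show "(w |` val_tapes op) i = (v |` val_tapes op) i"
      proof (cases "i \<in> val_tapes op")
        case True
        then have "i \<notin> int_tapes opx" using int_opx_disjoint by blast
        then show ?thesis using wv True by simp
      qed simp
    qed
    ultimately show "w \<in> lang (hw Y) \<and> (\<forall>i\<in>int_tapes opx. w i = Some []) \<and> w |` val_tapes op \<in> VAL ob"
      using wi v'(2) unfolding lang_iff by (simp del: exp_op_simps)
  next
    assume *: "w \<in> lang (hw Y) \<and> (\<forall>i\<in>int_tapes opx. w i = Some []) \<and> w |` val_tapes op \<in> VAL ob"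
    have "w |` ?J \<in> lang (hw Y |` ?J)" using * lang_restrict by blast
    moreover have "hw Y |` ?J = hw (op_graph op) |` ?J"
    proof
      fix i
      show "(hw Y |` ?J) i = (hw (op_graph op) |` ?J) i"
        using hw_eq[of i] int_opx_disjoint by (cases "i \<in> ?J") auto
    qed
    moreover have "w |` ?J |` val_tapes op = w |` val_tapes op"
      by (simp add: Int_absorb1)
    ultimately have "w |` ?J \<in> ND ob op" unfolding ND_iff using * by simp
    moreover have "w = (w |` ?J) ++ trivial (int_tapes opx)"
    proof
      fix i
      have "w i = None" if "i \<notin> ?J" "i \<notin> int_tapes opx"
      proof -
        from that have "i \<notin> dom (hw Y)" using hw_Y(1) by blast
        then show ?thesis using * lang_dom[of w] by blast
      qed
      then show "w i = ((w |` ?J) ++ trivial (int_tapes opx)) i"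
        using * unfolding map_add_def restrict_map_def trivial_apply by (auto simp del: exp_op_simps)
    qed
    ultimately show "w \<in> ND1_inv \<chi> ob op" unfolding ND1 by blast
  qed
qed

context expansion
begin

lemma inst_tapes_hw: "inst |\<in>| insts G \<Longrightarrow> inst_tapes inst \<subseteq> dom (hw G)"
  using graph_ok unfolding graph_ok_def by blast

lemma GL_iff: "w \<in> GL G \<longleftrightarrow> w \<in> lang (hw G) \<and>
    (\<forall>inst. inst |\<in>| insts G \<longrightarrow> w \<circ>\<^sub>m inst_map inst \<in> VAL (inst_obj inst))"
proof -
  have "w |` inst_tapes inst \<in> reindex (inst_map inst) ` VAL (inst_obj inst) \<longleftrightarrow>
      w \<circ>\<^sub>m inst_map inst \<in> VAL (inst_obj inst)" if "inst |\<in>| insts G" for inst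
  proof -
    have "w |` inst_tapes inst = reindex (inst_map inst) v \<longleftrightarrow> w \<circ>\<^sub>m inst_map inst = v"
      if "v \<in> VAL (inst_obj inst)" for v
      using inst_ok[OF \<open>inst |\<in>| insts G\<close>] lang_dom[OF VAL_lang[OF that]]
      by (intro restrict_ran_eq_reindex) (simp_all add: inst_ok_def)
    then show ?thesis by (auto simp: image_iff)
  qed
  then show ?thesis by (auto simp: GL_def GL_param_def VAL_def[symmetric])
qed

abbreviation "one_inv \<equiv> trivial (inv_tapes \<chi> G)"
abbreviation "visible w \<equiv> w |` dom (hw G)"

lemma add_one_inv_apply:
  "i \<notin> inv_tapes \<chi> G \<Longrightarrow> (w ++ one_inv) i = w i" "i \<in> inv_tapes \<chi> G \<Longrightarrow> (w ++ one_inv) i = Some []"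
  by (simp_all add: map_add_def)

lemma visible_add_one_inv: "w \<in> lang (hw G) \<Longrightarrow> visible (w ++ one_inv) = w"
proof
  fix i assume w: "w \<in> lang (hw G)"
  show "visible (w ++ one_inv) i = w i"
  proof (cases "i \<in> dom (hw G)")
    case True
    then have "i \<notin> inv_tapes \<chi> G" using inv_tapes_hw by blast
    then show ?thesis using True add_one_inv_apply(1) by simp
  next
    case False
    then have "w i = None" using lang_dom[OF w] by blast
    then show ?thesis using False by simp
  qed
qed

lemma visible_map_comp: "ran \<mu> \<subseteq> dom (hw G) \<Longrightarrow> visible w \<circ>\<^sub>m \<mu> = w \<circ>\<^sub>m \<mu>"
  by (rule map_comp_cong) (simp add: subsetD)

lemma lang_Gexp_iff:
  "w \<in> lang (hw Gexp) \<and> (\<forall>i\<in>inv_tapes \<chi> G. w i = Some []) \<longleftrightarrow>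
   visible w \<in> lang (hw G) \<and> w = visible w ++ one_inv" (is "?L \<longleftrightarrow> ?R")
proof
  assume L: ?L
  have "hw Gexp |` dom (hw G) = hw G"
  proof
    fix i show "(hw Gexp |` dom (hw G)) i = hw G i"
      using hw_Gexp_proper[of i] by (cases "i \<in> dom (hw G)") (simp_all add: domIff)
  qed
  then have "visible w \<in> lang (hw G)" using L lang_restrict by metis
  moreover have "w i = (visible w ++ one_inv) i" for i
  proof (cases "i \<in> inv_tapes \<chi> G")
    case True
    then show ?thesis using L by (simp add: add_one_inv_apply)
  next
    case False
    then have "i \<notin> dom (hw G) \<Longrightarrow> w i = None" using L lang_dom[of w] dom_hw_Gexp by blast
    then show ?thesis using False by (cases "i \<in> dom (hw G)") (simp_all add: add_one_inv_apply)
  qed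
  ultimately show ?R by blast
next
  assume R: ?R
  have inv: "w i = Some []" if "i \<in> inv_tapes \<chi> G" for i
    using R that add_one_inv_apply(2) by metis
  have "rel_option (\<lambda>u A. u \<in> free_words A) (w i) (hw Gexp i)" for i
  proof (cases "i \<in> inv_tapes \<chi> G")
    case True
    then obtain A where "hw Gexp i = Some A" using dom_hw_Gexp by blast
    then show ?thesis using inv[OF True] by simp
  next
    case False
    then have "w i = visible w i" using R add_one_inv_apply(1) by metis
    moreover have "hw Gexp i = hw G i"
    proof (cases "i \<in> dom (hw G)")
      case outside: False
      then have "i \<notin> dom (hw Gexp)" using False dom_hw_Gexp by blast
      with outside show ?thesis by (simp add: domIff)
    qed (rule hw_Gexp_proper)
    ultimately show ?thesis using R unfolding lang_iff by metis
  qed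
  then show ?L using inv unfolding lang_iff by blast
qed

lemma GL1_visible: "w \<in> GL1 \<chi> G \<longleftrightarrow> visible w \<in> GL G \<and> w = visible w ++ one_inv"
  unfolding GL1_def using visible_add_one_inv GL_iff by (auto simp: image_iff)

lemma add_one_inv_GL1: "w \<in> GL G \<Longrightarrow> w ++ one_inv \<in> GL1 \<chi> G"
  by (simp add: GL1_def)

lemma GL1_iff: "w \<in> GL1 \<chi> G \<longleftrightarrow> w \<in> lang (hw Gexp) \<and> (\<forall>i\<in>inv_tapes \<chi> G. w i = Some []) \<and>
    (\<forall>inst. inst |\<in>| insts G \<longrightarrow> w \<circ>\<^sub>m inst_map inst \<in> VAL (inst_obj inst))"
  using lang_Gexp_iff[of w] visible_map_comp[OF inst_tapes_hw, of _ w]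
  unfolding GL1_visible GL_iff by auto

end


section \<open>The copy of an expanded operation\<close>

text \<open>Outside the image of the renaming, a renamed action has trivial multipliers and no guard;
  since words are reduced, multiplying them by trivial words does not change them. The support
  condition on \<open>a\<close> ensures that no guard of \<open>a\<close> gets lost.\<close>

lemma rename_label_effect:
  assumes \<mu>: "map_injective \<mu>" and supp: "\<And>i. mentions0 a i \<Longrightarrow> i \<in> dom \<mu>" and w: "w \<in> lang H"
  shows "\<exists>b. rename_label \<mu> (Deg0 a) = Deg0 b \<and>
    (accepts b w \<longleftrightarrow> accepts a (w \<circ>\<^sub>m \<mu>)) \<and>
    (\<forall>w'. w' = act0_apply b w \<longleftrightarrow>
       w' \<circ>\<^sub>m \<mu> = act0_apply a (w \<circ>\<^sub>m \<mu>) \<and> (\<forall>i. i \<notin> ran \<mu> \<longrightarrow> w' i = w i))"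
proof -
  define b where "b = Act0
     (\<lambda>i. case map_inv \<mu> i of None \<Rightarrow> [] | Some j \<Rightarrow> lmul a j)
     (\<lambda>i. case map_inv \<mu> i of None \<Rightarrow> [] | Some j \<Rightarrow> rmul a j)
     (reindex \<mu> (guard a))"
  have b_image: "lmul b i = lmul a j" "rmul b i = rmul a j" "guard b i = guard a j"
    if "\<mu> j = Some i" for i j
    using that \<mu> by (simp_all add: b_def reindex_image map_inv_eq_Some_iff[THEN iffD2])
  have b_outside: "lmul b i = []" "rmul b i = []" "guard b i = None" if "i \<notin> ran \<mu>" for i
    using that by (simp_all add: b_def reindex_outside map_inv_eq_None_iff[THEN iffD2])
  have apply_image: "act0_apply b w i = act0_apply a (w \<circ>\<^sub>m \<mu>) j" if "\<mu> j = Some i" for i j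
    using that by (simp add: act0_apply_def b_image)
  have apply_outside: "act0_apply b w i = w i" if "i \<notin> ran \<mu>" for i
    using act0_apply_other[OF w] b_outside[OF that] by blast
  have "accepts b w \<longleftrightarrow> accepts a (w \<circ>\<^sub>m \<mu>)"
  proof
    assume acc: "accepts b w"
    show "accepts a (w \<circ>\<^sub>m \<mu>)"
      unfolding accepts_def map_le_def
    proof
      fix j assume j: "j \<in> dom (guard a)"
      then have "mentions0 a j" unfolding mentions0_def domIff by blast
      with supp obtain i where i: "\<mu> j = Some i" by blast
      with j b_image(3) have "i \<in> dom (guard b)" by (simp add: domIff)
      with acc have "guard b i = w i" unfolding accepts_def map_le_def by blast
      with i b_image(3) show "guard a j = (w \<circ>\<^sub>m \<mu>) j" by simp
    qed
  next
    assume acc: "accepts a (w \<circ>\<^sub>m \<mu>)"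
    show "accepts b w"
      unfolding accepts_def map_le_def
    proof
      fix i assume i: "i \<in> dom (guard b)"
      have "i \<in> ran \<mu>"
      proof (rule ccontr)
        assume "i \<notin> ran \<mu>"
        with i b_outside(3) show False by (simp add: domIff)
      qed
      then obtain j where j: "\<mu> j = Some i" by (auto simp: ran_def)
      with i b_image(3) have "j \<in> dom (guard a)" by (simp add: domIff)
      with acc have "guard a j = (w \<circ>\<^sub>m \<mu>) j" unfolding accepts_def map_le_def by blast
      with j b_image(3) show "guard b i = w i" by simp
    qed
  qed
  moreover have "w' = act0_apply b w \<longleftrightarrow>
      w' \<circ>\<^sub>m \<mu> = act0_apply a (w \<circ>\<^sub>m \<mu>) \<and> (\<forall>i. i \<notin> ran \<mu> \<longrightarrow> w' i = w i)" for w'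
  proof (intro iffI conjI)
    assume w': "w' = act0_apply b w"
    show "w' \<circ>\<^sub>m \<mu> = act0_apply a (w \<circ>\<^sub>m \<mu>)"
    proof
      fix j show "(w' \<circ>\<^sub>m \<mu>) j = act0_apply a (w \<circ>\<^sub>m \<mu>) j"
        using apply_image by (cases "\<mu> j") (simp_all add: w', simp add: act0_apply_def)
    qed
    show "\<forall>i. i \<notin> ran \<mu> \<longrightarrow> w' i = w i" using apply_outside w' by blast
  next
    assume *: "w' \<circ>\<^sub>m \<mu> = act0_apply a (w \<circ>\<^sub>m \<mu>) \<and> (\<forall>i. i \<notin> ran \<mu> \<longrightarrow> w' i = w i)"
    show "w' = act0_apply b w"
    proof
      fix i
      show "w' i = act0_apply b w i"
      proof (cases "i \<in> ran \<mu>")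
        case True
        then obtain j where j: "\<mu> j = Some i" by (auto simp: ran_def)
        then have "w' i = (w' \<circ>\<^sub>m \<mu>) j" by simp
        with * apply_image[OF j] show ?thesis by metis
      next
        case False
        with * apply_outside show ?thesis by metis
      qed
    qed
  qed
  moreover have "rename_label \<mu> (Deg0 a) = Deg0 b" by (simp add: b_def)
  ultimately show ?thesis by blast
qed

lemma step_degree_0_edge:
  "insts X = {||} \<Longrightarrow> step X c g c' \<Longrightarrow> \<exists>f. g = (S_hat, F_hat, f) \<and> f |\<in>| edges X \<and>
     esrc f = snd c \<and> etgt f = snd c'"
  unfolding step_def by force

context positive_edge
begin

text \<open>This dictionary between the copy and the expanded operation is used in both directions:
  for cutting a path of the expansion into generic edges, and for carrying out a generic edge
  in the expansion.\<close>

lemma copy_step_iff: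
  assumes f: "f |\<in>| edges Y"
  shows "step Gexp (w, s) (S_hat, F_hat, copy_edge c e f) (w', s') \<longleftrightarrow>
    s = copy_state c (esrc f) \<and> s' = copy_state c (etgt f) \<and>
    w \<in> lang (hw Gexp) \<and> w' \<in> lang (hw Gexp) \<and> (\<forall>i. i \<notin> ran m \<longrightarrow> w' i = w i) \<and>
    step Y (w \<circ>\<^sub>m m, esrc f) (S_hat, F_hat, f) (w' \<circ>\<^sub>m m, etgt f)"
proof (cases "w \<in> lang (hw Gexp)")
  case w: True
  obtain a where a: "elab f = Deg0 a" "\<And>i. mentions0 a i \<Longrightarrow> i \<in> dom m"
    "esrc f |\<in>| states Y" "etgt f |\<in>| states Y"
    using Y_edge[OF f] by blast
  obtain b where b: "rename_label m (Deg0 a) = Deg0 b" "accepts b w \<longleftrightarrow> accepts a (w \<circ>\<^sub>m m)"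
    "\<And>w'. w' = act0_apply b w \<longleftrightarrow>
       w' \<circ>\<^sub>m m = act0_apply a (w \<circ>\<^sub>m m) \<and> (\<forall>i. i \<notin> ran m \<longrightarrow> w' i = w i)"
    using rename_label_effect[OF m_injective a(2) w] by blast
  have lang: "u \<in> lang (hw Gexp) \<Longrightarrow> u \<circ>\<^sub>m m \<in> lang (hw Y)" for u
    using lang_map_comp[of u "hw Gexp" m] hw_Gexp_comp by simp
  have copy: "elab (copy_edge c e f) = Deg0 b" "esrc (copy_edge c e f) = copy_state c (esrc f)"
    "etgt (copy_edge c e f) = copy_state c (etgt f)"
    using b(1) a(1) by (simp_all add: copy_edge_def)
  show ?thesis
    unfolding step_degree_0[OF insts_exp_graph copy(1)] step_degree_0[OF insts_exp_graph a(1)] b(2,3)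
    using w lang copy(2,3) f copy_edge_Y[OF f] copy_state_Y a(3,4) by auto
qed (simp add: step_def configs_def GL_degree_0)

text \<open>A new state determines the copy to which it belongs and its original there, because new
  states are copied injectively and disjointly for distinct edges.\<close>

lemma copy_state_eq:
  assumes "t |\<in>| states Y" "copy_state c t |\<notin>| states G"
    and e': "e' |\<in>| pos_edges G"
    and t': "t' |\<in>| states (exp_graph \<chi> (op_graph (act_op (elab e'))))"
    and eq: "copy_state (\<chi> G e') t' = copy_state c t"
  shows "e' = e \<and> t' = t"
proof -
  have t: "t \<in> new_states opx"
    using assms(1,2) copy_state_proper by (simp add: new_states_def)
  obtain inst' op' \<mu>' where "positive_edge \<chi> G e' inst' op' \<mu>'" using positive_edge[OF e'] by blast
  then interpret e': positive_edge \<chi> G e' inst' op' \<mu>' .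
  have t'': "t' \<in> new_states (exp_op \<chi> op')"
    using t' eq assms(2) e'.copy_state_proper[of t'] e'.label by (simp add: new_states_def)
  have "e' = e"
  proof (rule ccontr)
    assume "e' \<noteq> e"
    then have "copy_state (\<chi> G e') ` new_states (exp_op \<chi> op') \<inter> copy_state c ` new_states opx = {}"
      using copies_disjoint(2)[OF e' pos] e'.label label by simp
    with t t'' eq show False by blast
  qed
  moreover from this have "op' = op" using e'.label label by simp
  ultimately show ?thesis using t t'' eq copy(6) by (simp add: inj_on_def)
qed

text \<open>A path that has entered the copy for \<open>e\<close> can leave it only through a proper state, since
  the new states of the copy are fresh. Up to its first proper state it is therefore
  a path of the expanded operation.\<close>

lemma copy_run:
  assumes "run Gexp (w, s) gs (w', s')" "gs \<noteq> []"
    and "under (hd gs) = copy_edge c e f" "f |\<in>| edges Y"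
    and "\<forall>g\<in>set (butlast gs). ghead g |\<notin>| states G" "s' |\<in>| states G"
  shows "\<exists>fs t. run Y (w \<circ>\<^sub>m m, esrc f) fs (w' \<circ>\<^sub>m m, t) \<and> t \<in> SF op \<and> s' = copy_state c t \<and>
    set (map under gs) \<subseteq> expanded_edges \<chi> G e \<and> (\<forall>i. i \<notin> ran m \<longrightarrow> w' i = w i)"
  using assms
proof (induction gs arbitrary: w s f)
  case (Cons g gs)
  obtain w1 s1 where 1: "step Gexp (w, s) g (w1, s1)" "run Gexp (w1, s1) gs (w', s')"
    using Cons.prems(1) by (auto elim: run_ConsE)
  have g: "g = (S_hat, F_hat, copy_edge c e f)"
    using step_degree_0_edge[OF insts_exp_graph 1(1)] Cons.prems(3) by (auto simp: under_def)
  note st = 1(1)[unfolded g copy_step_iff[OF Cons.prems(4)]]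
  have exp_f: "under g \<in> expanded_edges \<chi> G e"
    using Cons.prems(4) label by (simp add: expanded_edges_def g under_def)
  have tgt: "etgt f |\<in>| states Y" using Y_edge[OF Cons.prems(4)] by blast
  show ?case
  proof (cases gs)
    case Nil
    with 1(2) have "w1 = w'" "s1 = s'" by (auto elim: run_NilE)
    then have stY: "step Y (w \<circ>\<^sub>m m, esrc f) (S_hat, F_hat, f) (w' \<circ>\<^sub>m m, etgt f)"
      using st by blast
    then have "(w' \<circ>\<^sub>m m, etgt f) \<in> configs Y" by (simp add: step_def)
    from run_Cons[OF stY run_Nil[OF this]]
    have "run Y (w \<circ>\<^sub>m m, esrc f) [(S_hat, F_hat, f)] (w' \<circ>\<^sub>m m, etgt f)" .
    moreover have "etgt f \<in> SF op"
      using st Cons.prems(6) \<open>s1 = s'\<close> copy_state_proper[OF tgt] by simp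
    ultimately show ?thesis
      using st exp_f \<open>w1 = w'\<close> \<open>s1 = s'\<close> Nil
      by (intro exI[of _ "[(S_hat, F_hat, f)]"] exI[of _ "etgt f"]) simp
  next
    case (Cons g2 gs2)
    have "ghead g = s1" using 1(1) by (auto simp: step_def ghead_def)
    then have new: "s1 |\<notin>| states G" using Cons.prems(5) \<open>gs = g2 # gs2\<close> by simp
    obtain c2 where "step Gexp (w1, s1) g2 c2" using 1(2) Cons by (auto elim: run_ConsE)
    then obtain h where h: "g2 = (S_hat, F_hat, h)" "h |\<in>| edges Gexp" "esrc h = s1"
      using step_degree_0_edge[OF insts_exp_graph] by fastforce
    then have "h |\<notin>| edges G" using new edge_ok by blast
    with h(2) obtain e' f' where e': "e' |\<in>| pos_edges G"
      and f': "f' |\<in>| edges (exp_graph \<chi> (op_graph (act_op (elab e'))))"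
      and hf': "h = copy_edge (\<chi> G e') e' f'"
      unfolding edges_Gexp by blast
    obtain inst' op' \<mu>' where "positive_edge \<chi> G e' inst' op' \<mu>'" using positive_edge[OF e'] by blast
    then interpret e': positive_edge \<chi> G e' inst' op' \<mu>' .
    from f' have "f' |\<in>| edges (exp_graph \<chi> (op_graph op'))" by (simp add: e'.label)
    then have "esrc f' |\<in>| states (exp_graph \<chi> (op_graph op'))" by (rule e'.Y_edge)
    then have "esrc f' |\<in>| states (exp_graph \<chi> (op_graph (act_op (elab e'))))"
      by (simp add: e'.label)
    moreover have "copy_state (\<chi> G e') (esrc f') = copy_state c (etgt f)"
      using h(3) hf' st by (simp add: copy_edge_def)
    moreover have "copy_state c (etgt f) |\<notin>| states G" using new st by simp
    ultimately have eq: "e' = e" "esrc f' = etgt f"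
      using copy_state_eq[OF tgt _ e'] by blast+
    have f'Y: "f' |\<in>| edges Y" using f' eq(1) label by simp
    have "under (hd gs) = copy_edge c e f'"
      using Cons h(1) hf' eq(1) by (simp add: under_def)
    moreover have "\<forall>g\<in>set (butlast gs). ghead g |\<notin>| states G"
      using Cons.prems(5) Cons by simp
    ultimately obtain fs t where fs: "run Y (w1 \<circ>\<^sub>m m, esrc f') fs (w' \<circ>\<^sub>m m, t)" "t \<in> SF op"
      "s' = copy_state c t" "set (map under gs) \<subseteq> expanded_edges \<chi> G e"
      "\<forall>i. i \<notin> ran m \<longrightarrow> w' i = w1 i"
      using Cons.IH[OF 1(2) _ _ f'Y _ Cons.prems(6)] Cons by blast
    have "run Y (w \<circ>\<^sub>m m, esrc f) ((S_hat, F_hat, f) # fs) (w' \<circ>\<^sub>m m, t)"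
      using st fs(1) eq(2) run_Cons by metis
    then show ?thesis using fs exp_f st by (intro exI[of _ "(S_hat, F_hat, f) # fs"] exI[of _ t]) simp
  qed
qed simp

text \<open>Conversely, a tuple \<open>u\<close> of the expanded operation is placed on the image of \<open>\<mu>\<^sub>e\<close>, the
  other tapes holding the contents \<open>z\<close>.\<close>

lemma frame_apply:
  shows "m j = Some i \<Longrightarrow> dom z \<inter> ran m = {} \<Longrightarrow> (reindex m u ++ z) i = u j"
    and "i \<notin> ran m \<Longrightarrow> (reindex m u ++ z) i = z i"
proof -
  assume "m j = Some i" "dom z \<inter> ran m = {}"
  then have "z i = None" by (metis disjoint_iff domIff ranI)
  then show "(reindex m u ++ z) i = u j"
    using reindex_image[OF m_injective \<open>m j = Some i\<close>] by (simp add: map_add_def)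
next
  assume "i \<notin> ran m"
  then show "(reindex m u ++ z) i = z i"
    by (simp add: map_add_def reindex_outside split: option.splits)
qed

lemma frame_comp:
  assumes "u \<in> lang (hw Y)" "dom z \<inter> ran m = {}"
  shows "(reindex m u ++ z) \<circ>\<^sub>m m = u"
proof
  fix j
  show "((reindex m u ++ z) \<circ>\<^sub>m m) j = u j"
  proof (cases "m j")
    case None
    then have "u j = None" using lang_dom[OF assms(1)] dom_m by blast
    with None show ?thesis by simp
  qed (use frame_apply(1)[OF _ assms(2)] in simp)
qed

lemma frame_lang:
  assumes u: "u \<in> lang (hw Y)" and z: "z \<in> lang (hw Gexp |` (- ran m))"
  shows "reindex m u ++ z \<in> lang (hw Gexp)"
  unfolding lang_iff
proof
  fix i
  have disj: "dom z \<inter> ran m = {}" using lang_dom[OF z] by auto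
  show "rel_option (\<lambda>u A. u \<in> free_words A) ((reindex m u ++ z) i) (hw Gexp i)"
  proof (cases "i \<in> ran m")
    case True
    then obtain j where j: "m j = Some i" by (auto simp: ran_def)
    from u have "rel_option (\<lambda>u A. u \<in> free_words A) (u j) (hw Y j)" unfolding lang_iff by blast
    then show ?thesis unfolding frame_apply(1)[OF j disj] hw_Gexp_m[OF j] .
  next
    case False
    from z have "rel_option (\<lambda>u A. u \<in> free_words A) (z i) ((hw Gexp |` (- ran m)) i)"
      unfolding lang_iff by blast
    with False show ?thesis unfolding frame_apply(2)[OF False] by simp
  qed
qed

lemma copy_computation:
  assumes Y: "computation Y cs gs" and z: "z \<in> lang (hw Gexp |` (- ran m))"
  shows "computation Gexp (map (\<lambda>(u, s). (reindex m u ++ z, copy_state c s)) cs)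
    (map (\<lambda>(p, q, f). (p, q, copy_edge c e f)) gs)"
proof -
  let ?F = "\<lambda>(u, s). (reindex m u ++ z, copy_state c s)"
  have disj: "dom z \<inter> ran m = {}" using lang_dom[OF z] by auto
  have configs: "?F x \<in> configs Gexp" if "x \<in> configs Y" for x
    using that frame_lang[OF _ z] copy_state_Y by (auto simp: configs_def GL_degree_0)
  have step: "step Gexp (?F x) (case g of (p, q, f) \<Rightarrow> (p, q, copy_edge c e f)) (?F y)"
    if st: "step Y x g y" for x g y
  proof -
    obtain u s u' s' where xy: "x = (u, s)" "y = (u', s')" by (cases x; cases y)
    obtain f where f: "g = (S_hat, F_hat, f)" "f |\<in>| edges Y" "esrc f = s" "etgt f = s'"
      using step_degree_0_edge[OF insts_exp_graph st] xy by auto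
    have u: "u \<in> lang (hw Y)" "u' \<in> lang (hw Y)"
      using st xy by (auto simp: step_def configs_def GL_degree_0)
    show ?thesis
      unfolding xy f(1) prod.case copy_step_iff[OF f(2)] frame_comp[OF u(1) disj] frame_comp[OF u(2) disj]
      using st xy f frame_lang[OF u(1) z] frame_lang[OF u(2) z] by (auto simp: frame_apply(2))
  qed
  show ?thesis
    using Y configs step unfolding computation_iff by (auto simp: nth_append)
qed

end


section \<open>Pieces of a path and generic edges\<close>

text \<open>The facts about an object of lower degree that carry the induction on the degree: its
  values, the words on which its operations act, and their input-output relations survive the
  expansion.\<close>

definition expands_correctly :: "('i, 'a, 's, 'n) choice \<Rightarrow> ('i, 'a, 's, 'n) obj \<Rightarrow> bool" where
  "expands_correctly \<chi> ob \<longleftrightarrow> VAL (exp_obj \<chi> ob) = VAL ob \<and>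
     (\<forall>op\<in>set (obj_ops ob).
        (\<forall>w1 s1 w2 s2. (w1, s1, w2, s2) \<in> REACH (op_graph (exp_op \<chi> op)) \<and> s1 \<in> SF op \<and> s2 \<in> SF op
           \<longrightarrow> (w1 \<in> ND1_inv \<chi> ob op \<longleftrightarrow> w2 \<in> ND1_inv \<chi> ob op)) \<and>
        IO (exp_obj \<chi> ob) (exp_op \<chi> op) = IO ob op)"

lemma IO_iff: "(w1, s1, w2, s2) \<in> IO ob op \<longleftrightarrow> in_IO ob op w1 s1 w2 s2"
  by (simp add: IO_def)

lemma in_IO_iff: "in_IO ob op w1 s1 w2 s2 \<longleftrightarrow>
    w1 \<in> ND ob op \<and> w2 \<in> ND ob op \<and> s1 \<in> SF op \<and> s2 \<in> SF op \<and>
    (w1 ++ trivial (int_tapes op), s1, w2 ++ trivial (int_tapes op), s2) \<in> REACH (op_graph op)"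
  unfolding ND_def REACH_def by (subst in_IO.simps) blast

lemma (in object_op) ND_exp:
  assumes "VAL (exp_obj \<chi> ob) = VAL ob"
  shows "ND (exp_obj \<chi> ob) opx = ND ob op"
proof -
  have "hw Y |` ext_tapes op = hw (op_graph op) |` ext_tapes op"
  proof
    fix i
    show "(hw Y |` ext_tapes op) i = (hw (op_graph op) |` ext_tapes op) i"
      using hw_Y(2)[of i] op_tapes(1) by (cases "i \<in> ext_tapes op") auto
  qed
  moreover have "in_VAL (exp_obj \<chi> ob) v \<longleftrightarrow> in_VAL ob v" for v
    using assms by (auto simp: VAL_def)
  ultimately show ?thesis by (simp add: ND_def ND_param_def)
qed

context positive_edge
begin

lemma comp_ND1_inv_iff:
  assumes "u \<in> lang (hw Gexp)"
  shows "u \<circ>\<^sub>m m \<in> ND1_inv \<chi> (inst_obj inst) op \<longleftrightarrow>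
    (\<forall>i\<in>ran (copy_tape c). u i = Some []) \<and> u \<circ>\<^sub>m inst_map inst \<in> VAL (inst_obj inst)"
proof -
  have "(u \<circ>\<^sub>m m) |` val_tapes op = u \<circ>\<^sub>m inst_map inst"
  proof
    fix j
    show "((u \<circ>\<^sub>m m) |` val_tapes op) j = (u \<circ>\<^sub>m inst_map inst) j"
    proof (cases "j \<in> val_tapes op")
      case True
      then show ?thesis using m_val[OF True] by (simp add: map_comp_def)
    next
      case False
      then have "inst_map inst j = None" using dom_inst_map by blast
      with False show ?thesis by simp
    qed
  qed
  moreover have "(\<forall>j\<in>int_tapes opx. (u \<circ>\<^sub>m m) j = Some []) \<longleftrightarrow> (\<forall>i\<in>ran (copy_tape c). u i = Some [])"
  proof -
    have "(u \<circ>\<^sub>m m) j = Some [] \<longleftrightarrow> u i = Some []" if "copy_tape c j = Some i" for i j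
    proof -
      have "j \<in> int_tapes opx" using that copy(1) by blast
      from m_int[OF this] that show ?thesis by simp
    qed
    then show ?thesis unfolding copy(1)[symmetric] by (auto simp: ran_def)
  qed
  moreover have "u \<circ>\<^sub>m m \<in> lang (hw Y)"
    using lang_map_comp[OF assms, of m] hw_Gexp_comp by simp
  ultimately show ?thesis unfolding ND1_inv_iff by simp
qed

lemma comp_mu_act:
  assumes "\<And>i. i \<in> ran (copy_tape c) \<Longrightarrow> u i = Some []"
  shows "u \<circ>\<^sub>m m = (u \<circ>\<^sub>m mu_act (elab e)) ++ trivial (int_tapes opx)"
proof
  fix j
  show "(u \<circ>\<^sub>m m) j = ((u \<circ>\<^sub>m mu_act (elab e)) ++ trivial (int_tapes opx)) j"
  proof (cases "j \<in> int_tapes opx")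
    case True
    then obtain i where i: "copy_tape c j = Some i" using copy(1) by blast
    then have "u i = Some []" using assms by (simp add: ranI)
    with m_int[OF True] i True show ?thesis by (simp add: map_add_def)
  next
    case False
    have "m j = mu_act (elab e) j"
    proof (cases "j \<in> dom (mu_act (elab e))")
      case outside: False
      then have "j \<notin> dom m" using False dom_m hw_Y(1) dom_mu_act by blast
      with outside show ?thesis by (simp add: domIff)
    qed (rule m_act)
    with False show ?thesis by (simp add: map_add_def map_comp_def)
  qed
qed

lemma hw_Gexp_mu_act:
  "hw Gexp \<circ>\<^sub>m mu_act (elab e) = hw (op_graph op) |` (ext_tapes op \<union> val_tapes op)"
proof
  fix j
  show "(hw Gexp \<circ>\<^sub>m mu_act (elab e)) j = (hw (op_graph op) |` (ext_tapes op \<union> val_tapes op)) j"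
  proof (cases "mu_act (elab e) j")
    case None
    then have "j \<notin> ext_tapes op \<union> val_tapes op" using dom_mu_act by blast
    with None show ?thesis by simp
  next
    case (Some i)
    then have "j \<in> ext_tapes op \<union> val_tapes op" using dom_mu_act by blast
    with Some act_tape[OF Some] hw_Gexp_proper[of i] show ?thesis by simp
  qed
qed

lemma comp_mu_act_ND:
  assumes "u \<in> lang (hw Gexp)" "u \<circ>\<^sub>m inst_map inst \<in> VAL (inst_obj inst)"
  shows "u \<circ>\<^sub>m mu_act (elab e) \<in> ND (inst_obj inst) op"
proof -
  have "(u \<circ>\<^sub>m mu_act (elab e)) |` val_tapes op = u \<circ>\<^sub>m inst_map inst"
  proof
    fix j
    show "((u \<circ>\<^sub>m mu_act (elab e)) |` val_tapes op) j = (u \<circ>\<^sub>m inst_map inst) j"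
    proof (cases "j \<in> val_tapes op")
      case True
      then have "j \<in> dom (mu_act (elab e))" using dom_mu_act by blast
      then show ?thesis using True m_val[OF True] m_act by (simp add: map_comp_def)
    next
      case False
      then have "inst_map inst j = None" using dom_inst_map by blast
      with False show ?thesis by simp
    qed
  qed
  with assms lang_map_comp[OF assms(1), of "mu_act (elab e)"] hw_Gexp_mu_act
  show ?thesis unfolding ND_iff by simp
qed

text \<open>By the assumption on the object of lower degree, the input-output relation of the expanded
  operation is the one of the operation itself, so that a run of the former shows what a
  generic edge labelled with the latter may do.\<close>

lemma run_Y_IO:
  assumes good: "expands_correctly \<chi> (inst_obj inst)"
    and lang: "w \<in> lang (hw Gexp)" "w' \<in> lang (hw Gexp)"
    and ND: "w \<circ>\<^sub>m m \<in> ND1_inv \<chi> (inst_obj inst) op" "w' \<circ>\<^sub>m m \<in> ND1_inv \<chi> (inst_obj inst) op"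
    and run: "run Y (w \<circ>\<^sub>m m, t) fs (w' \<circ>\<^sub>m m, t')" and SF: "t \<in> SF op" "t' \<in> SF op"
  shows "in_IO (inst_obj inst) op (w \<circ>\<^sub>m mu_act (elab e)) t (w' \<circ>\<^sub>m mu_act (elab e)) t'"
proof -
  have VAL: "VAL (exp_obj \<chi> (inst_obj inst)) = VAL (inst_obj inst)"
    and IO: "IO (exp_obj \<chi> (inst_obj inst)) opx = IO (inst_obj inst) op"
    using good op by (auto simp: expands_correctly_def)
  note w = ND(1)[unfolded comp_ND1_inv_iff[OF lang(1)]] and w' = ND(2)[unfolded comp_ND1_inv_iff[OF lang(2)]]
  have "w \<circ>\<^sub>m mu_act (elab e) \<in> ND (inst_obj inst) op" "w' \<circ>\<^sub>m mu_act (elab e) \<in> ND (inst_obj inst) op"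
    using comp_mu_act_ND lang w w' by blast+
  moreover have "((w \<circ>\<^sub>m mu_act (elab e)) ++ trivial (int_tapes opx), t,
      (w' \<circ>\<^sub>m mu_act (elab e)) ++ trivial (int_tapes opx), t') \<in> REACH Y"
    using run w w' comp_mu_act[of w] comp_mu_act[of w'] unfolding REACH_iff by metis
  ultimately have "in_IO (exp_obj \<chi> (inst_obj inst)) opx
      (w \<circ>\<^sub>m mu_act (elab e)) t (w' \<circ>\<^sub>m mu_act (elab e)) t'"
    unfolding in_IO_iff ND_exp[OF VAL] using SF by (simp del: exp_op_simps(5))
  then show ?thesis using IO by (simp only: IO_iff[symmetric])
qed

text \<open>This is what immutability is for: the operation may see value tapes of another instance
  as external tapes, but it cannot change them.\<close>

lemma other_instance_unchanged:
  assumes io: "in_IO (inst_obj inst) op (w \<circ>\<^sub>m mu_act (elab e)) t (w' \<circ>\<^sub>m mu_act (elab e)) t'"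
    and outside: "\<And>i. i \<notin> ran m \<Longrightarrow> w' i = w i"
    and inst': "inst' |\<in>| insts G" "inst' \<noteq> inst"
  shows "w' \<circ>\<^sub>m inst_map inst' = w \<circ>\<^sub>m inst_map inst'"
proof (rule map_comp_cong)
  fix i assume i: "i \<in> inst_tapes inst'"
  show "w' i = w i"
  proof (cases "i \<in> ran m")
    case True
    have "i \<in> dom (hw G)" using i inst_tapes_hw[OF inst'(1)] by blast
    then have "i \<notin> ran (copy_tape c)" using copy(3) by blast
    moreover have "inst_tapes inst' \<inter> inst_tapes inst = {}"
      using graph_ok inst' inst unfolding graph_ok_def by blast
    then have "i \<notin> inst_tapes inst" using i by blast
    ultimately have "i \<in> ran \<mu>" using True ran_m ran_mu_act by blast
    then have "mentions_var (elab e) i" by (simp add: label)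
    moreover have "\<forall>e inst i. e |\<in>| edges G \<and> inst |\<in>| insts G \<and> i \<in> inst_tapes inst \<and>
        mentions_var (elab e) i \<longrightarrow> mentions_immutable (elab e) i"
      using graph_ok unfolding graph_ok_def by (elim conjE)
    ultimately have "mentions_immutable (elab e) i" using edge inst'(1) i by blast
    then obtain a where a: "\<mu> a = Some i" "immutable (inst_obj inst) op a" by (auto simp: label)
    then have "a \<in> ext_tapes op" using \<mu>(1) by blast
    then have "mu_act (elab e) a = Some i"
      using a(1) m_ext[of a] m_act[of a] dom_mu_act by simp
    moreover have "(w \<circ>\<^sub>m mu_act (elab e)) a = (w' \<circ>\<^sub>m mu_act (elab e)) a"
      using a(2) io unfolding immutable_def IO_def by blast
    ultimately show ?thesis by simp
  qed (rule outside)
qed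

text \<open>The piece is a run of the expanded operation, which by assumption preserves values and
  trivial internal words and realises the input-output relation of the operation. The ends
  \<open>p\<close> and \<open>q\<close> of the generic edge are read off in the expanded operation, since the endpoints
  of the piece do not reveal them if \<open>e\<close> is a loop.\<close>

lemma copy_piece:
  assumes good: "expands_correctly \<chi> (inst_obj inst)"
    and run: "run Gexp (w, s) gs (w', s')" and gs: "gs \<noteq> []"
    and proper: "s |\<in>| states G" "s' |\<in>| states G" "\<forall>g\<in>set (butlast gs). ghead g |\<notin>| states G"
    and f: "under (hd gs) = copy_edge c e f" "f |\<in>| edges Y"
    and ends: "esrc (hd (map under gs)) = s" "etgt (last (map under gs)) = s'"
  shows "w \<in> GL1 \<chi> G \<longleftrightarrow> w' \<in> GL1 \<chi> G"
    and "w \<in> GL1 \<chi> G \<Longrightarrow> \<exists>g. step G (visible w, s) g (visible w', s') \<and> replaces \<chi> G (map under gs) g"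
proof -
  have lang: "w \<in> lang (hw Gexp)" "w' \<in> lang (hw Gexp)"
    using run_configs[OF run] by (auto simp: configs_def GL_degree_0)
  obtain fs t where Y: "run Y (w \<circ>\<^sub>m m, esrc f) fs (w' \<circ>\<^sub>m m, t)" "t \<in> SF op" "s' = copy_state c t"
    "set (map under gs) \<subseteq> expanded_edges \<chi> G e" "\<forall>i. i \<notin> ran m \<longrightarrow> w' i = w i"
    using copy_run[OF run gs f proper(3,2)] by blast
  have s: "s = copy_state c (esrc f)" using ends(1) f(1) gs by (simp add: hd_map copy_edge_def)
  have "esrc f |\<in>| states Y" using f(2) by (rule Y_edge)
  then have SF: "esrc f \<in> SF op" using copy_state_proper proper(1) s by simp
  have ND: "w \<circ>\<^sub>m m \<in> ND1_inv \<chi> (inst_obj inst) op \<longleftrightarrow> w' \<circ>\<^sub>m m \<in> ND1_inv \<chi> (inst_obj inst) op"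
  proof -
    have "(w \<circ>\<^sub>m m, esrc f, w' \<circ>\<^sub>m m, t) \<in> REACH (op_graph opx)"
      unfolding exp_op_simps REACH_iff using Y(1) by (rule exI)
    then show ?thesis using good op SF Y(2) unfolding expands_correctly_def by blast
  qed
  have sub: "ran (copy_tape c) \<subseteq> inv_tapes \<chi> G" using pos by (auto simp: inv_tapes_def)
  have GL1_ND: "u \<circ>\<^sub>m m \<in> ND1_inv \<chi> (inst_obj inst) op" if "u \<in> GL1 \<chi> G" for u
    using that inst sub unfolding GL1_iff by (subst comp_ND1_inv_iff) auto
  have iff: "w \<in> GL1 \<chi> G \<longleftrightarrow> w' \<in> GL1 \<chi> G"
    and io: "in_IO (inst_obj inst) op (w \<circ>\<^sub>m mu_act (elab e)) (esrc f) (w' \<circ>\<^sub>m mu_act (elab e)) t"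
    if both: "w \<circ>\<^sub>m m \<in> ND1_inv \<chi> (inst_obj inst) op" "w' \<circ>\<^sub>m m \<in> ND1_inv \<chi> (inst_obj inst) op"
  proof -
    show io: "in_IO (inst_obj inst) op (w \<circ>\<^sub>m mu_act (elab e)) (esrc f) (w' \<circ>\<^sub>m mu_act (elab e)) t"
      using run_Y_IO[OF good lang both Y(1) SF Y(2)] .
    note w = both(1)[unfolded comp_ND1_inv_iff[OF lang(1)]]
      and w' = both(2)[unfolded comp_ND1_inv_iff[OF lang(2)]]
    have "w i = Some [] \<longleftrightarrow> w' i = Some []" if "i \<in> inv_tapes \<chi> G" for i
    proof (cases "i \<in> ran (copy_tape c)")
      case False
      have "i \<notin> dom (hw G)" using that inv_tapes_hw by blast
      then have "i \<notin> ran m" using False ran_m ran_mu_act_hw by blast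
      with Y(5) show ?thesis by simp
    qed (use w w' in simp)
    moreover have "w \<circ>\<^sub>m inst_map inst' \<in> VAL (inst_obj inst') \<longleftrightarrow>
        w' \<circ>\<^sub>m inst_map inst' \<in> VAL (inst_obj inst')" if "inst' |\<in>| insts G" for inst'
    proof (cases "inst' = inst")
      case False
      then show ?thesis using other_instance_unchanged[OF io _ that] Y(5) by simp
    qed (use w w' in simp)
    ultimately show "w \<in> GL1 \<chi> G \<longleftrightarrow> w' \<in> GL1 \<chi> G"
      unfolding GL1_iff using lang by blast
  qed
  show "w \<in> GL1 \<chi> G \<longleftrightarrow> w' \<in> GL1 \<chi> G" using GL1_ND ND iff by blast
  assume w: "w \<in> GL1 \<chi> G"
  then have both: "w \<circ>\<^sub>m m \<in> ND1_inv \<chi> (inst_obj inst) op" "w' \<circ>\<^sub>m m \<in> ND1_inv \<chi> (inst_obj inst) op"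
    using GL1_ND ND by blast+
  have w': "w' \<in> GL1 \<chi> G" using iff[OF both] w by blast
  \<comment> \<open>If start and finish state of the operation coincide, then so do the ends of \<open>e\<close>, and any
    choice of \<open>p\<close> and \<open>q\<close> will do.\<close>
  obtain p q where p: "esrc f = lam op p" and q: "t = lam op q" using SF_lam SF Y(2) by blast
  have ends': "edge_end e p = s" "edge_end e q = s'"
    using copy_lam[of p] copy_lam[of q] p q s Y(3) by simp_all
  have "\<forall>i\<in>dom (hw G) - ran (mu_act (elab e)). visible w i = visible w' i"
  proof
    fix i assume i: "i \<in> dom (hw G) - ran (mu_act (elab e))"
    then have "i \<notin> ran m" using ran_m copy(3) by blast
    with Y(5) i show "visible w i = visible w' i" by simp
  qed
  moreover have "in_IO (inst_obj inst) op (visible w \<circ>\<^sub>m mu_act (elab e)) (lam op p)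
      (visible w' \<circ>\<^sub>m mu_act (elab e)) (lam op q)"
    using io[OF both] p q by (simp add: visible_map_comp[OF ran_mu_act_hw])
  ultimately have "IO_act_param in_IO G (elab e) p q (visible w) (visible w')"
    unfolding label by (simp add: Let_def del: mu_act.simps)
  moreover have "insts G \<noteq> {||}" using inst by auto
  ultimately have "step G (visible w, s) (p, q, e) (visible w', s')"
    using w w' proper edge ends' unfolding step_def configs_def GL1_visible by simp
  moreover have "replaces \<chi> G (map under gs) (p, q, e)"
  proof -
    have "p = S_hat \<longleftrightarrow> s = esrc e" "q = S_hat \<longleftrightarrow> s' = esrc e" if "esrc e \<noteq> etgt e"
      using ends' that by (cases p; cases q; auto)+
    moreover have "s \<in> {esrc e, etgt e}" "s' \<in> {esrc e, etgt e}"
      using ends' by (cases p; cases q; auto)+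
    ultimately show ?thesis using pos Y(4) ends unfolding replaces_def by simp
  qed
  ultimately show "\<exists>g. step G (visible w, s) g (visible w', s') \<and> replaces \<chi> G (map under gs) g" by blast
qed

end


lemma run_degree_0_edges:
  assumes "run X c gs c'" "insts X = {||}"
  shows "\<forall>g\<in>set gs. fst g = S_hat \<and> fst (snd g) = F_hat \<and> under g |\<in>| edges X"
  using assms(1)
proof (induction rule: run.induct)
  case (run_Cons c g c1 gs c2)
  from step_degree_0_edge[OF assms(2) run_Cons.hyps(1)] run_Cons.IH show ?case
    by (auto simp: under_def)
qed simp

lemma degree_0_ends:
  "fst g = S_hat \<Longrightarrow> fst (snd g) = F_hat \<Longrightarrow> gtail g = esrc (under g) \<and> ghead g = etgt (under g)"
  by (cases g) (auto simp: gtail_def ghead_def under_def)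

lemma edge_path_run:
  assumes "run X c gs c'" "insts X = {||}"
  shows "edge_path X (map under gs)"
proof -
  obtain w s w' s' where "c = (w, s)" "c' = (w', s')" by (cases c; cases c')
  with run_path[of X w s gs w' s'] assms(1) have path: "successively (\<lambda>g h. ghead g = gtail h) gs"
    by (simp add: generic_path_def)
  note edges = run_degree_0_edges[OF assms]
  have ends: "gtail g = esrc (under g) \<and> ghead g = etgt (under g)" if "g \<in> set gs" for g
    using edges that degree_0_ends by blast
  have "successively (\<lambda>g h. etgt (under g) = esrc (under h)) gs"
    by (rule successively_mono[OF path]) (use ends in auto)
  moreover have "set (map under gs) \<subseteq> fset (edges X)" using edges by auto
  ultimately show ?thesis by (simp add: edge_path_def successively_map)
qed

lemma run_first_piece:
  assumes "run X c gs c'" "gs \<noteq> []" "snd c' \<in> P"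
  shows "\<exists>gs1 gs2 c1. gs = gs1 @ gs2 \<and> gs1 \<noteq> [] \<and> run X c gs1 c1 \<and> run X c1 gs2 c' \<and>
    snd c1 \<in> P \<and> (\<forall>g\<in>set (butlast gs1). ghead g \<notin> P)"
  using assms
proof (induction rule: run.induct)
  case (run_Cons c g c1 gs c2)
  have c1: "ghead g = snd c1" "c1 \<in> configs X"
    using run_Cons.hyps(1) by (auto simp: step_def ghead_def)
  have g: "run X c [g] c1" using run.run_Cons[OF run_Cons.hyps(1) run.run_Nil[OF c1(2)]] .
  show ?case
  proof (cases "snd c1 \<in> P")
    case True
    then show ?thesis
      using g run_Cons.hyps(2) by (intro exI[of _ "[g]"] exI[of _ gs] exI[of _ c1]) simp
  next
    case False
    then have "gs \<noteq> []" using run_Cons.hyps(2) run_Cons.prems(2) by (auto elim: run_NilE)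
    with run_Cons.IH run_Cons.prems(2) obtain gs1 gs2 c3 where
      "gs = gs1 @ gs2" "gs1 \<noteq> []" "run X c1 gs1 c3" "run X c3 gs2 c2" "snd c3 \<in> P"
      "\<forall>g\<in>set (butlast gs1). ghead g \<notin> P" by blast
    then show ?thesis
      using False c1(1) run.run_Cons[OF run_Cons.hyps(1)]
      by (intro exI[of _ "g # gs1"] exI[of _ gs2] exI[of _ c3]) simp
  qed
qed simp

locale correct_expansion = expansion +
  assumes good: "inst |\<in>| insts G \<Longrightarrow> expands_correctly \<chi> (inst_obj inst)"

context expansion
begin

lemma proper_action:
  assumes f: "f |\<in>| edges G" "elab f = Deg0 a"
  shows "mentions0 a i \<Longrightarrow> i \<in> dom (hw G)"
    and "i \<in> inst_tapes inst \<Longrightarrow> inst |\<in>| insts G \<Longrightarrow> lmul a i = [] \<and> rmul a i = []"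
proof -
  have over: "act0_over (hw G) a" using edge_ok[OF f(1)] f(2) by simp
  assume "mentions0 a i"
  then show "i \<in> dom (hw G)"
    using over by (metis act0_over_def mentions0_def)
next
  assume inst: "i \<in> inst_tapes inst" "inst |\<in>| insts G"
  have imm: "\<forall>e inst i. e |\<in>| edges G \<and> inst |\<in>| insts G \<and> i \<in> inst_tapes inst \<and>
        mentions_var (elab e) i \<longrightarrow> mentions_immutable (elab e) i"
    using graph_ok unfolding graph_ok_def by (elim conjE)
  show "lmul a i = [] \<and> rmul a i = []"
  proof (cases "mentions0 a i")
    case True
    then have "mentions_var (elab f) i" by (simp add: f(2))
    with imm f(1) inst have "mentions_immutable (elab f) i" by blast
    then show ?thesis by (simp add: f(2))
  qed (simp add: mentions0_def)
qed

text \<open>A proper edge is over the hardware of \<open>G\<close>, so it does not mention invisible tapes, and it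
  may mention value tapes of instances only as immutable variables.\<close>

lemma proper_step:
  assumes f: "f |\<in>| edges G" "elab f = Deg0 a"
    and step: "step Gexp (w, s) (S_hat, F_hat, f) (w', s')"
  shows "w \<in> GL1 \<chi> G \<longleftrightarrow> w' \<in> GL1 \<chi> G"
    and "w \<in> GL1 \<chi> G \<Longrightarrow> step G (visible w, s) (S_hat, F_hat, f) (visible w', s')"
proof -
  have st: "s = esrc f" "s' = etgt f" "w \<in> lang (hw Gexp)" "w' \<in> lang (hw Gexp)" "accepts a w"
    "w' = act0_apply a w"
    using step unfolding step_degree_0[OF insts_exp_graph f(2)] by auto
  have same: "w' i = w i" if "lmul a i = []" "rmul a i = []" for i
    unfolding st(6) by (rule act0_apply_other[OF st(3) that])
  have "w' i = w i" if "i \<in> inv_tapes \<chi> G" for i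
  proof -
    have "\<not> mentions0 a i" using that proper_action(1)[OF f] inv_tapes_hw by blast
    then show ?thesis using same by (simp add: mentions0_def)
  qed
  moreover have "w' \<circ>\<^sub>m inst_map inst = w \<circ>\<^sub>m inst_map inst" if "inst |\<in>| insts G" for inst
    using same proper_action(2)[OF f _ that] by (intro map_comp_cong) blast
  ultimately show iff: "w \<in> GL1 \<chi> G \<longleftrightarrow> w' \<in> GL1 \<chi> G" unfolding GL1_iff using st(3,4) by simp
  assume w: "w \<in> GL1 \<chi> G"
  have "accepts a (visible w)"
    unfolding accepts_def map_le_def
  proof
    fix i assume i: "i \<in> dom (guard a)"
    then have "mentions0 a i" unfolding mentions0_def domIff by blast
    then have "i \<in> dom (hw G)" by (rule proper_action(1)[OF f])
    with i st(5) show "guard a i = visible w i" by (simp add: accepts_def map_le_def)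
  qed
  moreover have "visible w' = act0_apply a (visible w)"
    unfolding st(6) by (simp add: act0_apply_def restrict_map_def fun_eq_iff)
  moreover have "visible w \<in> GL G" "visible w' \<in> GL G" using w iff GL1_visible by blast+
  ultimately show "step G (visible w, s) (S_hat, F_hat, f) (visible w', s')"
    using f edge_ok[OF f(1)] st(1,2) by (simp add: step_def configs_def)
qed

lemma proper_step_lift:
  assumes f: "f |\<in>| edges G" "elab f = Deg0 a" and w: "w \<in> GL G" "w' \<in> GL G"
    and act: "accepts a w" "w' = act0_apply a w"
  shows "step Gexp (w ++ one_inv, esrc f) (S_hat, F_hat, f) (w' ++ one_inv, etgt f)"
proof -
  have lang: "w ++ one_inv \<in> lang (hw Gexp)" "w' ++ one_inv \<in> lang (hw Gexp)"
    using w add_one_inv_GL1 GL1_iff by blast+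
  have unmentioned: "\<not> mentions0 a i" if "i \<in> inv_tapes \<chi> G" for i
    using that proper_action(1)[OF f] inv_tapes_hw by blast
  have "accepts a (w ++ one_inv)"
    unfolding accepts_def map_le_def
  proof
    fix i assume i: "i \<in> dom (guard a)"
    then have "mentions0 a i" unfolding mentions0_def domIff by blast
    then have "i \<notin> inv_tapes \<chi> G" using unmentioned by blast
    with i act(1) show "guard a i = (w ++ one_inv) i"
      by (simp add: accepts_def map_le_def add_one_inv_apply)
  qed
  moreover have "w' ++ one_inv = act0_apply a (w ++ one_inv)"
  proof
    fix i
    show "(w' ++ one_inv) i = act0_apply a (w ++ one_inv) i"
    proof (cases "i \<in> inv_tapes \<chi> G")
      case True
      have "act0_apply a (w ++ one_inv) i = (w ++ one_inv) i"
        using unmentioned[OF True] by (intro act0_apply_other[OF lang(1)]) (simp_all add: mentions0_def)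
      then show ?thesis using True by (simp add: add_one_inv_apply)
    next
      case False
      then show ?thesis using act(2) by (simp add: act0_apply_def add_one_inv_apply)
    qed
  qed
  moreover have "f |\<in>| edges Gexp" unfolding edges_Gexp using f by simp
  ultimately show ?thesis
    unfolding step_degree_0[OF insts_exp_graph f(2)] using lang edge_ok[OF f(1)] states_Gexp by simp
qed

end

context correct_expansion
begin

text \<open>The first edge of a piece decides what the piece is: either a proper edge, which already
  ends in a proper state, or a path in a copy.\<close>

lemma piece_reduction:
  assumes run: "run Gexp (w, s) gs (w', s')" and gs: "gs \<noteq> []"
    and proper: "s |\<in>| states G" "s' |\<in>| states G" "\<forall>g\<in>set (butlast gs). ghead g |\<notin>| states G"
  shows "(w \<in> GL1 \<chi> G \<longleftrightarrow> w' \<in> GL1 \<chi> G) \<and> piece G (map under gs) \<and> (w \<in> GL1 \<chi> G \<longrightarrow>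
    (\<exists>g. step G (visible w, s) g (visible w', s') \<and> replaces \<chi> G (map under gs) g))"
proof -
  note edges = run_degree_0_edges[OF run insts_exp_graph]
  have heads: "gtail g = esrc (under g) \<and> ghead g = etgt (under g)" if "g \<in> set gs" for g
    using edges that degree_0_ends by blast
  have ends: "esrc (hd (map under gs)) = s" "etgt (last (map under gs)) = s'"
    using run_path[OF run] gs heads[of "hd gs"] heads[of "last gs"] by (simp_all add: hd_map last_map)
  have new: "etgt (under g) |\<notin>| states G" if "g \<in> set (butlast gs)" for g
    using proper(3) that heads[OF in_set_butlastD[OF that]] by auto
  have piece: "piece G (map under gs)"
    unfolding piece_def using gs ends proper(1,2) new by (auto simp: map_butlast[symmetric])
  have "hd gs \<in> set gs" using gs by simp
  then have hd: "hd gs = (S_hat, F_hat, under (hd gs))" "under (hd gs) |\<in>| edges Gexp"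
    using edges by (auto simp: under_def prod_eq_iff)
  show ?thesis
  proof (cases "under (hd gs) |\<in>| edges G \<and> \<not> positive (elab (under (hd gs)))")
    case True
    then obtain a where a: "elab (under (hd gs)) = Deg0 a" by (cases "elab (under (hd gs))") auto
    have "tl gs = []"
    proof (rule ccontr)
      assume "tl gs \<noteq> []"
      then have "hd gs \<in> set (butlast gs)" by (cases gs) auto
      then have "etgt (under (hd gs)) |\<notin>| states G" by (rule new)
      then show False using edge_ok True by blast
    qed
    then have gs1: "gs = [hd gs]" using gs by (cases gs) auto
    then obtain c2 where "step Gexp (w, s) (hd gs) c2" "run Gexp c2 [] (w', s')"
      using run by (metis run_ConsE)
    then have "step Gexp (w, s) (S_hat, F_hat, under (hd gs)) (w', s')"
      using hd(1) by (auto elim: run_NilE)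
    note proper_step[OF True[THEN conjunct1] a this]
    moreover have "map under gs = [under (hd gs)]" using gs1 by (metis list.simps(8,9))
    then have "replaces \<chi> G (map under gs) (S_hat, F_hat, under (hd gs))"
      unfolding replaces_def using True by (intro disjI1 exI[of _ "under (hd gs)"]) simp
    ultimately show ?thesis using piece by blast
  next
    case False
    then obtain e f where e: "e |\<in>| pos_edges G"
      and f: "f |\<in>| edges (exp_graph \<chi> (op_graph (act_op (elab e))))" "under (hd gs) = copy_edge (\<chi> G e) e f"
      using hd(2) unfolding edges_Gexp by blast
    obtain inst op \<mu> where "positive_edge \<chi> G e inst op \<mu>" using positive_edge[OF e] by blast
    then interpret e: positive_edge \<chi> G e inst op \<mu> .
    have fY: "f |\<in>| edges (exp_graph \<chi> (op_graph op))" using f(1) by (simp add: e.label)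
    show ?thesis
      using e.copy_piece[OF good[OF e.inst] run gs proper f(2) fY ends] piece by blast
  qed
qed

lemma run_reduction:
  assumes "run Gexp (w, s) gs (w', s')" "s |\<in>| states G" "s' |\<in>| states G"
  shows "(w \<in> GL1 \<chi> G \<longleftrightarrow> w' \<in> GL1 \<chi> G) \<and> (w \<in> GL1 \<chi> G \<longrightarrow>
    (\<exists>\<pi>s gs'. run G (visible w, s) gs' (visible w', s') \<and> map under gs = concat \<pi>s \<and>
       (\<forall>\<pi>\<in>set \<pi>s. piece G \<pi>) \<and> list_all2 (replaces \<chi> G) \<pi>s gs'))"
  using assms
proof (induction "length gs" arbitrary: w s gs rule: less_induct)
  case less
  show ?case
  proof (cases "gs = []")
    case True
    with less.prems(1) have eq: "w' = w" "s' = s" by (auto elim: run_NilE)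
    have "run G (visible w, s) [] (visible w, s)" if "w \<in> GL1 \<chi> G"
      using that less.prems(2) GL1_visible by (intro run_Nil) (simp add: configs_def)
    then show ?thesis using eq True by (auto intro!: exI[of _ "[]"])
  next
    case False
    obtain gs1 gs2 w1 s1 where gs: "gs = gs1 @ gs2" "gs1 \<noteq> []"
      and run1: "run Gexp (w, s) gs1 (w1, s1)" and run2: "run Gexp (w1, s1) gs2 (w', s')"
      and s1: "s1 |\<in>| states G" and new: "\<forall>g\<in>set (butlast gs1). ghead g |\<notin>| states G"
      using run_first_piece[OF less.prems(1) False, of "fset (states G)"] less.prems(3) by auto
    note piece = piece_reduction[OF run1 gs(2) less.prems(2) s1 new]
    have "length gs2 < length gs" using gs by simp
    note IH = less.hyps[OF this run2 s1 less.prems(3)]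
    have "\<exists>\<pi>s gs'. run G (visible w, s) gs' (visible w', s') \<and> map under gs = concat \<pi>s \<and>
       (\<forall>\<pi>\<in>set \<pi>s. piece G \<pi>) \<and> list_all2 (replaces \<chi> G) \<pi>s gs'" if w: "w \<in> GL1 \<chi> G"
    proof -
      obtain g where g: "step G (visible w, s) g (visible w1, s1)" "replaces \<chi> G (map under gs1) g"
        using piece w by blast
      obtain \<pi>s gs' where rest: "run G (visible w1, s1) gs' (visible w', s')" "map under gs2 = concat \<pi>s"
        "\<forall>\<pi>\<in>set \<pi>s. piece G \<pi>" "list_all2 (replaces \<chi> G) \<pi>s gs'"
        using IH piece w by blast
      show ?thesis
        using run_Cons[OF g(1) rest(1)] g(2) rest(2-4) piece gs(1)
        by (intro exI[of _ "map under gs1 # \<pi>s"] exI[of _ "g # gs'"]) simp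
    qed
    then show ?thesis using piece IH by blast
  qed
qed

end

context positive_edge
begin

text \<open>With \<open>w0\<close> on the visible tapes outside the image of the label and trivial words on the
  invisible tapes of the other edges as frame, the copy displays both ends of a generic edge
  over \<open>e\<close>; the lemma is used for \<open>v = w0\<close> and for the tuple \<open>v\<close> at the end.\<close>

lemma frame_one_inv:
  assumes v: "v \<in> lang (hw G)" and same: "\<And>i. i \<in> dom (hw G) - ran (mu_act (elab e)) \<Longrightarrow> w0 i = v i"
  shows "reindex m ((v \<circ>\<^sub>m mu_act (elab e)) ++ trivial (int_tapes opx)) ++
      ((w0 |` (dom (hw G) - ran (mu_act (elab e)))) ++ trivial (inv_tapes \<chi> G - ran (copy_tape c))) =
    v ++ one_inv" (is "_ ++ ?z = _")
proof
  fix i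
  have sub: "ran (copy_tape c) \<subseteq> inv_tapes \<chi> G" using pos by (auto simp: inv_tapes_def)
  have dom_z: "dom ?z \<subseteq> (dom (hw G) - ran (mu_act (elab e))) \<union> (inv_tapes \<chi> G - ran (copy_tape c))"
    by (simp add: le_supI1)
  have disjoint: "Z \<inter> (A \<union> C) = {}"
    if "Z \<subseteq> (H - A) \<union> (V - C)" "A \<subseteq> H" "C \<subseteq> V" "H \<inter> V = {}" for Z A C H V :: "'i set"
    using that by blast
  have "dom ?z \<inter> ran m = {}"
    unfolding ran_m by (rule disjoint[OF dom_z ran_mu_act_hw sub inv_tapes_hw])
  note frame = frame_apply(1)[OF _ this] frame_apply(2)
  have "(v \<circ>\<^sub>m mu_act (elab e)) = ((v ++ one_inv) \<circ>\<^sub>m mu_act (elab e))"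
  proof (rule map_comp_cong)
    fix k assume "k \<in> ran (mu_act (elab e))"
    then have "k \<notin> inv_tapes \<chi> G" using ran_mu_act_hw inv_tapes_hw by blast
    then show "v k = (v ++ one_inv) k" by (simp add: add_one_inv_apply)
  qed
  then have u: "(v \<circ>\<^sub>m mu_act (elab e)) ++ trivial (int_tapes opx) = (v ++ one_inv) \<circ>\<^sub>m m"
    using comp_mu_act[of "v ++ one_inv"] sub add_one_inv_apply(2)[of _ v] by (simp add: subsetD)
  show "(reindex m ((v \<circ>\<^sub>m mu_act (elab e)) ++ trivial (int_tapes opx)) ++ ?z) i = (v ++ one_inv) i"
    unfolding u
  proof (cases "i \<in> ran m")
    case True
    then obtain j where j: "m j = Some i" by (auto simp: ran_def)
    show "(reindex m ((v ++ one_inv) \<circ>\<^sub>m m) ++ ?z) i = (v ++ one_inv) i"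
      unfolding frame(1)[OF j] using j by simp
  next
    case False
    then have out: "i \<notin> ran (mu_act (elab e))" "i \<notin> ran (copy_tape c)" using ran_m by blast+
    have "?z i = (v ++ one_inv) i"
    proof (cases "i \<in> inv_tapes \<chi> G")
      case True
      then show ?thesis using out by (simp add: add_one_inv_apply map_add_def)
    next
      case visible: False
      show ?thesis
      proof (cases "i \<in> dom (hw G)")
        case True
        then show ?thesis using visible out same[of i]
          by (simp add: add_one_inv_apply map_add_def)
      next
        case False
        then have "v i = None" using lang_dom[OF v] by blast
        then show ?thesis using visible False by (simp add: add_one_inv_apply map_add_def)
      qed
    qed
    then show "(reindex m ((v ++ one_inv) \<circ>\<^sub>m m) ++ ?z) i = (v ++ one_inv) i"
      unfolding frame(2)[OF False] .
  qed
qed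

lemma generic_edge_IO:
  assumes good: "expands_correctly \<chi> (inst_obj inst)"
    and step: "step G (w0, s0) (p, q, e) (w1, s1)"
  shows "(w0 \<circ>\<^sub>m mu_act (elab e), lam op p, w1 \<circ>\<^sub>m mu_act (elab e), lam op q)
    \<in> IO (exp_obj \<chi> (inst_obj inst)) opx"
proof -
  have "IO (exp_obj \<chi> (inst_obj inst)) opx = IO (inst_obj inst) op"
    using good op by (auto simp: expands_correctly_def)
  moreover have "IO_act_param in_IO G (elab e) p q w0 w1" using step by (auto simp: step_def)
  ultimately show ?thesis by (simp add: label Let_def IO_iff)
qed

lemma generic_edge_computation:
  assumes step: "step G (w0, s0) (p, q, e) (w1, s1)"
    and comp: "computation Y cs gs"
      "hd cs = ((w0 \<circ>\<^sub>m mu_act (elab e)) ++ trivial (int_tapes opx), lam op p)"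
      "last cs = ((w1 \<circ>\<^sub>m mu_act (elab e)) ++ trivial (int_tapes opx), lam op q)"
  shows "\<exists>cs' gs'. computation Gexp cs' gs' \<and> length gs' = length gs \<and>
    hd cs' = (w0 ++ one_inv, s0) \<and> last cs' = (w1 ++ one_inv, s1) \<and>
    (\<forall>j\<le>length gs. fst (cs' ! j) = reindex m (fst (cs ! j)) ++
       (w0 |` (dom (hw G) - ran (mu_act (elab e)))) ++ trivial (inv_tapes \<chi> G - ran (copy_tape c)))"
proof -
  define z where "z = (w0 |` (dom (hw G) - ran (mu_act (elab e)))) ++
    trivial (inv_tapes \<chi> G - ran (copy_tape c))"
  have st: "w0 \<in> GL G" "w1 \<in> GL G" "edge_end e p = s0" "edge_end e q = s1"
    "IO_act_param in_IO G (elab e) p q w0 w1"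
    using step by (auto simp: step_def configs_def)
  have lang: "w0 \<in> lang (hw G)" "w1 \<in> lang (hw G)" using st(1,2) GL_iff by blast+
  have same: "w0 i = w1 i" if "i \<in> dom (hw G) - ran (mu_act (elab e))" for i
    using st(5) that by (simp add: label Let_def)
  have z: "z \<in> lang (hw Gexp |` (- ran m))"
    unfolding lang_iff
  proof
    fix i
    show "rel_option (\<lambda>u A. u \<in> free_words A) (z i) ((hw Gexp |` (- ran m)) i)"
    proof (cases "i \<in> ran m")
      case True
      then have "i \<notin> dom (hw G) - ran (mu_act (elab e))" "i \<notin> inv_tapes \<chi> G - ran (copy_tape c)"
        using ran_m copy(3) ran_mu_act_hw inv_tapes_hw by blast+
      with True show ?thesis by (simp add: z_def map_add_def)
    next
      case False
      then have out: "i \<notin> ran (mu_act (elab e))" "i \<notin> ran (copy_tape c)" using ran_m by blast+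
      have "z i = (w0 ++ one_inv) i"
      proof (cases "i \<in> inv_tapes \<chi> G")
        case True
        then show ?thesis using out by (simp add: z_def add_one_inv_apply map_add_def)
      next
        case visible: False
        show ?thesis
        proof (cases "i \<in> dom (hw G)")
          case outside: False
          then have "w0 i = None" using lang_dom[OF lang(1)] by blast
          with visible outside show ?thesis by (simp add: z_def add_one_inv_apply map_add_def)
        qed (use visible out in \<open>simp add: z_def add_one_inv_apply map_add_def\<close>)
      qed
      moreover have "w0 ++ one_inv \<in> lang (hw Gexp)"
        using add_one_inv_GL1[OF st(1)] GL1_iff by blast
      ultimately show ?thesis using False unfolding lang_iff by simp
    qed
  qed
  let ?F = "\<lambda>(u, s). (reindex m u ++ z, copy_state c s)"
  have len: "length cs = Suc (length gs)" using comp(1) by (simp add: computation_iff)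
  then have "cs \<noteq> []" by auto
  have "hd (map ?F cs) = (w0 ++ one_inv, s0)"
    using frame_one_inv[OF lang(1), of w0] \<open>cs \<noteq> []\<close> copy_lam[of p] st(3)
    by (simp add: hd_map comp(2) z_def)
  moreover have "last (map ?F cs) = (w1 ++ one_inv, s1)"
    using frame_one_inv[OF lang(2) same] \<open>cs \<noteq> []\<close> copy_lam[of q] st(4)
    by (simp add: last_map comp(3) z_def)
  moreover have "fst (map ?F cs ! j) = reindex m (fst (cs ! j)) ++
       (w0 |` (dom (hw G) - ran (mu_act (elab e)))) ++ trivial (inv_tapes \<chi> G - ran (copy_tape c))"
    if "j \<le> length gs" for j
    using that len by (simp add: case_prod_beta z_def map_add_assoc)
  ultimately show ?thesis
    using copy_computation[OF comp(1) z]
    by (intro exI[of _ "map ?F cs"] exI[of _ "map (\<lambda>(p, q, f). (p, q, copy_edge c e f)) gs"]) simp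
qed

end

text \<open>In the expansion, edges are traversed forwards only, so a proper edge that is traversed
  backwards is replaced by its inverse edge. For an edge of positive degree, the
  input-output relation of the expanded operation supplies a computation to be carried out in
  the copy.\<close>

lemma (in correct_expansion) step_lift:
  assumes step: "step G (w, s) (p, q, f) (w', s')"
  shows "\<exists>gs. run Gexp (w ++ one_inv, s) gs (w' ++ one_inv, s')"
proof -
  have st: "f |\<in>| edges G" "w \<in> GL G" "w' \<in> GL G" "edge_end f p = s" "edge_end f q = s'"
    "IO_act_param in_IO G (elab f) p q w w'" "s |\<in>| states G"
    using step by (auto simp: step_def configs_def)
  have conf: "(w ++ one_inv, s) \<in> configs Gexp"
    using add_one_inv_GL1[OF st(2)] GL1_iff st(7) states_Gexp by (auto simp: configs_def GL_degree_0)
  show ?thesis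
  proof (cases "elab f")
    case (Deg0 a)
    have single: "\<exists>gs. run Gexp (w ++ one_inv, s) gs (w' ++ one_inv, s')"
      if "step Gexp (w ++ one_inv, s) g (w' ++ one_inv, s')" for g
    proof -
      have "(w' ++ one_inv, s') \<in> configs Gexp" using that by (simp add: step_def)
      with that show ?thesis using run_Cons run_Nil by blast
    qed
    show ?thesis
    proof (cases "p = q")
      case True
      then have "w' = w" "s' = s" using st(4-6) Deg0 by (cases p; simp)+
      then show ?thesis using run_Nil[OF conf] by blast
    next
      case False
      show ?thesis
      proof (cases p)
        case S_hat
        with False have "q = F_hat" by (cases q) auto
        then have "accepts a w" "w' = act0_apply a w" "s = esrc f" "s' = etgt f"
          using st(4-6) Deg0 S_hat by simp_all
        with proper_step_lift[OF st(1) Deg0 st(2,3)] single show ?thesis by blast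
      next
        case F_hat
        with False have "q = S_hat" by (cases q) auto
        then have act: "accepts (act0_inv a) w" "w' = act0_apply (act0_inv a) w" "s = etgt f" "s' = esrc f"
          using st(4-6) Deg0 F_hat by simp_all
        have "\<forall>e a. e |\<in>| edges G \<and> elab e = Deg0 a \<longrightarrow>
            (\<exists>e'. e' |\<in>| edges G \<and> esrc e' = etgt e \<and> etgt e' = esrc e \<and> elab e' = Deg0 (act0_inv a))"
          using graph_ok unfolding graph_ok_def by (elim conjE)
        with st(1) Deg0 obtain f' where f': "f' |\<in>| edges G" "esrc f' = etgt f" "etgt f' = esrc f"
          "elab f' = Deg0 (act0_inv a)" by blast
        show ?thesis
          using proper_step_lift[OF f'(1,4) st(2,3) act(1,2)] act(3,4) f'(2,3) single by simp
      qed
    qed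
  next
    case (Pos inst op \<mu>)
    with st(1) have "positive_edge \<chi> G f inst op \<mu>"
      by (intro positive_edge.intro expansion_axioms positive_edge_axioms.intro)
    then interpret f: positive_edge \<chi> G f inst op \<mu> .
    have "in_IO (exp_obj \<chi> (inst_obj inst)) (exp_op \<chi> op)
        (w \<circ>\<^sub>m mu_act (elab f)) (lam op p) (w' \<circ>\<^sub>m mu_act (elab f)) (lam op q)"
      using f.generic_edge_IO[OF good[OF f.inst] step] unfolding IO_iff .
    then have "((w \<circ>\<^sub>m mu_act (elab f)) ++ trivial (int_tapes (exp_op \<chi> op)), lam op p,
        (w' \<circ>\<^sub>m mu_act (elab f)) ++ trivial (int_tapes (exp_op \<chi> op)), lam op q)
        \<in> REACH (exp_graph \<chi> (op_graph op))"
      unfolding in_IO_iff exp_op_simps(1) by (elim conjE)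
    then obtain gs where "run (exp_graph \<chi> (op_graph op))
        ((w \<circ>\<^sub>m mu_act (elab f)) ++ trivial (int_tapes (exp_op \<chi> op)), lam op p) gs
        ((w' \<circ>\<^sub>m mu_act (elab f)) ++ trivial (int_tapes (exp_op \<chi> op)), lam op q)"
      unfolding REACH_iff by blast
    then obtain cs where "computation (exp_graph \<chi> (op_graph op)) cs gs"
      "hd cs = ((w \<circ>\<^sub>m mu_act (elab f)) ++ trivial (int_tapes (exp_op \<chi> op)), lam op p)"
      "last cs = ((w' \<circ>\<^sub>m mu_act (elab f)) ++ trivial (int_tapes (exp_op \<chi> op)), lam op q)"
      by (rule run_computation)
    from f.generic_edge_computation[OF step this] obtain cs' gs' where "computation Gexp cs' gs'"
      "hd cs' = (w ++ one_inv, s)" "last cs' = (w' ++ one_inv, s')" by blast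
    then show ?thesis using computation_run by metis
  qed
qed

lemma (in correct_expansion) run_lift:
  assumes "run G (w, s) gs (w', s')"
  shows "\<exists>gs'. run Gexp (w ++ one_inv, s) gs' (w' ++ one_inv, s')"
  using assms
proof (induction gs arbitrary: w s)
  case Nil
  then have eq: "(w, s) \<in> configs G" "w' = w" "s' = s"
    using run_configs by (auto elim: run_NilE)
  then have "(w ++ one_inv, s) \<in> configs Gexp"
    using add_one_inv_GL1 GL1_iff states_Gexp by (auto simp: configs_def GL_degree_0)
  then show ?case using eq run_Nil by blast
next
  case (Cons g gs)
  obtain w1 s1 where 1: "step G (w, s) g (w1, s1)" "run G (w1, s1) gs (w', s')"
    using Cons.prems by (auto elim: run_ConsE)
  obtain p q f where "g = (p, q, f)" by (cases g)
  with step_lift 1(1) obtain gs1 where "run Gexp (w ++ one_inv, s) gs1 (w1 ++ one_inv, s1)" by blast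
  with Cons.IH[OF 1(2)] show ?case using run_append by blast
qed


section \<open>Internal tapes and condition (O)\<close>

lemma step_unmentioned:
  assumes step: "step G (w, s) g (w', s')" and i: "\<not> mentions (elab (under g)) i"
  shows "w' i = w i"
proof -
  obtain p q e where g: "g = (p, q, e)" "IO_act_param in_IO G (elab e) p q w w'"
    and GL: "w \<in> GL G" "w' \<in> GL G"
    using step by (auto simp: step_def configs_def)
  then have w: "w \<in> lang (hw G)" "w' \<in> lang (hw G)" by (auto simp: GL_def GL_param_def)
  show ?thesis
  proof (cases "elab e")
    case (Deg0 a)
    then have "lmul a i = []" "rmul a i = []" using i g(1) by (auto simp: under_def mentions0_def)
    moreover from this have "lmul (act0_inv a) i = []" "rmul (act0_inv a) i = []"
      by (simp_all add: act0_inv_def word_inv_def)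
    ultimately show ?thesis
      using g(2) Deg0 act0_apply_other[OF w(1)] by (cases p; cases q) auto
  next
    case (Pos inst op \<mu>)
    then have "i \<notin> ran (mu_act (elab e))" using i g(1) by (simp add: under_def)
    then have "i \<in> dom (hw G) \<Longrightarrow> w i = w' i" using g(2) Pos by (simp add: Let_def)
    moreover have "i \<notin> dom (hw G) \<Longrightarrow> w i = None \<and> w' i = None"
      using lang_dom[OF w(1)] lang_dom[OF w(2)] by blast
    ultimately show ?thesis by metis
  qed
qed

lemma run_unmentioned:
  assumes "run G (w, s) gs (w', s')" "\<forall>g\<in>set gs. \<not> mentions (elab (under g)) i"
  shows "w' i = w i"
  using assms
proof (induction gs arbitrary: w s)
  case (Cons g gs)
  obtain w1 s1 where 1: "step G (w, s) g (w1, s1)" "run G (w1, s1) gs (w', s')"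
    using Cons.prems(1) by (auto elim: run_ConsE)
  then show ?case using Cons.IH[OF 1(2)] Cons.prems(2) step_unmentioned[OF 1(1)] by simp
qed (auto elim: run_NilE)

text \<open>Condition (O) speaks of paths that traverse edges from end to end, whereas a generic edge
  may start and end at the same end of its edge. Such a generic edge is unfolded into
  a traversal and the way back; as it mentions the same tapes, condition (O) still
  applies.\<close>

fun traversals :: "('i, 'a, 's, 'n) gedge \<Rightarrow> (bool \<times> ('i, 'a, 's, 'n) sedge) list" where
  "traversals (S_hat, F_hat, e) = [(True, e)]"
| "traversals (F_hat, S_hat, e) = [(False, e)]"
| "traversals (S_hat, S_hat, e) = [(True, e), (False, e)]"
| "traversals (F_hat, F_hat, e) = [(False, e), (True, e)]"

lemma traversals_props:
  shows "traversals g \<noteq> []" "snd ` set (traversals g) = {under g}"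
    "dir_tail (hd (traversals g)) = gtail g" "dir_head (last (traversals g)) = ghead g"
    "successively (\<lambda>x y. dir_head x = dir_tail y) (traversals g)"
  by (cases g rule: traversals.cases; simp add: under_def gtail_def ghead_def dir_tail_def dir_head_def)+

lemma traversals_path:
  assumes "run G (w, s) gs (w', s')" "gs \<noteq> []"
  shows "concat (map traversals gs) \<noteq> [] \<and>
    successively (\<lambda>x y. dir_head x = dir_tail y) (concat (map traversals gs)) \<and>
    dir_tail (hd (concat (map traversals gs))) = s \<and> dir_head (last (concat (map traversals gs))) = s'"
  using assms
proof (induction gs arbitrary: w s)
  case (Cons g gs)
  obtain w1 s1 where 1: "step G (w, s) g (w1, s1)" "run G (w1, s1) gs (w', s')"
    using Cons.prems(1) by (auto elim: run_ConsE)
  have g: "gtail g = s" "ghead g = s1" using 1(1) by (auto simp: step_def gtail_def ghead_def)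
  show ?case
  proof (cases "gs = []")
    case True
    with 1(2) have "s1 = s'" by (auto elim: run_NilE)
    then show ?thesis using True g traversals_props[of g] by simp
  next
    case False
    from Cons.IH[OF 1(2) this] show ?thesis
      using g traversals_props[of g] by (simp add: successively_append_iff)
  qed
qed simp

lemma traversals_split:
  assumes "concat (map traversals gs) = \<rho>1 @ x # \<rho>2" "\<not> positive (elab (snd x))"
    and "\<forall>g\<in>set gs. \<not> positive (elab (under g)) \<longrightarrow> g = (S_hat, F_hat, under g)"
  shows "\<exists>gs1 gs2. gs = gs1 @ (S_hat, F_hat, snd x) # gs2 \<and>
    \<rho>1 = concat (map traversals gs1) \<and> \<rho>2 = concat (map traversals gs2)"
  using assms
proof (induction gs arbitrary: \<rho>1)
  case (Cons g gs)
  have later: ?case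
    if us: "concat (map traversals gs) = us @ x # \<rho>2" "\<rho>1 = traversals g @ us" for us
  proof -
    obtain gs1 gs2 where "gs = gs1 @ (S_hat, F_hat, snd x) # gs2" "us = concat (map traversals gs1)"
      "\<rho>2 = concat (map traversals gs2)"
      using Cons.IH[OF us(1) Cons.prems(2)] Cons.prems(3) by auto
    with us(2) show ?thesis by (intro exI[of _ "g # gs1"] exI[of _ gs2]) simp
  qed
  from Cons.prems(1) have "traversals g @ concat (map traversals gs) = \<rho>1 @ x # \<rho>2" by simp
  then obtain us where "traversals g = \<rho>1 @ us \<and> us @ concat (map traversals gs) = x # \<rho>2 \<or>
      traversals g @ us = \<rho>1 \<and> concat (map traversals gs) = us @ x # \<rho>2"
    unfolding append_eq_append_conv2 by blast
  then show ?case
  proof (elim disjE conjE)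
    assume us: "traversals g = \<rho>1 @ us" "us @ concat (map traversals gs) = x # \<rho>2"
    show ?case
    proof (cases us)
      case Nil
      with us show ?thesis using later[of "[]"] by simp
    next
      case (Cons y us')
      with us have "x \<in> set (traversals g)" by simp
      then have x: "snd x = under g" using traversals_props(2)[of g] by blast
      then have g: "g = (S_hat, F_hat, snd x)" using Cons.prems(2,3) by auto
      then have "traversals g = [(True, snd x)]" using traversals.simps(1) by metis
      with us Cons have "\<rho>1 = []" "concat (map traversals gs) = \<rho>2" by (auto simp: append_eq_Cons_conv Cons_eq_append_conv)
      with g show ?thesis by (intro exI[of _ "[]"] exI[of _ gs]) simp
    qed
  next
    assume "traversals g @ us = \<rho>1" "concat (map traversals gs) = us @ x # \<rho>2"
    then show ?case using later[of us] by simp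
  qed
qed simp

text \<open>A tape that is not mentioned keeps its word. If it is mentioned, condition (O) provides two
  guards such that the tape is trivial before the first and after the second one and is not
  mentioned outside, so that it is trivial at both ends.\<close>

lemma internal_tape_trivial:
  assumes O: "condition_O op" and run: "run (op_graph op) (w, s) gs (w', s')"
    and SF: "s \<in> SF op" "s' \<in> SF op" and i: "i \<in> int_tapes op"
    and deg0: "\<forall>g\<in>set gs. \<not> positive (elab (under g)) \<longrightarrow> g = (S_hat, F_hat, under g)"
  shows "w i = Some [] \<longleftrightarrow> w' i = Some []"
proof (cases "\<exists>g\<in>set gs. mentions (elab (under g)) i")
  case False
  then show ?thesis using run_unmentioned[OF run] by simp
next
  case True
  define \<rho> where "\<rho> = concat (map traversals gs)"
  have "gs \<noteq> []" using True by auto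
  note path = traversals_path[OF run this, folded \<rho>_def]
  have under_\<rho>: "\<exists>g\<in>set gs. x \<in> set (traversals g) \<and> snd x = under g" if "x \<in> set \<rho>" for x
    using that traversals_props(2) by (fastforce simp: \<rho>_def)
  have unmentioned: "\<forall>g\<in>set hs. \<not> mentions (elab (under g)) i"
    if "\<forall>y\<in>set (concat (map traversals hs)). \<not> mentions (elab (snd y)) i"
    for hs :: "('a, 'b, 'c, 'd) gedge list"
  proof
    fix g assume "g \<in> set hs"
    moreover obtain y where y: "y \<in> set (traversals g)" "snd y = under g"
      using traversals_props(2)[of g] by (metis imageE insertI1)
    ultimately have "y \<in> set (concat (map traversals hs))" by auto
    with that have "\<not> mentions (elab (snd y)) i" by blast
    then show "\<not> mentions (elab (under g)) i" using y(2) by simp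
  qed
  have edges: "under g |\<in>| edges (op_graph op)" if "g \<in> set gs" for g
    using run_path[OF run] that by (auto simp: generic_path_def)
  have "\<forall>x\<in>set \<rho>. snd x |\<in>| edges (op_graph op) \<and> (\<not> fst x \<longrightarrow> positive (elab (snd x)))"
  proof
    fix x assume "x \<in> set \<rho>"
    then obtain g where g: "g \<in> set gs" "x \<in> set (traversals g)" "snd x = under g"
      using under_\<rho> by blast
    have "positive (elab (snd x))" if "\<not> fst x"
    proof (rule ccontr)
      assume "\<not> positive (elab (snd x))"
      then have "g = (S_hat, F_hat, under g)" using deg0 g by simp
      then have "traversals g = [(True, under g)]" using traversals.simps(1) by metis
      with g(2) that show False by simp
    qed
    then show "snd x |\<in>| edges (op_graph op) \<and> (\<not> fst x \<longrightarrow> positive (elab (snd x)))"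
      using edges[OF g(1)] g(3) by simp
  qed
  moreover have "\<exists>x\<in>set \<rho>. mentions (elab (snd x)) i"
    using True unmentioned[of gs] unfolding \<rho>_def by blast
  ultimately have "\<exists>l1 l2. l1 \<le> l2 \<and> l2 < length \<rho> \<and>
      (\<exists>a. elab (snd (\<rho> ! l1)) = Deg0 a \<and> guard a i = Some []) \<and>
      (\<exists>a. elab (snd (\<rho> ! l2)) = Deg0 a \<and> guard (act0_inv a) i = Some []) \<and>
      (\<forall>m<length \<rho>. m \<notin> {l1..l2} \<longrightarrow> \<not> mentions (elab (snd (\<rho> ! m))) i)"
    using O[unfolded condition_O_def, rule_format, of \<rho> i] path SF i by simp
  then obtain l1 l2 a b where l: "l1 \<le> l2" "l2 < length \<rho>"
    and a: "elab (snd (\<rho> ! l1)) = Deg0 a" "guard a i = Some []"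
    and b: "elab (snd (\<rho> ! l2)) = Deg0 b" "guard (act0_inv b) i = Some []"
    and out: "\<forall>m<length \<rho>. m \<notin> {l1..l2} \<longrightarrow> \<not> mentions (elab (snd (\<rho> ! m))) i" by blast
  have cut: "concat (map traversals gs) = take k \<rho> @ \<rho> ! k # drop (Suc k) \<rho>" if "k < length \<rho>" for k
    using id_take_nth_drop[OF that] by (simp add: \<rho>_def)
  have at: "\<exists>w1 s1 w2 s2. run (op_graph op) (w, s) gs1 (w1, s1) \<and> accepts d w1 \<and>
      w2 = act0_apply d w1 \<and> run (op_graph op) (w2, s2) gs2 (w', s')"
    if gs: "gs = gs1 @ (S_hat, F_hat, f) # gs2" and f: "elab f = Deg0 d" for gs1 gs2 f d
  proof -
    obtain w1 s1 where 1: "run (op_graph op) (w, s) gs1 (w1, s1)"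
      "run (op_graph op) (w1, s1) ((S_hat, F_hat, f) # gs2) (w', s')"
      using run unfolding gs by (metis run_appendE surj_pair)
    then obtain w2 s2 where 2: "step (op_graph op) (w1, s1) (S_hat, F_hat, f) (w2, s2)"
      "run (op_graph op) (w2, s2) gs2 (w', s')" by (auto elim: run_ConsE)
    from 2(1) f have "accepts d w1" "w2 = act0_apply d w1" by (auto simp: step_def)
    with 1(1) 2(2) show ?thesis by blast
  qed
  have "w i = Some []"
  proof -
    have "l1 < length \<rho>" using l by simp
    from traversals_split[OF cut[OF this]] a(1) deg0 obtain gs1 gs2 where
      gs1: "gs = gs1 @ (S_hat, F_hat, snd (\<rho> ! l1)) # gs2" "take l1 \<rho> = concat (map traversals gs1)"
      by auto
    obtain w1 s1 where w1: "run (op_graph op) (w, s) gs1 (w1, s1)" "accepts a w1"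
      using at[OF gs1(1) a(1)] by blast
    have "w1 i = Some []" using w1(2) a(2) by (auto simp: accepts_def map_le_def dom_def)
    moreover have "\<forall>y\<in>set (take l1 \<rho>). \<not> mentions (elab (snd y)) i"
    proof
      fix y assume "y \<in> set (take l1 \<rho>)"
      then obtain k where "k < l1" "y = \<rho> ! k"
        by (auto simp: in_set_conv_nth)
      moreover from this(1) have "k < length \<rho>" "k \<notin> {l1..l2}" using l by auto
      ultimately show "\<not> mentions (elab (snd y)) i" using out by blast
    qed
    then have "w1 i = w i" using run_unmentioned[OF w1(1)] unmentioned[of gs1] gs1(2) by simp
    ultimately show ?thesis by simp
  qed
  moreover have "w' i = Some []"
  proof -
    from traversals_split[OF cut[OF l(2)]] b(1) deg0 obtain gs1 gs2 where
      gs2: "gs = gs1 @ (S_hat, F_hat, snd (\<rho> ! l2)) # gs2" "drop (Suc l2) \<rho> = concat (map traversals gs2)"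
      by auto
    obtain w1 w2 s2 where w2: "accepts b w1" "w2 = act0_apply b w1" "run (op_graph op) (w2, s2) gs2 (w', s')"
      using at[OF gs2(1) b(1)] by blast
    obtain u where u: "guard b i = Some u" "lmul b i \<cdot> u \<cdot> rmul b i = []"
      using b(2) by (auto simp: act0_inv_def)
    then have "w1 i = Some u" using w2(1) by (auto simp: accepts_def map_le_def dom_def)
    then have "w2 i = Some []" using u(2) w2(2) by (simp add: act0_apply_def)
    moreover have "\<forall>y\<in>set (drop (Suc l2) \<rho>). \<not> mentions (elab (snd y)) i"
    proof
      fix y assume "y \<in> set (drop (Suc l2) \<rho>)"
      then obtain k where "k < length \<rho> - Suc l2" "y = \<rho> ! (Suc l2 + k)"
        by (auto simp: in_set_conv_nth)
      moreover from this(1) have "Suc l2 + k < length \<rho>" "Suc l2 + k \<notin> {l1..l2}" by auto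
      ultimately show "\<not> mentions (elab (snd y)) i" using out by blast
    qed
    then have "w' i = w2 i" using run_unmentioned[OF w2(3)] unmentioned[of gs2] gs2(2) by simp
    ultimately show ?thesis by simp
  qed
  ultimately show ?thesis by simp
qed


section \<open>Objects\<close>

lemma VAL_trivial: "trivial (dom (val_hw ob)) \<in> VAL ob"
  by (simp add: VAL_def in_VAL)

lemma VAL_iff: "v \<in> VAL ob \<longleftrightarrow> equivclp (val_adj_param in_VAL in_IO ob) (trivial (dom (val_hw ob))) v"
  unfolding VAL_def mem_Collect_eq by (subst in_VAL.simps) simp

lemma VAL_adjacent:
  assumes "v \<in> VAL ob" "val_adj_param in_VAL in_IO ob v v' \<or> val_adj_param in_VAL in_IO ob v' v"
  shows "v' \<in> VAL ob"
  unfolding VAL_iff by (rule equivclp_into_equivclp[OF assms(1)[unfolded VAL_iff]]) (rule assms(2))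

lemma VAL_induct [consumes 1, case_names trivial adjacent]:
  assumes "v \<in> VAL ob" "P (trivial (dom (val_hw ob)))"
    and "\<And>y z. y \<in> VAL ob \<Longrightarrow> P y \<Longrightarrow>
      val_adj_param in_VAL in_IO ob y z \<or> val_adj_param in_VAL in_IO ob z y \<Longrightarrow> P z"
  shows "P v"
  using assms(1)[unfolded VAL_iff]
proof (induction rule: equivclp_induct)
  case base
  show ?case by (rule assms(2))
next
  case (step y z)
  then show ?case using assms(3) VAL_iff by blast
qed

lemma val_adj_run:
  "val_adj_param in_VAL in_IO ob v1 v2 \<longleftrightarrow> v1 \<in> lang (val_hw ob) \<and> v2 \<in> lang (val_hw ob) \<and>
     (\<exists>op\<in>set (obj_ops ob). \<exists>w1 s1 gs w2 s2. run (op_graph op) (w1, s1) gs (w2, s2) \<and>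
        s1 \<in> SF op \<and> s2 \<in> SF op \<and> w1 |` int_tapes op = trivial (int_tapes op) \<and>
        w2 |` int_tapes op = trivial (int_tapes op) \<and>
        w1 |` dom (val_hw ob) = v1 \<and> w2 |` dom (val_hw ob) = v2)" (is "?L \<longleftrightarrow> ?R")
proof
  assume ?L
  then obtain op cs gs where *: "v1 \<in> lang (val_hw ob)" "v2 \<in> lang (val_hw ob)" "op \<in> set (obj_ops ob)"
    "computation (op_graph op) cs gs" "snd (hd cs) \<in> SF op" "snd (last cs) \<in> SF op"
    "fst (hd cs) |` int_tapes op = trivial (int_tapes op)"
    "fst (last cs) |` int_tapes op = trivial (int_tapes op)"
    "fst (hd cs) |` dom (val_hw ob) = v1" "fst (last cs) |` dom (val_hw ob) = v2"
    unfolding val_adj_param_def io_computation_param_def computation_def by blast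
  have "run (op_graph op) (fst (hd cs), snd (hd cs)) gs (fst (last cs), snd (last cs))"
    using computation_run[OF *(4)] by simp
  with * show ?R by blast
next
  assume ?R
  then obtain op w1 s1 gs w2 s2 where *: "v1 \<in> lang (val_hw ob)" "v2 \<in> lang (val_hw ob)"
    "op \<in> set (obj_ops ob)" "run (op_graph op) (w1, s1) gs (w2, s2)" "s1 \<in> SF op" "s2 \<in> SF op"
    "w1 |` int_tapes op = trivial (int_tapes op)" "w2 |` int_tapes op = trivial (int_tapes op)"
    "w1 |` dom (val_hw ob) = v1" "w2 |` dom (val_hw ob) = v2" by blast
  obtain cs where "computation (op_graph op) cs gs" "hd cs = (w1, s1)" "last cs = (w2, s2)"
    using run_computation[OF *(4)] .
  with * show ?L
    unfolding val_adj_param_def io_computation_param_def computation_def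
    by (intro conjI bexI[of _ op] exI[of _ cs] exI[of _ gs]) simp_all
qed

locale correct_object =
  fixes \<chi> :: "('i, 'a, 's, 'n) choice" and ob :: "('i, 'a, 's, 'n) obj"
  assumes obj_ok: "obj_ok ob"
    and oper_ok: "op \<in> set (obj_ops ob) \<Longrightarrow> oper_ok op"
    and graphs: "op \<in> set (obj_ops ob) \<Longrightarrow> correct_expansion \<chi> (op_graph op)"
begin

lemma object_op: "op \<in> set (obj_ops ob) \<Longrightarrow> object_op \<chi> ob op"
  using obj_ok oper_ok graphs expansion.wf_expansion
  by (intro object_op.intro) (auto simp: correct_expansion_def)

lemma obj_insts: "op \<in> set (obj_ops ob) \<Longrightarrow> insts (op_graph op) = obj_insts ob"
  using obj_ok by (simp add: obj_ok_def)

lemma inst_tapes_op: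
  "op \<in> set (obj_ops ob) \<Longrightarrow> inst |\<in>| obj_insts ob \<Longrightarrow> inst_tapes inst \<subseteq> val_tapes op \<union> int_tapes op"
  using oper_ok[of op] obj_insts[of op] unfolding oper_ok_def by blast

lemma inst_ok: "inst |\<in>| obj_insts ob \<Longrightarrow> inst_ok inst"
proof -
  assume inst: "inst |\<in>| obj_insts ob"
  obtain op where op: "op \<in> set (obj_ops ob)"
    using obj_ok unfolding obj_ok_def by (meson last_in_set)
  then interpret correct_expansion \<chi> "op_graph op" by (rule graphs)
  show "inst_ok inst" using inst obj_insts[OF op] by (intro inst_ok) simp
qed

text \<open>Here \<open>trivial UNIV ++ v\<close> extends \<open>v\<close> by trivial words.
  The value tapes of an instance may be value tapes of the object, so that a tuple with
  values of the object need not lie in the graph language of its operations just because the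
  internal tapes are trivial. It does: each value of the object other than the trivial one
  occurs at an end of a computation of some operation of the object, and all of these have
  the same instances.\<close>

lemma VAL_instances:
  assumes "v \<in> VAL ob" "inst |\<in>| obj_insts ob"
  shows "(trivial UNIV ++ v) \<circ>\<^sub>m inst_map inst \<in> VAL (inst_obj inst)"
  using assms(1)
proof (induction rule: VAL_induct)
  case trivial
  have "(trivial UNIV ++ trivial (dom (val_hw ob))) \<circ>\<^sub>m inst_map inst =
      trivial (dom (val_hw (inst_obj inst)))"
  proof
    fix j
    have "dom (inst_map inst) = dom (val_hw (inst_obj inst))"
      using inst_ok[OF assms(2)] by (simp add: inst_ok_def)
    then have "inst_map inst j = None \<longleftrightarrow> j \<notin> dom (val_hw (inst_obj inst))" by blast
    then show "((trivial UNIV ++ trivial (dom (val_hw ob))) \<circ>\<^sub>m inst_map inst) j =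
        trivial (dom (val_hw (inst_obj inst))) j"
      by (cases "inst_map inst j") (simp_all add: map_add_def)
  qed
  then show ?case using VAL_trivial by metis
next
  case (adjacent y z)
  then obtain op w where op: "op \<in> set (obj_ops ob)" and w: "w \<in> GL (op_graph op)"
    "w |` int_tapes op = trivial (int_tapes op)" "w |` dom (val_hw ob) = z"
  proof -
    from adjacent.hyps(2) obtain v1 v2 where adj: "val_adj_param in_VAL in_IO ob v1 v2" "z = v1 \<or> z = v2"
      by blast
    from adj(1) obtain op w1 s1 gs w2 s2 where op: "op \<in> set (obj_ops ob)"
      and run: "run (op_graph op) (w1, s1) gs (w2, s2)"
      and w: "w1 |` int_tapes op = trivial (int_tapes op)" "w2 |` int_tapes op = trivial (int_tapes op)"
        "w1 |` dom (val_hw ob) = v1" "w2 |` dom (val_hw ob) = v2"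
      unfolding val_adj_run by blast
    from run_configs[OF run] have "w1 \<in> GL (op_graph op)" "w2 \<in> GL (op_graph op)"
      by (simp_all add: configs_def)
    with that op w adj(2) show thesis by blast
  qed
  interpret correct_expansion \<chi> "op_graph op" using op by (rule graphs)
  interpret object_op \<chi> ob op using op by (rule object_op)
  have "(trivial UNIV ++ z) \<circ>\<^sub>m inst_map inst = w \<circ>\<^sub>m inst_map inst"
  proof (rule map_comp_cong)
    fix i assume "i \<in> inst_tapes inst"
    then have i: "i \<in> val_tapes op \<union> int_tapes op" using inst_tapes_op[OF op assms(2)] by blast
    have "dom w = dom (hw (op_graph op))" using w(1) unfolding GL_iff by (simp add: lang_dom)
    then have "i \<in> dom w" using i op_tapes(1) by auto
    show "(trivial UNIV ++ z) i = w i"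
    proof (cases "i \<in> val_tapes op")
      case True
      then have "z i = w i" using w(3) val_hw(1) by auto
      then show ?thesis using \<open>i \<in> dom w\<close> by (auto simp: map_add_def)
    next
      case False
      then have "z i = None" using w(3) val_hw(1) by auto
      moreover have "w i = Some []"
      proof -
        have "i \<in> int_tapes op" using False i by blast
        then show ?thesis using fun_cong[OF w(2), of i] by simp
      qed
      ultimately show ?thesis by (simp add: map_add_def)
    qed
  qed
  moreover have "w \<circ>\<^sub>m inst_map inst \<in> VAL (inst_obj inst)"
    using w(1) assms(2) obj_insts[OF op] GL_iff by simp
  ultimately show ?case by (simp only:)
qed

end

locale correct_operation =
  correct_object \<chi> ob + correct_expansion \<chi> "op_graph op" + object_op \<chi> ob op
  for \<chi> :: "('i, 'a, 's, 'n) choice" and ob and op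
begin

lemma ND1_inv_GL1:
  assumes "w \<in> ND1_inv \<chi> ob op"
  shows "w \<in> GL1 \<chi> (op_graph op)"
proof -
  note w = assms[unfolded ND1_inv_iff]
  have "w \<circ>\<^sub>m inst_map inst \<in> VAL (inst_obj inst)" if inst: "inst |\<in>| obj_insts ob" for inst
  proof -
    have "(trivial UNIV ++ (w |` val_tapes op)) \<circ>\<^sub>m inst_map inst = w \<circ>\<^sub>m inst_map inst"
    proof (rule map_comp_cong)
      fix i assume "i \<in> inst_tapes inst"
      then have i: "i \<in> val_tapes op \<union> int_tapes op" using inst_tapes_op[OF op inst] by blast
      show "(trivial UNIV ++ (w |` val_tapes op)) i = w i"
      proof (cases "i \<in> val_tapes op")
        case True
        moreover have "dom w = dom (hw Y)" using w by (simp add: lang_dom)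
        ultimately have "i \<in> dom w" using hw_Y(1) by auto
        then show ?thesis using True by (auto simp: map_add_def)
      next
        case False
        then have "w i = Some []" using i w by simp
        then show ?thesis using False by (simp add: map_add_def)
      qed
    qed
    then show ?thesis using VAL_instances[OF _ inst, of "w |` val_tapes op"] w by (simp only:)
  qed
  moreover have "inv_tapes \<chi> (op_graph op) \<subseteq> int_tapes opx" by simp
  ultimately show ?thesis unfolding GL1_iff obj_insts[OF op] using w by blast
qed

text \<open>A run of the expanded operation in the graph language reduces to a computation of the
  operation itself, whose degree-0 edges are traversed forwards because it is a generic
  reduction; so condition (O) applies to it. With trivial internal tapes it is an input-output
  computation, which makes the values at its ends adjacent.\<close>

lemma run_Y_GL1:
  assumes run: "run Y (w1, s1) gs (w2, s2)" and SF: "s1 \<in> SF op" "s2 \<in> SF op"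
    and w1: "w1 \<in> GL1 \<chi> (op_graph op)"
  shows "w2 \<in> GL1 \<chi> (op_graph op)"
    and "i \<in> int_tapes op \<Longrightarrow> w1 i = Some [] \<longleftrightarrow> w2 i = Some []"
    and "\<forall>i\<in>int_tapes op. w1 i = Some [] \<Longrightarrow>
      val_adj_param in_VAL in_IO ob (w1 |` val_tapes op) (w2 |` val_tapes op)"
proof -
  have states: "s1 |\<in>| states (op_graph op)" "s2 |\<in>| states (op_graph op)"
    using SF oper_ok by (auto simp: SF_def oper_ok_def)
  note red = run_reduction[OF run states]
  show w2: "w2 \<in> GL1 \<chi> (op_graph op)" using red w1 by blast
  obtain \<pi>s gs' where G: "run (op_graph op) (visible w1, s1) gs' (visible w2, s2)"
    and rep: "list_all2 (replaces \<chi> (op_graph op)) \<pi>s gs'"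
    using red w1 by blast
  have "\<forall>g\<in>set gs'. \<not> positive (elab (under g)) \<longrightarrow> g = (S_hat, F_hat, under g)"
  proof (intro ballI impI)
    fix g assume "g \<in> set gs'" "\<not> positive (elab (under g))"
    moreover from this(1) rep obtain \<pi> where "replaces \<chi> (op_graph op) \<pi> g"
      by (metis in_set_conv_nth list_all2_conv_all_nth)
    ultimately show "g = (S_hat, F_hat, under g)"
      unfolding replaces_def by (auto simp: under_def pos_edges_def)
  qed
  note int = internal_tape_trivial[OF _ G SF _ this]
  have vis: "visible w i = w i" if "i \<in> int_tapes op \<union> val_tapes op" for w :: "('i, 'a) tuple" and i
    using that op_tapes(1) by auto
  show int': "w1 i = Some [] \<longleftrightarrow> w2 i = Some []" if "i \<in> int_tapes op" for i
    using int[OF _ that] oper_ok vis that by (simp add: oper_ok_def)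
  assume w1_int: "\<forall>i\<in>int_tapes op. w1 i = Some []"
  have sub: "dom (hw (op_graph op)) \<inter> val_tapes op = val_tapes op" using op_tapes(1) by blast
  have "w |` val_tapes op \<in> lang (val_hw ob)" if "w \<in> GL1 \<chi> (op_graph op)" for w
  proof -
    have "visible w \<in> lang (hw (op_graph op))" using that GL1_visible GL_iff by blast
    from lang_restrict[OF this, of "val_tapes op"] show ?thesis
      using val_hw(2) by (simp add: sub)
  qed
  moreover have "visible w |` int_tapes op = trivial (int_tapes op)"
    if "\<forall>i\<in>int_tapes op. w i = Some []" for w :: "('i, 'a) tuple"
    using that vis[of _ w] by (auto simp: fun_eq_iff restrict_map_def)
  moreover have "visible w |` dom (val_hw ob) = w |` val_tapes op" for w :: "('i, 'a) tuple"
    using val_hw(1) by (simp add: sub)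
  ultimately show "val_adj_param in_VAL in_IO ob (w1 |` val_tapes op) (w2 |` val_tapes op)"
    unfolding val_adj_run using op G SF w1 w2 w1_int int' by blast
qed

text \<open>Whichever end is admissible, it lies in the graph language, and then so does the other end.
  The internal tapes are trivial at both ends or at neither, and the values are adjacent.\<close>

lemma run_Y_ND1_inv:
  assumes run: "run Y (w1, s1) gs (w2, s2)" and SF: "s1 \<in> SF op" "s2 \<in> SF op"
  shows "w1 \<in> ND1_inv \<chi> ob op \<longleftrightarrow> w2 \<in> ND1_inv \<chi> ob op"
proof -
  have states: "s1 |\<in>| states (op_graph op)" "s2 |\<in>| states (op_graph op)"
    using SF oper_ok by (auto simp: SF_def oper_ok_def)
  have GL1: "w1 \<in> GL1 \<chi> (op_graph op) \<longleftrightarrow> w2 \<in> GL1 \<chi> (op_graph op)"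
    using run_reduction[OF run states] by blast
  have lang: "w1 \<in> lang (hw Y)" "w2 \<in> lang (hw Y)"
    using run_configs[OF run] by (auto simp: configs_def GL_degree_0)
  have split: "(\<forall>i\<in>int_tapes opx. w i = Some []) \<longleftrightarrow>
      (\<forall>i\<in>int_tapes op. w i = Some []) \<and> (\<forall>i\<in>inv_tapes \<chi> (op_graph op). w i = Some [])"
    for w :: "('i, 'a) tuple" by auto
  show ?thesis
  proof (cases "w1 \<in> GL1 \<chi> (op_graph op)")
    case True
    note facts = run_Y_GL1[OF run SF True]
    have inv: "\<forall>i\<in>inv_tapes \<chi> (op_graph op). w1 i = Some []" "\<forall>i\<in>inv_tapes \<chi> (op_graph op). w2 i = Some []"
      using True GL1 GL1_iff by blast+
    show ?thesis
      unfolding ND1_inv_iff split using facts(2,3) lang inv VAL_adjacent by blast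
  qed (use GL1 ND1_inv_GL1 in blast)
qed

lemma val_adj_exp:
  assumes "run (op_graph op) (w1, s1) gs (w2, s2)" "s1 \<in> SF op" "s2 \<in> SF op"
    and "w1 |` int_tapes op = trivial (int_tapes op)" "w2 |` int_tapes op = trivial (int_tapes op)"
  shows "val_adj_param in_VAL in_IO (exp_obj \<chi> ob) (w1 |` val_tapes op) (w2 |` val_tapes op)"
proof -
  obtain gs' where lift: "run Y (w1 ++ one_inv, s1) gs' (w2 ++ one_inv, s2)"
    using run_lift[OF assms(1)] by blast
  have GL: "w1 \<in> GL (op_graph op)" "w2 \<in> GL (op_graph op)"
    using run_configs[OF assms(1)] by (auto simp: configs_def)
  have "w |` val_tapes op \<in> lang (val_hw ob)" if "w \<in> GL (op_graph op)" for w
    using that GL_iff lang_restrict[of w "hw (op_graph op)" "val_tapes op"] val_hw(2) by simp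
  moreover have "(w ++ one_inv) |` int_tapes opx = trivial (int_tapes opx)"
    if "w |` int_tapes op = trivial (int_tapes op)" for w :: "('i, 'a) tuple"
  proof
    fix i
    show "((w ++ one_inv) |` int_tapes opx) i = trivial (int_tapes opx) i"
      using fun_cong[OF that, of i] by (auto simp: map_add_def restrict_map_def split: if_splits)
  qed
  moreover have "(w ++ one_inv) |` val_tapes op = w |` val_tapes op" for w :: "('i, 'a) tuple"
  proof
    fix i
    show "((w ++ one_inv) |` val_tapes op) i = (w |` val_tapes op) i"
    proof (cases "i \<in> val_tapes op")
      case True
      then have "i \<notin> inv_tapes \<chi> (op_graph op)" using op_tapes(1) inv_tapes_hw by blast
      then show ?thesis by (simp add: map_add_def restrict_map_def)
    qed simp
  qed
  moreover have "dom (val_hw (exp_obj \<chi> ob)) = val_tapes op" "val_hw (exp_obj \<chi> ob) = val_hw ob"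
    "opx \<in> set (obj_ops (exp_obj \<chi> ob))"
    using val_hw(1) op by (simp_all add: exp_obj_def)
  ultimately show ?thesis
    unfolding val_adj_run using lift assms(2-5) GL
    by (intro conjI bexI[of _ opx] exI[of _ "w1 ++ one_inv"] exI[of _ "w2 ++ one_inv"]
        exI[of _ s1] exI[of _ s2] exI[of _ gs']) (simp_all del: exp_op_simps(5))
qed

lemma IO_exp:
  assumes VAL: "VAL (exp_obj \<chi> ob) = VAL ob"
  shows "IO (exp_obj \<chi> ob) opx = IO ob op"
proof -
  have "(w1 ++ trivial (int_tapes opx), s1, w2 ++ trivial (int_tapes opx), s2) \<in> REACH Y \<longleftrightarrow>
      (w1 ++ trivial (int_tapes op), s1, w2 ++ trivial (int_tapes op), s2) \<in> REACH (op_graph op)"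
    if w: "w1 \<in> ND ob op" "w2 \<in> ND ob op" and SF: "s1 \<in> SF op" "s2 \<in> SF op" for w1 s1 w2 s2
  proof -
    have states: "s1 |\<in>| states (op_graph op)" "s2 |\<in>| states (op_graph op)"
      using SF oper_ok by (auto simp: SF_def oper_ok_def)
    have add: "u ++ trivial (int_tapes opx) = (u ++ trivial (int_tapes op)) ++ one_inv"
      for u :: "('i, 'a) tuple"
      by (simp add: trivial_Un map_add_assoc)
    have vis: "visible ((u ++ trivial (int_tapes op)) ++ one_inv) = u ++ trivial (int_tapes op)"
      if "u \<in> ND ob op" for u
    proof
      fix i
      from that[unfolded ND_iff] have "dom u = dom (hw (op_graph op) |` (ext_tapes op \<union> val_tapes op))"
        by (intro lang_dom) (elim conjE)
      then have "dom u \<subseteq> dom (hw (op_graph op))" by simp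
      then have dom: "dom (u ++ trivial (int_tapes op)) \<subseteq> dom (hw (op_graph op))"
        using op_tapes(1) by auto
      show "visible ((u ++ trivial (int_tapes op)) ++ one_inv) i = (u ++ trivial (int_tapes op)) i"
      proof (cases "i \<in> dom (hw (op_graph op))")
        case True
        then have "i \<notin> inv_tapes \<chi> (op_graph op)" using inv_tapes_hw by blast
        then show ?thesis using True by (simp add: add_one_inv_apply)
      next
        case False
        then have "i \<notin> dom (u ++ trivial (int_tapes op))"
          by (rule contrapos_nn) (rule subsetD[OF dom])
        then have "(u ++ trivial (int_tapes op)) i = None" unfolding domIff by (rule notnotD)
        then show ?thesis by (simp only: restrict_out[OF False])
      qed
    qed
    have GL1: "(w1 ++ trivial (int_tapes op)) ++ one_inv \<in> GL1 \<chi> (op_graph op)"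
      using w(1) by (intro ND1_inv_GL1) (simp add: ND1_inv_def ND1_def)
    show ?thesis
      unfolding REACH_iff add
      using run_reduction[OF _ states] run_lift GL1 vis[OF w(1)] vis[OF w(2)] by metis
  qed
  then have "in_IO (exp_obj \<chi> ob) opx w1 s1 w2 s2 \<longleftrightarrow> in_IO ob op w1 s1 w2 s2" for w1 s1 w2 s2
    unfolding in_IO_iff ND_exp[OF VAL] by (auto simp del: exp_op_simps(5))
  then show ?thesis by (simp add: IO_def)
qed

end

context correct_object
begin

lemma correct_operation: "op \<in> set (obj_ops ob) \<Longrightarrow> correct_operation \<chi> ob op"
  using correct_object_axioms graphs object_op by (simp add: correct_operation_def)

text \<open>An input-output computation of an expanded operation need not stay in the graph language,
  so tuples can be adjacent for the expansion without being adjacent for the object. But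
  starting from a value of the object, such a computation ends with a value of the object, and
  the component of the trivial tuple consists of what is reached in this way.\<close>

lemma VAL_exp: "VAL (exp_obj \<chi> ob) = VAL ob"
proof (intro subset_antisym subsetI)
  fix v assume "v \<in> VAL ob"
  then show "v \<in> VAL (exp_obj \<chi> ob)"
  proof (induction rule: VAL_induct)
    case trivial
    have "val_hw (exp_obj \<chi> ob) = val_hw ob" by (simp add: exp_obj_def)
    then show ?case using VAL_trivial by metis
  next
    case (adjacent y z)
    have "val_adj_param in_VAL in_IO (exp_obj \<chi> ob) v1 v2" if adj: "val_adj_param in_VAL in_IO ob v1 v2" for v1 v2
    proof -
      obtain op w1 s1 gs w2 s2 where op: "op \<in> set (obj_ops ob)"
        and run: "run (op_graph op) (w1, s1) gs (w2, s2)" "s1 \<in> SF op" "s2 \<in> SF op"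
          "w1 |` int_tapes op = trivial (int_tapes op)" "w2 |` int_tapes op = trivial (int_tapes op)"
        and v: "w1 |` dom (val_hw ob) = v1" "w2 |` dom (val_hw ob) = v2"
        using adj unfolding val_adj_run by blast
      interpret correct_operation \<chi> ob op using op by (rule correct_operation)
      show ?thesis using val_adj_exp[OF run] v val_hw(1) by simp
    qed
    with adjacent show ?case using VAL_adjacent by blast
  qed
next
  fix v assume "v \<in> VAL (exp_obj \<chi> ob)"
  then show "v \<in> VAL ob"
  proof (induction rule: VAL_induct)
    case trivial
    have "val_hw (exp_obj \<chi> ob) = val_hw ob" by (simp add: exp_obj_def)
    then show ?case using VAL_trivial by metis
  next
    case (adjacent y z)
    have "v1 \<in> VAL ob \<longleftrightarrow> v2 \<in> VAL ob"
      if adj: "val_adj_param in_VAL in_IO (exp_obj \<chi> ob) v1 v2" for v1 v2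
    proof -
      obtain opx w1 s1 gs w2 s2 where opx: "opx \<in> set (obj_ops (exp_obj \<chi> ob))"
        and run: "run (op_graph opx) (w1, s1) gs (w2, s2)" "s1 \<in> SF opx" "s2 \<in> SF opx"
          "w1 |` int_tapes opx = trivial (int_tapes opx)" "w2 |` int_tapes opx = trivial (int_tapes opx)"
        and v: "w1 |` dom (val_hw (exp_obj \<chi> ob)) = v1" "w2 |` dom (val_hw (exp_obj \<chi> ob)) = v2"
        using adj unfolding val_adj_run by blast
      from opx obtain op where op: "op \<in> set (obj_ops ob)" and opx: "opx = exp_op \<chi> op"
        by (auto simp: exp_obj_def)
      interpret correct_operation \<chi> ob op using op by (rule correct_operation)
      have runY: "run Y (w1, s1) gs (w2, s2)" using run(1) opx by simp
      have v': "w1 |` val_tapes op = v1" "w2 |` val_tapes op = v2"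
        using v val_hw(1) by (simp_all add: exp_obj_def)
      have lang: "w1 \<in> lang (hw Y)" "w2 \<in> lang (hw Y)"
        using run_configs[OF runY] by (auto simp: configs_def GL_degree_0)
      have "w i = Some []" if "w |` int_tapes opx = trivial (int_tapes opx)" "i \<in> int_tapes opx"
        for w :: "('i, 'a) tuple" and i
        using fun_cong[OF that(1), of i] that(2) by simp
      then have int: "\<forall>i\<in>int_tapes (exp_op \<chi> op). w1 i = Some []"
        "\<forall>i\<in>int_tapes (exp_op \<chi> op). w2 i = Some []"
        using run(4,5) opx by blast+
      have SF: "s1 \<in> SF op" "s2 \<in> SF op" using run(2,3) opx by simp_all
      show ?thesis
        using run_Y_ND1_inv[OF runY SF] lang int v' unfolding ND1_inv_iff by blast
    qed
    with adjacent show ?case by blast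
  qed
qed

lemma expands_correctly: "expands_correctly \<chi> ob"
  unfolding expands_correctly_def
proof (intro conjI ballI allI impI)
  show "VAL (exp_obj \<chi> ob) = VAL ob" by (rule VAL_exp)
next
  fix op w1 s1 w2 s2
  assume op: "op \<in> set (obj_ops ob)"
    and reach: "(w1, s1, w2, s2) \<in> REACH (op_graph (exp_op \<chi> op)) \<and> s1 \<in> SF op \<and> s2 \<in> SF op"
  interpret correct_operation \<chi> ob op using op by (rule correct_operation)
  show "w1 \<in> ND1_inv \<chi> ob op \<longleftrightarrow> w2 \<in> ND1_inv \<chi> ob op"
    using reach run_Y_ND1_inv unfolding exp_op_simps(1) REACH_iff by blast
next
  fix op assume op: "op \<in> set (obj_ops ob)"
  interpret correct_operation \<chi> ob op using op by (rule correct_operation)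
  show "IO (exp_obj \<chi> ob) (exp_op \<chi> op) = IO ob op" by (rule IO_exp[OF VAL_exp])
qed

end


section \<open>Induction on the degree\<close>

text \<open>The instances of a graph of degree \<open>n\<close> have degree less than \<open>n\<close>, whereas the operations of an
  object of degree \<open>n\<close> may have degree \<open>n\<close>; so graphs rely on objects of smaller degree, and
  objects on graphs of the same degree.\<close>

lemma correct_expansion_step:
  fixes G :: "('i, 'a, 's, 'n) sgraph"
  assumes G: "is_sgraph n G" and choice: "expansion_choice \<chi> G"
    and IH: "\<And>k ob. k < n \<Longrightarrow> is_obj k ob \<Longrightarrow> expansion_choice_obj \<chi> ob \<Longrightarrow> correct_object \<chi> ob"
  shows "correct_expansion \<chi> G"
proof -
  from G have "graph_ok G \<and> (\<forall>inst. inst |\<in>| insts G \<longrightarrow> (\<exists>k<n. is_inst k inst)) \<and>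
    (\<forall>e. e |\<in>| edges G \<longrightarrow> (\<exists>k. is_act k (elab e)))"
  proof (cases rule: is_sgraph.cases)
    case sgraph_0
    then show ?thesis by auto
  next
    case (sgraph_Suc n')
    then show ?thesis by (simp only: less_Suc_eq_le) blast
  qed
  then have G': "graph_ok G" "\<forall>inst. inst |\<in>| insts G \<longrightarrow> (\<exists>k<n. is_inst k inst)"
    "\<forall>e. e |\<in>| edges G \<longrightarrow> (\<exists>k. is_act k (elab e))"
    by blast+
  have choice': "choice_ok \<chi> G" "\<And>inst. inst |\<in>| insts G \<Longrightarrow> expansion_choice_obj \<chi> (inst_obj inst)"
    using choice by (auto elim: expansion_choice.cases simp: expansion_choice_obj_def)
  have object: "correct_object \<chi> (inst_obj inst) \<and> inst_ok inst" if inst: "inst |\<in>| insts G" for inst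
  proof -
    obtain k where k: "k < n" "is_inst k inst" using G'(2) inst by blast
    from k(2) have i: "is_obj k (inst_obj inst)" "dom (inst_map inst) = dom (val_hw (inst_obj inst))"
      "map_injective (inst_map inst)"
      by (cases rule: is_inst.cases; simp)+
    from IH[OF k(1) i(1) choice'(2)[OF inst]] have "correct_object \<chi> (inst_obj inst)" .
    with i show ?thesis by (simp add: inst_ok_def correct_object.obj_ok)
  qed
  have label: "op \<in> set (obj_ops (inst_obj inst)) \<and> dom \<mu> = ext_tapes op \<and> map_injective \<mu> \<and>
      ran \<mu> \<inter> inst_tapes inst = {} \<and> oper_ok op \<and> wf_expansion \<chi> (op_graph op)"
    if e: "e |\<in>| edges G" "elab e = Pos inst op \<mu>" for e inst op \<mu>
  proof -
    obtain k where "is_act k (Pos inst op \<mu>)" using G'(3) e by metis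
    then have act: "op \<in> set (obj_ops (inst_obj inst))" "dom \<mu> = ext_tapes op" "map_injective \<mu>"
      "ran \<mu> \<inter> inst_tapes inst = {}"
      by (cases rule: is_act.cases; simp)+
    have "label_ok G (elab e)" using G'(1) e(1) by (simp add: graph_ok_def)
    then have "inst |\<in>| insts G" by (simp add: e(2))
    then interpret object: correct_object \<chi> "inst_obj inst" using object by blast
    interpret op: correct_operation \<chi> "inst_obj inst" op by (rule object.correct_operation[OF act(1)])
    show ?thesis using act op.oper_ok op.wf_Y by blast
  qed
  show ?thesis
  proof (intro correct_expansion.intro expansion.intro correct_expansion_axioms.intro)
    show "graph_ok G" "choice_ok \<chi> G" by (fact G'(1), fact choice'(1))
  next
    fix inst assume inst: "inst |\<in>| insts G"
    show "inst_ok inst" using object[OF inst] by (rule conjunct2)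
    have "correct_object \<chi> (inst_obj inst)" using object[OF inst] by (rule conjunct1)
    then show "expands_correctly \<chi> (inst_obj inst)" by (rule correct_object.expands_correctly)
  next
    fix e inst op \<mu> assume e: "e |\<in>| edges G" "elab e = Pos inst op \<mu>"
    show "op \<in> set (obj_ops (inst_obj inst)) \<and> dom \<mu> = ext_tapes op \<and> map_injective \<mu> \<and>
      ran \<mu> \<inter> inst_tapes inst = {} \<and> oper_ok op \<and> wf_expansion \<chi> (op_graph op)"
      by (rule label[OF e])
  qed
qed

lemma correct_object_degree:
  "is_obj n ob \<Longrightarrow> expansion_choice_obj \<chi> ob \<Longrightarrow> correct_object \<chi> ob"
proof (induction n arbitrary: ob rule: less_induct)
  case (less n)
  from less.prems(1) obtain ob: "obj_ok ob" "\<forall>op\<in>set (obj_ops ob). \<exists>k\<le>n. is_oper k op"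
  proof (cases rule: is_obj.cases)
    case obj
    with that show thesis by blast
  qed
  have op: "oper_ok op \<and> correct_expansion \<chi> (op_graph op)" if op_ob: "op \<in> set (obj_ops ob)" for op
  proof -
    obtain k where k: "k \<le> n" "is_oper k op" using bspec[OF ob(2) op_ob] by blast
    from k(2) obtain op: "is_sgraph k (op_graph op)" "oper_ok op"
    proof (cases rule: is_oper.cases)
      case oper
      with that show thesis by blast
    qed
    have choice: "expansion_choice \<chi> (op_graph op)"
      using less.prems(2) op_ob by (simp add: expansion_choice_obj_def)
    have "correct_expansion \<chi> (op_graph op)"
    proof (rule correct_expansion_step[OF op(1) choice])
      fix j ob' assume "j < k" "is_obj j ob'" "expansion_choice_obj \<chi> ob'"
      moreover from this(1) k(1) have "j < n" by simp
      ultimately show "correct_object \<chi> ob'" using less.IH by blast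
    qed
    with op(2) show ?thesis by blast
  qed
  show ?case
  proof (rule correct_object.intro)
    show "obj_ok ob" by (rule ob(1))
    show "oper_ok op" if "op \<in> set (obj_ops ob)" for op using op[OF that] by (rule conjunct1)
    show "correct_expansion \<chi> (op_graph op)" if "op \<in> set (obj_ops ob)" for op
      using op[OF that] by (rule conjunct2)
  qed
qed

lemma correct_expansion_S_star:
  "S_star_graph G \<Longrightarrow> expansion_choice \<chi> G \<Longrightarrow> correct_expansion \<chi> G"
  unfolding S_star_graph_def using correct_expansion_step correct_object_degree by blast

theorem theorem8p10:
  fixes G :: "('i::countable, 'a::countable, 's, 'n) sgraph"
    and Ob :: "('i, 'a, 's, 'n) obj"
    and \<chi> :: "('i, 'a, 's, 'n) choice"
  assumes "S_star_graph G" and "S_star_object Ob"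
    and "expansion_choice \<chi> G" and "expansion_choice_obj \<chi> Ob"
  defines "Gexp \<equiv> exp_graph \<chi> G"
    and "one_inv \<equiv> trivial (inv_tapes \<chi> G)"
  shows
    "(\<forall>w1 s1 w2 s2.
        (w1, s1) \<in> configs Gexp \<and> (w2, s2) \<in> configs Gexp \<and>
        s1 |\<in>| states G \<and> s2 |\<in>| states G \<and> (w1, s1, w2, s2) \<in> REACH Gexp
        \<longrightarrow> (w1 \<in> GL1 \<chi> G \<longleftrightarrow> w2 \<in> GL1 \<chi> G))
     \<and>
     (\<forall>cs gs.
        computation Gexp cs gs \<and>
        hd cs \<in> GL1 \<chi> G \<times> fset (states G) \<and> last cs \<in> GL1 \<chi> G \<times> fset (states G)
        \<longrightarrow> (\<exists>cs' gs'. computation G cs' gs' \<and>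
              fst (hd cs) = fst (hd cs') ++ one_inv \<and> fst (last cs) = fst (last cs') ++ one_inv \<and>
              snd (hd cs) = snd (hd cs') \<and> snd (last cs) = snd (last cs') \<and>
              generic_reduction \<chi> G (map under gs) gs'))
     \<and>
     (\<forall>w0 s0 w1 s1 p q e inst op \<mu>.
        computation G [(w0, s0), (w1, s1)] [(p, q, e)] \<and>
        e |\<in>| edges G \<and> elab e = Pos inst op \<mu>
        \<longrightarrow> (let \<mu>a = mu_act (elab e); opx = exp_op \<chi> op in
              (w0 \<circ>\<^sub>m \<mu>a, lam op p, w1 \<circ>\<^sub>m \<mu>a, lam op q) \<in> IO (exp_obj \<chi> (inst_obj inst)) opx
              \<and>
              (\<forall>cs gs.
                 io_computation opx cs gs \<and>
                 hd cs = ((w0 \<circ>\<^sub>m \<mu>a) ++ trivial (int_tapes opx), lam op p) \<and>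
                 last cs = ((w1 \<circ>\<^sub>m \<mu>a) ++ trivial (int_tapes opx), lam op q)
                 \<longrightarrow> (\<exists>cs' gs'. computation Gexp cs' gs' \<and> length gs' = length gs \<and>
                       hd cs' = (w0 ++ one_inv, s0) \<and> last cs' = (w1 ++ one_inv, s1) \<and>
                       (\<forall>j\<le>length gs.
                          fst (cs' ! j) =
                            reindex (mu_edge (\<chi> G e) e) (fst (cs ! j)) ++
                            (w0 |` (dom (hw G) - ran \<mu>a)) ++
                            trivial (inv_tapes \<chi> G - ran (copy_tape (\<chi> G e))))))))
     \<and>
     (\<forall>cs' gs'.
        computation G cs' gs'
        \<longrightarrow> (\<exists>cs gs. computation Gexp cs gs \<and>
              hd cs \<in> GL1 \<chi> G \<times> fset (states G) \<and> last cs \<in> GL1 \<chi> G \<times> fset (states G) \<and>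
              fst (hd cs) = fst (hd cs') ++ one_inv \<and> fst (last cs) = fst (last cs') ++ one_inv \<and>
              snd (hd cs) = snd (hd cs') \<and> snd (last cs) = snd (last cs')))
     \<and>
     VAL (exp_obj \<chi> Ob) = VAL Ob
     \<and>
     (\<forall>op\<in>set (obj_ops Ob). \<forall>w1 s1 w2 s2.
        (w1, s1, w2, s2) \<in> REACH (op_graph (exp_op \<chi> op)) \<and> s1 \<in> SF op \<and> s2 \<in> SF op
        \<longrightarrow> (w1 \<in> ND1_inv \<chi> Ob op \<longleftrightarrow> w2 \<in> ND1_inv \<chi> Ob op))
     \<and>
     (\<forall>op\<in>set (obj_ops Ob). IO (exp_obj \<chi> Ob) (exp_op \<chi> op) = IO Ob op)"
proof -
  interpret correct_expansion \<chi> G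
    using assms(1,3) by (rule correct_expansion_S_star)
  have good_Ob: "expands_correctly \<chi> Ob"
    using assms(2,4) correct_object_degree correct_object.expands_correctly
    unfolding S_star_object_def by blast
  have a: "w1 \<in> GL1 \<chi> G \<longleftrightarrow> w2 \<in> GL1 \<chi> G"
    if "s1 |\<in>| states G" "s2 |\<in>| states G" "(w1, s1, w2, s2) \<in> REACH Gexp" for w1 s1 w2 s2
    using that run_reduction unfolding REACH_iff Gexp_def by blast
  have b: "\<exists>cs' gs'. computation G cs' gs' \<and>
      fst (hd cs) = fst (hd cs') ++ one_inv \<and> fst (last cs) = fst (last cs') ++ one_inv \<and>
      snd (hd cs) = snd (hd cs') \<and> snd (last cs) = snd (last cs') \<and>
      generic_reduction \<chi> G (map under gs) gs'"
    if cs: "computation Gexp cs gs" "hd cs \<in> GL1 \<chi> G \<times> fset (states G)"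
      "last cs \<in> GL1 \<chi> G \<times> fset (states G)" for cs gs
  proof -
    obtain w s w' s' where ends: "hd cs = (w, s)" "last cs = (w', s')" by (cases "hd cs"; cases "last cs")
    have run: "run (exp_graph \<chi> G) (w, s) gs (w', s')"
      using computation_run[OF cs(1)] ends by (simp add: Gexp_def)
    have proper: "w \<in> GL1 \<chi> G" "s |\<in>| states G" "w' \<in> GL1 \<chi> G" "s' |\<in>| states G"
      using cs(2,3) ends by simp_all
    obtain \<pi>s gs' where G: "run G (visible w, s) gs' (visible w', s')"
      and red: "map under gs = concat \<pi>s" "\<forall>\<pi>\<in>set \<pi>s. piece G \<pi>" "list_all2 (replaces \<chi> G) \<pi>s gs'"
      using run_reduction[OF run proper(2,4)] proper(1) by blast
    obtain cs' where cs': "computation G cs' gs'" "hd cs' = (visible w, s)" "last cs' = (visible w', s')"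
      using run_computation[OF G] .
    have "generic_reduction \<chi> G (map under gs) gs'"
      unfolding generic_reduction_def
      using edge_path_run[OF run] run_path[OF G] red by auto
    moreover have "w = visible w ++ one_inv" "w' = visible w' ++ one_inv"
      using proper GL1_visible unfolding one_inv_def by blast+
    ultimately show ?thesis using cs' ends by (intro exI[of _ cs'] exI[of _ gs']) simp
  qed
  have c: "(w0 \<circ>\<^sub>m mu_act (elab e), lam op p, w1 \<circ>\<^sub>m mu_act (elab e), lam op q)
        \<in> IO (exp_obj \<chi> (inst_obj inst)) (exp_op \<chi> op) \<and>
      (\<forall>cs gs. io_computation (exp_op \<chi> op) cs gs \<and>
         hd cs = ((w0 \<circ>\<^sub>m mu_act (elab e)) ++ trivial (int_tapes (exp_op \<chi> op)), lam op p) \<and>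
         last cs = ((w1 \<circ>\<^sub>m mu_act (elab e)) ++ trivial (int_tapes (exp_op \<chi> op)), lam op q)
         \<longrightarrow> (\<exists>cs' gs'. computation Gexp cs' gs' \<and> length gs' = length gs \<and>
               hd cs' = (w0 ++ one_inv, s0) \<and> last cs' = (w1 ++ one_inv, s1) \<and>
               (\<forall>j\<le>length gs. fst (cs' ! j) = reindex (mu_edge (\<chi> G e) e) (fst (cs ! j)) ++
                  (w0 |` (dom (hw G) - ran (mu_act (elab e)))) ++
                  trivial (inv_tapes \<chi> G - ran (copy_tape (\<chi> G e))))))"
    if comp: "computation G [(w0, s0), (w1, s1)] [(p, q, e)]"
      and e: "e |\<in>| edges G" "elab e = Pos inst op \<mu>" for w0 s0 w1 s1 p q e inst op \<mu>
  proof -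
    interpret e: positive_edge \<chi> G e inst op \<mu>
      using e by unfold_locales
    have step: "step G (w0, s0) (p, q, e) (w1, s1)" using comp by (simp add: computation_Cons)
    have "computation (exp_graph \<chi> (op_graph op)) cs gs" if "io_computation (exp_op \<chi> op) cs gs" for cs gs
      using that by (simp add: io_computation_def io_computation_param_def computation_def)
    then show ?thesis
      using e.generic_edge_IO[OF good[OF e.inst] step] e.generic_edge_computation[OF step]
      unfolding Gexp_def one_inv_def by blast
  qed
  have d: "\<exists>cs gs. computation Gexp cs gs \<and>
      hd cs \<in> GL1 \<chi> G \<times> fset (states G) \<and> last cs \<in> GL1 \<chi> G \<times> fset (states G) \<and>
      fst (hd cs) = fst (hd cs') ++ one_inv \<and> fst (last cs) = fst (last cs') ++ one_inv \<and>
      snd (hd cs) = snd (hd cs') \<and> snd (last cs) = snd (last cs')"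
    if cs': "computation G cs' gs'" for cs' gs'
  proof -
    obtain w s w' s' where ends: "hd cs' = (w, s)" "last cs' = (w', s')"
      by (cases "hd cs'"; cases "last cs'")
    have run: "run G (w, s) gs' (w', s')" using computation_run[OF cs'] ends by simp
    from run_configs[OF run]
    have conf: "w \<in> GL G" "s |\<in>| states G" "w' \<in> GL G" "s' |\<in>| states G"
      by (simp_all add: configs_def)
    obtain gs where "run (exp_graph \<chi> G) (w ++ trivial (inv_tapes \<chi> G), s) gs (w' ++ trivial (inv_tapes \<chi> G), s')"
      using run_lift[OF run] by blast
    then obtain cs where "computation Gexp cs gs" "hd cs = (w ++ one_inv, s)" "last cs = (w' ++ one_inv, s')"
      unfolding Gexp_def one_inv_def by (rule run_computation)
    then show ?thesis
      using ends conf add_one_inv_GL1 unfolding one_inv_def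
      by (intro exI[of _ cs] exI[of _ gs]) simp
  qed
  have e: "VAL (exp_obj \<chi> Ob) = VAL Ob"
    and f: "\<forall>op\<in>set (obj_ops Ob). \<forall>w1 s1 w2 s2.
        (w1, s1, w2, s2) \<in> REACH (op_graph (exp_op \<chi> op)) \<and> s1 \<in> SF op \<and> s2 \<in> SF op
        \<longrightarrow> (w1 \<in> ND1_inv \<chi> Ob op \<longleftrightarrow> w2 \<in> ND1_inv \<chi> Ob op)"
    and g: "\<forall>op\<in>set (obj_ops Ob). IO (exp_obj \<chi> Ob) (exp_op \<chi> op) = IO Ob op"
    using good_Ob unfolding expands_correctly_def by blast+
  show ?thesis
    unfolding Let_def
  proof (intro conjI)
    show "\<forall>w1 s1 w2 s2. (w1, s1) \<in> configs Gexp \<and> (w2, s2) \<in> configs Gexp \<and>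
        s1 |\<in>| states G \<and> s2 |\<in>| states G \<and> (w1, s1, w2, s2) \<in> REACH Gexp
        \<longrightarrow> (w1 \<in> GL1 \<chi> G \<longleftrightarrow> w2 \<in> GL1 \<chi> G)"
      using a by blast
  qed ((intro allI impI, (elim conjE)?, rule b c d; assumption) | rule e f g)+
qed

end
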